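(* Assume that $(\Delta-1)\sigma\in L^1(\mathbb R^3)$; that $\Sigma(\theta)$ is positive definite for a.e. $\theta\in\Pi^*\setminus\Gamma^*$ (Wiener condition); and that $\hat\sigma(2\pi m)=0$ for all $m\in\mathbb Z^3\setminus\{0\}$ (Jellium condition). Let $Q$ be a compact subset of $\Pi^*_+$. Then there is $\varepsilon(Q)>0$ such that $$|\omega_k(\theta)|\ge\varepsilon(Q)\,k^{2/3},\qquad k\ge1,\quad\theta\in Q .$$
   Context: All spaces are complex. Fix constants $e>0$, $M>0$, $Z>0$, and a real function $\sigma\in L^1(\mathbb R^3)$ with $\int_{\mathbb R^3}\sigma\,dx=eZ$. Put $\hat\sigma(\xi)=\int e^{i\xi\cdot x}\sigma(x)\,dx$, $\Gamma^*=2\pi\mathbb Z^3$, $\Pi^*=[0,2\pi]^3$, $\mathbb T=\mathbb R^3/\mathbb Z^3$, $\psi^0=\sqrt Z$, and $$\Sigma(\theta)=\sum_{m\in\mathbb Z^3}\Big[\frac{\xi\otimes\xi}{|\xi|^2}|\hat\sigma(\xi)|^2\Big]_{\xi=2\pi m+\theta},\qquad \Pi^*_+=\{\theta\in\Pi^*\setminus\Gamma^*:\Sigma(\theta)>0\},$$ where $\xi\otimes\xi=(\xi_i\xi_j)$. Let $\mathcal X^s(\mathbb T)=H^s(\mathbb T)\oplus H^s(\mathbb T)\oplus\mathbb C^3\oplus\mathbb C^3$. For $\theta\in\Pi^*\setminus\Gamma^*$ let $$\tilde B(\theta)=\begin{pmatrix}2\tilde H^0(\theta)+4e^2\psi^0\tilde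 G(\theta)\psi^0&0&2\tilde S(\theta)&0\\0&2\tilde H^0(\theta)&0&0\\2\tilde S^*(\theta)&0&\tilde T(\theta)&0\\0&0&0&M^{-1}\end{pmatrix},\qquad J=\begin{pmatrix}0&\frac12&0&0\\-\frac12&0&0&0\\0&0&0&1\\0&0&-1&0\end{pmatrix},$$ with domain $\mathcal X^2(\mathbb T)$ in $\mathcal X^0(\mathbb T)$ for $\tilde B(\theta)$, where $\tilde H^0(\theta)=\frac12(i\nabla+\theta)^2$, $\tilde G(\theta)=(i\nabla+\theta)^{-2}$, $\tilde S(\theta)q=e\psi^0\tilde G(\theta)[(\nabla-i\theta)\tilde\sigma(\theta,\cdot)\cdot q]$ for $q\in\mathbb C^3$, $\tilde\sigma(\theta,y)=\sum_{n\in\mathbb Z^3}e^{i\theta\cdot(n+y)}\sigma(n+y)$, $\tilde T(\theta)=\Sigma(\theta)$. Under the stated conditions $\tilde B(\theta)$ is selfadjoint and nonnegative, and for $\theta\in\Pi^*_+$ it satisfies $\langle\tilde Y,\tilde B(\theta)\tilde Y\rangle\ge\varkappa(\theta)\|\tilde Y\|^2_{\mathcal X^1(\mathbb T)}$ with some $\varkappa(\theta)>0$. Put $\tilde\Lambda(\theta)=\tilde B(\theta)^{1/2}$ and $\tilde K(\theta)=\tilde\Lambda(\theta)\,iJ\,\tilde\Lambda(\theta)$; for $\theta\in\Pi^*_+$ this is a selfadjoint operator in $\mathcal X^0(\mathbb T)$ with compact inverse. Its (real, nonzero) eigenvalues, the dispersion relations, are denoted $\omega_k(\theta)$, $k\ge1$,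 counted with multiplicity and ordered so that $|\omega_1(\theta)|\le|\omega_2(\theta)|\le\dots$. *)

theory Defs
  imports "HOL-Analysis.Analysis"
begin

section \<open>Test functions\<close>

definition partial_deriv :: "3 \<Rightarrow> (real^3 \<Rightarrow> 'a::real_normed_vector) \<Rightarrow> real^3 \<Rightarrow> 'a" where
  "partial_deriv j \<phi> x = vector_derivative (\<lambda>t. \<phi> (x + t *\<^sub>R axis j 1)) (at 0)"

primrec C_k :: "nat \<Rightarrow> (real^3 \<Rightarrow> 'a::real_normed_vector) \<Rightarrow> bool" where
  "C_k 0 \<phi> \<longleftrightarrow> continuous_on UNIV \<phi>"
| "C_k (Suc k) \<phi> \<longleftrightarrow> continuous_on UNIV \<phi> \<and>
     (\<forall>j. (\<forall>x. (\<lambda>t. \<phi> (x + t *\<^sub>R axis j 1)) differentiable (at 0)) \<and> C_k k (partial_deriv j \<phi>))"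

definition smooth :: "(real^3 \<Rightarrow> 'a::real_normed_vector) \<Rightarrow> bool" where
  "smooth \<phi> \<longleftrightarrow> (\<forall>k. C_k k \<phi>)"

definition laplacian :: "(real^3 \<Rightarrow> 'a::real_normed_vector) \<Rightarrow> real^3 \<Rightarrow> 'a" where
  "laplacian \<phi> x = (\<Sum>j\<in>UNIV. partial_deriv j (partial_deriv j \<phi>) x)"

text \<open>\<open>(\<Delta> - 1) \<sigma> \<in> L\<^sup>1(\<real>\<^sup>3)\<close>, with the derivatives in the sense of distributions.\<close>

definition helmholtz_L1 :: "(real^3 \<Rightarrow> real) \<Rightarrow> bool" where
  "helmholtz_L1 \<sigma> \<longleftrightarrow> (\<exists>g. integrable lborel g \<and>
     (\<forall>\<phi>::real^3 \<Rightarrow> real. smooth \<phi> \<and> compact (closure {x. \<phi> x \<noteq> 0}) \<longrightarrow>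
        (LINT x|lborel. \<sigma> x * (laplacian \<phi> x - \<phi> x)) = (LINT x|lborel. g x * \<phi> x)))"


section \<open>Lattices and the matrix \<open>\<Sigma>(\<theta>)\<close>\<close>

definition ivec :: "int^3 \<Rightarrow> real^3" where
  "ivec m = (\<chi> i. of_int (m $ i))"

definition Gamma_star :: "(real^3) set" where
  "Gamma_star = range (\<lambda>m. (2 * pi) *\<^sub>R ivec m)"

definition Pi_star :: "(real^3) set" where
  "Pi_star = cbox 0 (\<chi> i. 2 * pi)"

definition fourier :: "(real^3 \<Rightarrow> real) \<Rightarrow> real^3 \<Rightarrow> complex" where
  "fourier \<sigma> \<xi> = (LINT x|lborel. exp (\<i> * of_real (\<xi> \<bullet> x)) * of_real (\<sigma> x))"

definition Sigma_summand :: "(real^3 \<Rightarrow> real) \<Rightarrow> real^3 \<Rightarrow> real^3^3" where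
  "Sigma_summand \<sigma> \<xi> = (\<chi> i j. \<xi> $ i * \<xi> $ j / (norm \<xi>)\<^sup>2 * (cmod (fourier \<sigma> \<xi>))\<^sup>2)"

definition Sigma_mat :: "(real^3 \<Rightarrow> real) \<Rightarrow> real^3 \<Rightarrow> real^3^3" where
  "Sigma_mat \<sigma> \<theta> = (\<Sum>\<^sub>\<infinity>m. Sigma_summand \<sigma> ((2 * pi) *\<^sub>R ivec m + \<theta>))"

definition positive_definite :: "real^'n^'n \<Rightarrow> bool" where
  "positive_definite A \<longleftrightarrow> transpose A = A \<and> (\<forall>x. x \<noteq> 0 \<longrightarrow> 0 < x \<bullet> (A *v x))"

definition Pi_star_plus :: "(real^3 \<Rightarrow> real) \<Rightarrow> (real^3) set" where
  "Pi_star_plus \<sigma> = {\<theta> \<in> Pi_star - Gamma_star. positive_definite (Sigma_mat \<sigma> \<theta>)}"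


section \<open>The space \<open>L\<^sup>2(\<T>)\<close>\<close>

text \<open>Functions on the torus are represented by functions on \<open>\<real>\<^sup>3\<close> of which only the values on the
  unit cell \<open>[0,1]\<^sup>3\<close> matter.\<close>

definition cell :: "(real^3) measure" where
  "cell = restrict_space lborel (cbox 0 1)"

definition square_integrable :: "(real^3 \<Rightarrow> complex) \<Rightarrow> bool" where
  "square_integrable f \<longleftrightarrow> f \<in> borel_measurable cell \<and> integrable cell (\<lambda>x. (cmod (f x))\<^sup>2)"

definition L2_eq :: "(real^3 \<Rightarrow> complex) \<Rightarrow> (real^3 \<Rightarrow> complex) \<Rightarrow> bool" where
  "L2_eq f g \<longleftrightarrow> square_integrable f \<and> square_integrable g \<and> (AE x in cell. f x = g x)"

lemma square_integrable_zero: "square_integrable (\<lambda>x. 0)"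
  by (simp add: square_integrable_def)

lemma square_integrable_scale:
  assumes "square_integrable f" shows "square_integrable (\<lambda>x. c * f x)"
  using assms by (auto simp: square_integrable_def norm_mult power_mult_distrib)

lemma square_integrable_add:
  assumes f: "square_integrable f" and g: "square_integrable g"
  shows "square_integrable (\<lambda>x. f x + g x)"
proof -
  have [measurable]: "f \<in> borel_measurable cell" "g \<in> borel_measurable cell"
    using f g by (auto simp: square_integrable_def)
  have bound: "(cmod (a + b))\<^sup>2 \<le> 2 * (cmod a)\<^sup>2 + 2 * (cmod b)\<^sup>2" for a b
  proof -
    have "(cmod (a + b))\<^sup>2 \<le> (cmod a + cmod b)\<^sup>2"
      by (intro power_mono norm_triangle_ineq) auto
    also have "\<dots> \<le> 2 * (cmod a)\<^sup>2 + 2 * (cmod b)\<^sup>2"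
      using zero_le_power2[of "cmod a - cmod b"] by (simp add: power2_eq_square algebra_simps)
    finally show ?thesis .
  qed
  have "integrable cell (\<lambda>x. (cmod (f x + g x))\<^sup>2)"
  proof (rule Bochner_Integration.integrable_bound)
    show "integrable cell (\<lambda>x. 2 * (cmod (f x))\<^sup>2 + 2 * (cmod (g x))\<^sup>2)"
      using f g by (auto simp: square_integrable_def)
    show "AE x in cell. norm ((cmod (f x + g x))\<^sup>2) \<le> norm (2 * (cmod (f x))\<^sup>2 + 2 * (cmod (g x))\<^sup>2)"
      using bound by (auto intro!: AE_I2)
  qed auto
  then show ?thesis by (simp add: square_integrable_def)
qed

quotient_type L2T = "real^3 \<Rightarrow> complex" / partial: L2_eq
proof (rule part_equivpI)
  show "\<exists>f. L2_eq f f"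
    using square_integrable_zero by (auto simp: L2_eq_def)
  show "symp L2_eq"
    by (auto simp: symp_def L2_eq_def)
  show "transp L2_eq"
    by (rule transpI) (auto simp: L2_eq_def elim: AE_mp)
qed

instantiation L2T :: ab_group_add
begin

lift_definition zero_L2T :: L2T is "\<lambda>x. 0"
  by (simp add: L2_eq_def square_integrable_zero)

lift_definition plus_L2T :: "L2T \<Rightarrow> L2T \<Rightarrow> L2T" is "\<lambda>f g x. f x + g x"
  by (auto simp: L2_eq_def square_integrable_add elim: AE_mp)

lift_definition uminus_L2T :: "L2T \<Rightarrow> L2T" is "\<lambda>f x. - f x"
  using square_integrable_scale[of _ "-1"] by (auto simp: L2_eq_def)

definition minus_L2T :: "L2T \<Rightarrow> L2T \<Rightarrow> L2T" where
  "minus_L2T u v = u + - v"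

instance
proof
  fix a b c :: L2T
  show "a + b + c = a + (b + c)"
    by transfer (auto simp: L2_eq_def add.assoc intro!: square_integrable_add)
  show "a + b = b + a"
    by transfer (auto simp: L2_eq_def add.commute intro!: square_integrable_add)
  show "0 + a = a"
    by transfer (auto simp: L2_eq_def)
  show "- a + a = 0"
    by transfer (auto simp: L2_eq_def square_integrable_zero)
  show "a - b = a + - b"
    by (rule minus_L2T_def)
qed

end

lift_definition scale_L2 :: "complex \<Rightarrow> L2T \<Rightarrow> L2T" is "\<lambda>c f x. c * f x"
  by (auto simp: L2_eq_def square_integrable_scale elim: AE_mp)

text \<open>The integrals below involve \<^const>\<open>rep_L2T\<close>, a choice of representative, on which their values do
  not depend.\<close>

definition inner_L2 :: "L2T \<Rightarrow> L2T \<Rightarrow> complex" where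
  "inner_L2 u v = (LINT x|cell. rep_L2T u x * cnj (rep_L2T v x))"

definition fcoef :: "L2T \<Rightarrow> int^3 \<Rightarrow> complex" where
  "fcoef u m = (LINT x|cell. exp (\<i> * of_real (2 * pi * (ivec m \<bullet> x))) * rep_L2T u x)"

definition sobolev :: "real \<Rightarrow> L2T set" where
  "sobolev s = {u. (\<lambda>m. (1 + (norm (ivec m))\<^sup>2) powr s * (cmod (fcoef u m))\<^sup>2) summable_on UNIV}"


section \<open>Distributions on the torus and the operators \<open>H\<^sup>0\<close>, \<open>G\<close>, \<open>S\<close>\<close>

definition torus_test_functions :: "(real^3 \<Rightarrow> complex) set" where
  "torus_test_functions = {\<phi>. smooth \<phi> \<and> (\<forall>x j. \<phi> (x + axis j 1) = \<phi> x)}"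

text \<open>Distributions are functionals on \<^const>\<open>torus_test_functions\<close>; the pairing is bilinear (without
  complex conjugation).\<close>

type_synonym dist = "(real^3 \<Rightarrow> complex) \<Rightarrow> complex"

definition dist_eq :: "dist \<Rightarrow> dist \<Rightarrow> bool" where
  "dist_eq u v \<longleftrightarrow> (\<forall>\<phi>\<in>torus_test_functions. u \<phi> = v \<phi>)"

definition dist_of_fun :: "(real^3 \<Rightarrow> complex) \<Rightarrow> dist" where
  "dist_of_fun f \<phi> = (LINT x|cell. f x * \<phi> x)"

definition dist_of :: "L2T \<Rightarrow> dist" where
  "dist_of u = dist_of_fun (rep_L2T u)"

definition dist_deriv :: "3 \<Rightarrow> dist \<Rightarrow> dist" where
  "dist_deriv j u \<phi> = - u (partial_deriv j \<phi>)"

text \<open>\<open>i\<partial>\<^sub>j + \<theta>\<^sub>j\<close> and \<open>(i\<nabla> + \<theta>)\<^sup>2\<close>\<close>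

definition bloch_deriv :: "real^3 \<Rightarrow> 3 \<Rightarrow> dist \<Rightarrow> dist" where
  "bloch_deriv \<theta> j u \<phi> = \<i> * dist_deriv j u \<phi> + of_real (\<theta> $ j) * u \<phi>"

definition bloch_laplacian :: "real^3 \<Rightarrow> dist \<Rightarrow> dist" where
  "bloch_laplacian \<theta> u \<phi> = (\<Sum>j\<in>UNIV. bloch_deriv \<theta> j (bloch_deriv \<theta> j u) \<phi>)"

text \<open>The graph of \<open>H\<^sup>0(\<theta>)\<close> with domain \<open>H\<^sup>2(\<T>)\<close>\<close>

definition H0_op :: "real^3 \<Rightarrow> (L2T \<times> L2T) set" where
  "H0_op \<theta> = {(u, f). u \<in> sobolev 2 \<and>
     dist_eq (\<lambda>\<phi>. 1/2 * bloch_laplacian \<theta> (dist_of u) \<phi>) (dist_of f)}"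

text \<open>\<open>G(\<theta>)\<close> is applied to elements of \<open>L\<^sup>2(\<T>)\<close> and to the distribution \<open>(\<nabla> - i\<theta>) \<sigma>(\<theta>,\<cdot>) \<cdot> q\<close>, which
  need not be in \<open>L\<^sup>2(\<T>)\<close>. In both cases the result lies in \<open>L\<^sup>2(\<T>)\<close>, and for
  \<open>\<theta> \<notin> \<Gamma>\<^sup>*\<close> it is unique.\<close>

definition G_op :: "real^3 \<Rightarrow> dist \<Rightarrow> L2T" where
  "G_op \<theta> F = (THE u. dist_eq (bloch_laplacian \<theta> (dist_of u)) F)"

definition sigma_tilde :: "(real^3 \<Rightarrow> real) \<Rightarrow> real^3 \<Rightarrow> real^3 \<Rightarrow> complex" where
  "sigma_tilde \<sigma> \<theta> y =
     (\<Sum>\<^sub>\<infinity>n. exp (\<i> * of_real (\<theta> \<bullet> (ivec n + y))) * of_real (\<sigma> (ivec n + y)))"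

text \<open>\<open>(\<nabla> - i\<theta>) \<sigma>(\<theta>,\<cdot>) \<cdot> q\<close>\<close>

definition S_source :: "(real^3 \<Rightarrow> real) \<Rightarrow> real^3 \<Rightarrow> complex^3 \<Rightarrow> dist" where
  "S_source \<sigma> \<theta> q \<phi> =
     (\<Sum>j\<in>UNIV. q $ j * (dist_deriv j (dist_of_fun (sigma_tilde \<sigma> \<theta>)) \<phi>
        - \<i> * of_real (\<theta> $ j) * dist_of_fun (sigma_tilde \<sigma> \<theta>) \<phi>))"

definition S_op :: "real \<Rightarrow> real \<Rightarrow> (real^3 \<Rightarrow> real) \<Rightarrow> real^3 \<Rightarrow> complex^3 \<Rightarrow> L2T" where
  "S_op e Z \<sigma> \<theta> q = scale_L2 (of_real (e * sqrt Z)) (G_op \<theta> (S_source \<sigma> \<theta> q))"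

definition inner_C3 :: "complex^3 \<Rightarrow> complex^3 \<Rightarrow> complex" where
  "inner_C3 p q = (\<Sum>j\<in>UNIV. p $ j * cnj (q $ j))"

definition S_adj :: "real \<Rightarrow> real \<Rightarrow> (real^3 \<Rightarrow> real) \<Rightarrow> real^3 \<Rightarrow> L2T \<Rightarrow> complex^3" where
  "S_adj e Z \<sigma> \<theta> u = (THE p. \<forall>q. inner_C3 p q = inner_L2 u (S_op e Z \<sigma> \<theta> q))"

definition T_op :: "(real^3 \<Rightarrow> real) \<Rightarrow> real^3 \<Rightarrow> complex^3 \<Rightarrow> complex^3" where
  "T_op \<sigma> \<theta> q = (\<chi> i j. of_real (Sigma_mat \<sigma> \<theta> $ i $ j)) *v q"


section \<open>The space \<open>X\<^sup>0(\<T>)\<close> and unbounded operators in it\<close>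

type_synonym state = "L2T \<times> L2T \<times> (complex^3) \<times> (complex^3)"

definition scale_X :: "complex \<Rightarrow> state \<Rightarrow> state" where
  "scale_X c = (\<lambda>(u, v, q, p). (scale_L2 c u, scale_L2 c v, c *s q, c *s p))"

global_interpretation X: vector_space scale_X
  defines X_span = X.span and X_dependent = X.dependent
proof
  have L: "scale_L2 a (u + v) = scale_L2 a u + scale_L2 a v"
    "scale_L2 (a + b) u = scale_L2 a u + scale_L2 b u"
    "scale_L2 a (scale_L2 b u) = scale_L2 (a * b) u" "scale_L2 1 u = u" for a b u v
    by (transfer; auto simp: L2_eq_def algebra_simps
        intro!: square_integrable_add square_integrable_scale)+
  fix a b :: complex and x y :: state
  show "scale_X a (x + y) = scale_X a x + scale_X a y"
    "scale_X (a + b) x = scale_X a x + scale_X b x"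
    "scale_X a (scale_X b x) = scale_X (a * b) x" "scale_X 1 x = x"
    by (cases x; cases y; simp add: scale_X_def L vec_eq_iff algebra_simps)+
qed

definition inner_X :: "state \<Rightarrow> state \<Rightarrow> complex" where
  "inner_X = (\<lambda>(u, v, q, p) (u', v', q', p').
     inner_L2 u u' + inner_L2 v v' + inner_C3 q q' + inner_C3 p p')"

definition norm_X :: "state \<Rightarrow> real" where
  "norm_X x = sqrt (Re (inner_X x x))"

text \<open>An operator is given by its graph.\<close>

type_synonym oper = "(state \<times> state) set"

definition adjoint_oper :: "oper \<Rightarrow> oper" where
  "adjoint_oper A = {(y, z). \<forall>(x, w)\<in>A. inner_X w y = inner_X x z}"

text \<open>The graph of an adjoint is a linear subspace, so that the following implies linearity.\<close>

definition selfadjoint_oper :: "oper \<Rightarrow> bool" where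
  "selfadjoint_oper A \<longleftrightarrow> single_valued A \<and>
     (\<forall>x. \<forall>\<epsilon>>0. \<exists>y\<in>Domain A. norm_X (x - y) < \<epsilon>) \<and> adjoint_oper A = A"

definition nonneg_oper :: "oper \<Rightarrow> bool" where
  "nonneg_oper A \<longleftrightarrow> (\<forall>(x, y)\<in>A. inner_X y x \<in> \<real> \<and> 0 \<le> Re (inner_X y x))"

text \<open>\<open>L = A\<^bsup>1/2\<^esup>\<close>, the nonnegative selfadjoint square root\<close>

definition is_sqrt_oper :: "oper \<Rightarrow> oper \<Rightarrow> bool" where
  "is_sqrt_oper L A \<longleftrightarrow> selfadjoint_oper L \<and> nonneg_oper L \<and> L O L = A"

definition eigenspace :: "oper \<Rightarrow> complex \<Rightarrow> state set" where
  "eigenspace A \<mu> = {x. (x, scale_X \<mu> x) \<in> A}"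

text \<open>\<open>\<omega> 1, \<omega> 2, \<dots>\<close> are the eigenvalues of \<open>A\<close> counted with multiplicity and ordered by absolute value:
  the indices \<open>k\<close> with \<open>\<omega> k = \<mu>\<close> label a basis of the eigenspace of \<open>\<mu>\<close>. The value \<open>\<omega> 0\<close> is ignored.\<close>

definition eigenvalue_enumeration :: "oper \<Rightarrow> (nat \<Rightarrow> real) \<Rightarrow> bool" where
  "eigenvalue_enumeration A \<omega> \<longleftrightarrow>
     (\<forall>j k. 1 \<le> j \<and> j \<le> k \<longrightarrow> \<bar>\<omega> j\<bar> \<le> \<bar>\<omega> k\<bar>) \<and>
     (\<forall>\<mu>. \<exists>v. let I = {k. 1 \<le> k \<and> complex_of_real (\<omega> k) = \<mu>} in
        inj_on v I \<and> \<not> X_dependent (v ` I) \<and> X_span (v ` I) = eigenspace A \<mu>)"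


section \<open>The operators \<open>B(\<theta>)\<close>, \<open>J\<close> and \<open>K(\<theta>)\<close>\<close>

text \<open>The domain \<open>X\<^sup>2(\<T>)\<close> of \<open>B(\<theta>)\<close> is enforced by that of \<^const>\<open>H0_op\<close>.\<close>

definition B_op :: "real \<Rightarrow> real \<Rightarrow> real \<Rightarrow> (real^3 \<Rightarrow> real) \<Rightarrow> real^3 \<Rightarrow> oper" where
  "B_op e M Z \<sigma> \<theta> = {((u, v, q, p),
       (scale_L2 2 f + scale_L2 (of_real (4 * e\<^sup>2 * sqrt Z)) (G_op \<theta> (dist_of (scale_L2 (of_real (sqrt Z)) u)))
          + scale_L2 2 (S_op e Z \<sigma> \<theta> q),
        scale_L2 2 g,
        2 *s S_adj e Z \<sigma> \<theta> u + T_op \<sigma> \<theta> q,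
        of_real (inverse M) *s p)) | u v q p f g.
     (u, f) \<in> H0_op \<theta> \<and> (v, g) \<in> H0_op \<theta>}"

definition J_op :: "state \<Rightarrow> state" where
  "J_op = (\<lambda>(u, v, q, p). (scale_L2 (1/2) v, scale_L2 (-1/2) u, p, - q))"

definition iJ_op :: oper where
  "iJ_op = {(x, scale_X \<i> (J_op x)) | x. True}"

text \<open>\<open>\<Lambda> iJ \<Lambda>\<close> as a function of \<open>\<Lambda>\<close>, with its natural domain\<close>

definition K_op :: "oper \<Rightarrow> oper" where
  "K_op \<Lambda> = \<Lambda> O iJ_op O \<Lambda>"

end

theory Submission
  imports Defs
begin

text \<open>An eigenvector \<open>x = \<Lambda> z\<close> of \<open>K = \<Lambda> iJ \<Lambda>\<close> with eigenvalue \<open>\<omega> \<noteq> 0\<close> yields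
  \<open>iJ B z = \<omega> z\<close>. On the span of the \<open>z\<close> that belong to eigenvalues of one sign in
  \<open>[- r, r]\<close> one has \<open>\<langle>z, B z\<rangle> \<le> 2 r \<parallel>z\<parallel>\<^sup>2\<close>, because \<open>(iJ)\<^sup>-\<^sup>1\<close> has norm 2. In Fourier variables
  with \<open>\<xi> = 2 \<pi> m + \<theta>\<close> the form of \<open>B\<close> is a sum of squares,
  \<open>\<Sum>\<^sub>m |\<xi>|\<^sup>2 (|u\<^sub>m|\<^sup>2 + |v\<^sub>m|\<^sup>2) + |\<xi>|\<^sup>-\<^sup>2 |2 e \<surd>Z u\<^sub>m - i \<xi>\<cdot>q \<sigma>(\<xi>)|\<^sup>2 + |p|\<^sup>2 / M\<close>,
  so it is coercive uniformly for \<open>\<theta>\<close> in the compact set \<open>Q\<close> and exceeds \<open>c (1 + R\<^sup>2) \<parallel>z\<parallel>\<^sup>2\<close> when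
  \<open>q\<close>, \<open>p\<close> and all modes with \<open>|m| \<le> R\<close> vanish. For \<open>R\<^sup>2\<close> of order \<open>r\<close> the span therefore has at
  most as many dimensions as there are such modes, that is \<open>O(R\<^sup>3) = O(r\<^sup>3\<^sup>/\<^sup>2)\<close>.\<close>

section \<open>Integration over the unit cell\<close>

text \<open>Treating one sign of the eigenvalues at a time is essential: the estimate rests on the
  form of the inverse of K on a combination X of eigenvectors, where contributions of opposite sign
  would cancel. The price is a factor 2 in the count.

  The count is made on coefficients. If there are more of them than low modes, some nonzero choice
  kills all low modes of the combination Z of the vectors z. It still gives X = \<Lambda> Z \<noteq>
  0, because eigenvectors for different eigenvalues are orthogonal and those for one eigenvalue are
  independent. Since \<langle>Z, B Z\<rangle> is the squared norm of X, upper and lower bound then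
  collide.

  G(\<theta>) and the adjoint of S(\<theta>) are given by definite descriptions, so their Fourier
  form needs existence as well as uniqueness. Hence the first half identifies L^2 of the torus with
  l^2: uniqueness of coefficients, Riesz-Fischer, Parseval.

  With C the coercivity constant, the cutoff is R^2 = 2 C |\<omega>_k|. As C is at least 1/c, this
  beats the factor 2 |\<omega>_k| in the upper bound; coercivity also forces R to be at least 1,
  which absorbs all lower order terms of the count.\<close>

lemma integral_infsum_countable:
  fixes f :: "'i::countable \<Rightarrow> 'a \<Rightarrow> complex"
  assumes f: "\<And>i. integrable M (f i)"
    and sm: "(\<lambda>i. LINT x|M. norm (f i x)) summable_on UNIV"
  shows "AE x in M. (\<lambda>i. norm (f i x)) summable_on UNIV"
    and "integrable M (\<lambda>x. \<Sum>\<^sub>\<infinity>i. f i x)"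
    and "((\<lambda>i. LINT x|M. f i x) has_sum (LINT x|M. (\<Sum>\<^sub>\<infinity>i. f i x))) UNIV"
proof -
  \<comment> \<open>The sum is moved to the naturals along \<open>to_nat\<close>. Since
    \<open>to_nat\<close> need not be onto, \<open>g\<close> is 0 off its range, and the transfer
    works for every \<open>h\<close> that sends the zero function to 0: evaluation at a point, norm
    and integral are all of this kind.\<close>
  define R where "R = range (to_nat :: 'i \<Rightarrow> nat)"
  define g where "g n x = (if n \<in> R then f (from_nat n) x else 0)" for n x
  have inj: "inj_on (to_nat :: 'i \<Rightarrow> nat) UNIV" by simp
  have comp: "(\<lambda>n. h (g n)) \<circ> to_nat = (\<lambda>i. h (f i))" for h :: "('a \<Rightarrow> complex) \<Rightarrow> 'c"
  proof -
    have "g (to_nat i) = f i" for i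
      by (rule ext) (simp add: g_def R_def)
    then show ?thesis by (simp add: o_def)
  qed
  have g0: "g n = (\<lambda>x. 0)" if "n \<notin> R" for n
    by (rule ext) (simp add: g_def that)
  have red_has: "((\<lambda>i. h (f i)) has_sum s) UNIV \<longleftrightarrow> ((\<lambda>n. h (g n)) has_sum s) UNIV"
    if "h (\<lambda>x. 0) = 0" for h :: "('a \<Rightarrow> complex) \<Rightarrow> 'c::real_normed_vector" and s
  proof -
    have "((\<lambda>n. h (g n)) has_sum s) UNIV \<longleftrightarrow> ((\<lambda>n. h (g n)) has_sum s) R"
      by (rule has_sum_cong_neutral) (use that in \<open>auto simp: g0\<close>)
    also have "\<dots> \<longleftrightarrow> (((\<lambda>n. h (g n)) \<circ> to_nat) has_sum s) (UNIV :: 'i set)"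
      unfolding R_def using has_sum_reindex[OF inj, of "\<lambda>n. h (g n)" s] by blast
    finally show ?thesis unfolding comp by simp
  qed
  have red: "(\<lambda>i. h (f i)) summable_on UNIV \<longleftrightarrow> (\<lambda>n. h (g n)) summable_on UNIV"
    if "h (\<lambda>x. 0) = 0" for h :: "('a \<Rightarrow> complex) \<Rightarrow> 'c::real_normed_vector"
    using red_has[of h] that by (auto simp: summable_on_def)
  have g: "integrable M (g n)" for n
    using f[of "from_nat n"] by (cases "n \<in> R") (simp_all add: g0 g_def[abs_def])
  have [measurable]: "g n \<in> borel_measurable M" for n using g by auto
  have sg: "summable (\<lambda>n. LINT x|M. norm (g n x))"
    using sm red[of "\<lambda>u. LINT x|M. norm (u x)"]
    by (simp add: summable_on_UNIV_nonneg_real_iff)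
  have "(\<Sum>n. \<integral>\<^sup>+x. ennreal (norm (g n x)) \<partial>M) = (\<Sum>n. ennreal (LINT x|M. norm (g n x)))"
    using g by (subst nn_integral_eq_integral) auto
  also have "\<dots> = ennreal (\<Sum>n. LINT x|M. norm (g n x))"
    using sg by (intro suminf_ennreal2) auto
  finally have "(\<integral>\<^sup>+x. (\<Sum>n. ennreal (norm (g n x))) \<partial>M) < \<infinity>"
    by (subst nn_integral_suminf) auto
  then have ae0: "AE x in M. (\<Sum>n. ennreal (norm (g n x))) \<noteq> \<infinity>"
    by (intro nn_integral_PInf_AE) auto
  have smx: "(\<Sum>n. ennreal (norm (g n x))) \<noteq> \<infinity> \<longleftrightarrow> summable (\<lambda>n. norm (g n x))" for x
  proof
    show "(\<Sum>n. ennreal (norm (g n x))) \<noteq> \<infinity>" if "summable (\<lambda>n. norm (g n x))"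
      using that by (subst suminf_ennreal2) auto
  qed (rule summable_suminf_not_top, auto)
  have ae: "AE x in M. summable (\<lambda>n. norm (g n x))"
    using ae0 by eventually_elim (simp only: smx)
  have abs_iff: "(\<lambda>i. norm (f i x)) summable_on UNIV \<longleftrightarrow> summable (\<lambda>n. norm (g n x))" for x
    using red[of "\<lambda>u. norm (u x)"] by (simp add: summable_on_UNIV_nonneg_real_iff)
  show "AE x in M. (\<lambda>i. norm (f i x)) summable_on UNIV"
    using ae by (simp add: abs_iff)
  have has: "((\<lambda>i. f i x) has_sum (\<Sum>n. g n x)) UNIV" if "summable (\<lambda>n. norm (g n x))" for x
    using red_has[of "\<lambda>u. u x"] norm_summable_imp_has_sum[OF that summable_sums[OF summable_norm_cancel[OF that]]]
    by simp
  \<comment> \<open>\<open>infsum\<close> is 0 where the sum diverges, and for complex terms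
    convergence means absolute convergence. With the value 0 where the norms add up to infinity,
    \<open>G\<close> therefore agrees with the sum at every point, and the sum is measurable without
    changes on a null set.\<close>
  define G where "G x = (if (\<Sum>n. ennreal (norm (g n x))) = \<infinity> then 0 else \<Sum>n. g n x)" for x
  have eq: "(\<Sum>\<^sub>\<infinity>i. f i x) = G x" for x
  proof (cases "summable (\<lambda>n. norm (g n x))")
    case True
    then show ?thesis using has[OF True] smx[of x] by (simp add: G_def infsumI)
  next
    case False
    then have "\<not> (\<lambda>i. f i x) summable_on UNIV"
      using abs_iff[of x] by (metis summable_on_iff_abs_summable_on_complex)
    then show ?thesis using False smx[of x] by (auto simp: G_def infsum_not_exists)
  qed
  have [measurable]: "G \<in> borel_measurable M" unfolding G_def by measurable
  have aeG: "AE x in M. G x = (\<Sum>n. g n x)"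
    using ae0 by eventually_elim (simp add: G_def)
  have "integrable M (\<lambda>x. \<Sum>n. g n x)"
    using g ae sg by (rule integrable_suminf)
  then show "integrable M (\<lambda>x. \<Sum>\<^sub>\<infinity>i. f i x)"
    unfolding eq using aeG by (subst integrable_cong_AE[where g = "\<lambda>x. \<Sum>n. g n x"]) auto
  have "(\<lambda>n. LINT x|M. g n x) sums (LINT x|M. (\<Sum>n. g n x))"
    using g ae sg by (rule sums_integral)
  moreover have "(LINT x|M. (\<Sum>n. g n x)) = (LINT x|M. G x)"
    using aeG by (intro integral_cong_AE) auto
  moreover have "summable (\<lambda>n. norm (LINT x|M. g n x))"
    by (rule summable_comparison_test'[OF sg, of 0]) (simp add: integral_norm_bound)
  ultimately have "((\<lambda>n. LINT x|M. g n x) has_sum (LINT x|M. G x)) UNIV"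
    by (intro norm_summable_imp_has_sum) auto
  then show "((\<lambda>i. LINT x|M. f i x) has_sum (LINT x|M. (\<Sum>\<^sub>\<infinity>i. f i x))) UNIV"
    unfolding eq using red_has[of "\<lambda>u. LINT x|M. u x"] by simp
qed

section \<open>The unit cell as a probability space, and periodic integrands\<close>

lemma space_cell: "space cell = cbox 0 1"
  by (simp add: cell_def space_restrict_space)

lemma measurable_cell: "f \<in> borel_measurable borel \<Longrightarrow> f \<in> borel_measurable cell"
  by (simp add: cell_def measurable_restrict_space1)

lemma emeasure_cell_UNIV: "emeasure cell (space cell) = 1"
proof -
  have "(1::real^3) \<bullet> b = 1" if "b \<in> Basis" for b
    using that by (auto simp: Basis_vec_def inner_axis)
  then show ?thesis
    by (simp add: cell_def space_restrict_space emeasure_restrict_space emeasure_lborel_cbox_eq)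
qed

interpretation cell: finite_measure cell
  by (rule finite_measureI) (simp add: emeasure_cell_UNIV)

lemma measure_cell: "measure cell (space cell) = 1"
  by (simp add: Sigma_Algebra.measure_def emeasure_cell_UNIV)

lemma integral_cell:
  fixes f :: "real^3 \<Rightarrow> 'b::euclidean_space"
  assumes "continuous_on UNIV f"
  shows "integrable cell f" "(LINT x|cell. f x) = integral (cbox 0 1) f"
proof -
  have "set_integrable lborel (cbox 0 1) f"
    unfolding set_integrable_def
    by (rule borel_integrable_compact) (use assms continuous_on_subset in auto)
  then show "integrable cell f" "(LINT x|cell. f x) = integral (cbox 0 1) f"
    by (simp_all add: cell_def integrable_restrict_space set_integrable_def
        integral_restrict_space set_borel_integral_eq_integral(2)[symmetric] set_lebesgue_integral_def)
qed

text \<open>The translated cell is cut at the face where coordinate \<open>j\<close> equals 1, and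
  the overhanging slab is moved back by one period. It becomes the slab \<open>cbox 0 p\<close> of
  thickness \<open>t\<close>, exactly the part of the cell that the translate has left.\<close>

lemma integral_cell_shift:
  fixes h :: "real^3 \<Rightarrow> 'b::euclidean_space"
  assumes h: "continuous_on UNIV h" and per: "\<And>x. h (x + axis j 1) = h x" and t: "0 \<le> t" "t \<le> 1"
  shows "integral (cbox 0 1) (\<lambda>x. h (x + t *\<^sub>R axis j 1)) = integral (cbox 0 1) h"
proof -
  define e :: "real^3" where "e = axis j 1"
  define p :: "real^3" where "p = (\<chi> i. if i = j then t else 1)"
  have e: "e \<in> Basis" by (simp add: e_def axis_in_Basis_iff)
  have ee: "x \<bullet> e = x $ j" for x by (simp add: e_def inner_axis)
  have split: "integral (cbox a b) h = integral (cbox a b \<inter> {x. x \<bullet> e \<le> c}) h + integral (cbox a b \<inter> {x. x \<bullet> e \<ge> c}) h"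
    for a b c
    by (rule integral_split[OF _ e]) (use h continuous_on_subset integrable_continuous in blast)
  have sh: "integral (cbox (a - c) (b - c)) (\<lambda>x. h (x + c)) = integral (cbox a b) h" for a b c
    by (rule integral_shift_cbox)
  have bx: "x \<in> cbox a b \<longleftrightarrow> a $ j \<le> x $ j \<and> x $ j \<le> b $ j \<and> (\<forall>i. i \<noteq> j \<longrightarrow> a $ i \<le> x $ i \<and> x $ i \<le> b $ i)"
    for x a b :: "real^3"
    unfolding mem_box_cart by metis
  have p: "1 + t *\<^sub>R e - e = p" by (auto simp: p_def e_def vec_eq_iff axis_def)
  have "integral (cbox 0 1) (\<lambda>x. h (x + t *\<^sub>R e)) = integral (cbox (t *\<^sub>R e) (1 + t *\<^sub>R e)) h"
    using sh[of "t *\<^sub>R e" "t *\<^sub>R e" "1 + t *\<^sub>R e"] by simp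
  also have "\<dots> = integral (cbox (t *\<^sub>R e) 1) h + integral (cbox e (1 + t *\<^sub>R e)) h"
  proof -
    have "cbox (t *\<^sub>R e) (1 + t *\<^sub>R e) \<inter> {x. x \<bullet> e \<le> 1} = cbox (t *\<^sub>R e) 1"
      "cbox (t *\<^sub>R e) (1 + t *\<^sub>R e) \<inter> {x. x \<bullet> e \<ge> 1} = cbox e (1 + t *\<^sub>R e)"
      using t by (auto simp: ee bx) (auto simp: e_def axis_def)
    then show ?thesis using split[of "t *\<^sub>R e" "1 + t *\<^sub>R e" 1] by simp
  qed
  also have "integral (cbox e (1 + t *\<^sub>R e)) h = integral (cbox 0 p) h"
    using sh[of e e "1 + t *\<^sub>R e"] per by (simp add: p) (simp add: e_def)
  also have "integral (cbox (t *\<^sub>R e) 1) h + integral (cbox 0 p) h = integral (cbox 0 1) h"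
  proof -
    have "cbox 0 1 \<inter> {x. x \<bullet> e \<le> t} = cbox 0 p" "cbox 0 1 \<inter> {x. x \<bullet> e \<ge> t} = cbox (t *\<^sub>R e) 1"
      using t by (auto simp: ee bx) (auto simp: e_def p_def axis_def)
    then show ?thesis using split[of 0 1 t] by simp
  qed
  finally show ?thesis by (simp add: e_def)
qed

text \<open>By periodicity the integral of \<open>g\<close> over the cell translated by
  \<open>t\<close> is constant in \<open>t\<close>, and differentiating under the integral at
  \<open>t = 0\<close> produces the integral of \<open>g'\<close>. Applied to products, this is
  integration by parts on the torus.\<close>

lemma integral_cell_derivative:
  fixes g g' :: "real^3 \<Rightarrow> 'b::euclidean_space"
  assumes g: "continuous_on UNIV g" and g': "continuous_on UNIV g'"
    and per: "\<And>x. g (x + axis j 1) = g x"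
    and deriv: "\<And>x. ((\<lambda>t. g (x + t *\<^sub>R axis j 1)) has_vector_derivative g' x) (at 0)"
  shows "(LINT x|cell. g' x) = 0"
proof -
  let ?e = "axis j 1 :: real^3"
  \<comment> \<open>The hypothesis differentiates only at \<open>t = 0\<close>, but at every base
    point; moving the base point gives the derivative at every \<open>s\<close>.\<close>
  have d: "((\<lambda>t. g (x + t *\<^sub>R ?e)) has_vector_derivative g' (x + s *\<^sub>R ?e)) (at s within {0..1})" for x s
  proof -
    have "((\<lambda>t. g ((x + s *\<^sub>R ?e) + t *\<^sub>R ?e)) has_vector_derivative g' (x + s *\<^sub>R ?e)) (at (s - s))"
      using deriv[of "x + s *\<^sub>R ?e"] by simp
    then have "(((\<lambda>t. g ((x + s *\<^sub>R ?e) + t *\<^sub>R ?e)) \<circ> (\<lambda>t. t - s)) has_vector_derivative 1 *\<^sub>R g' (x + s *\<^sub>R ?e)) (at s)"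
      by (intro vector_diff_chain_at) (auto intro!: derivative_eq_intros)
    then show ?thesis
      by (simp add: o_def algebra_simps has_vector_derivative_at_within)
  qed
  have "((\<lambda>t. integral (cbox 0 1) (\<lambda>x. g (x + t *\<^sub>R ?e))) has_vector_derivative
      integral (cbox 0 1) (\<lambda>x. g' (x + 0 *\<^sub>R ?e))) (at 0 within {0..1})"
  proof (rule leibniz_rule_vector_derivative)
    show "continuous_on ({0..1} \<times> cbox 0 1) (\<lambda>(t, x). g' (x + t *\<^sub>R ?e))"
      unfolding case_prod_beta
      by (intro continuous_on_compose2[OF g'] continuous_intros) auto
    show "(\<lambda>x. g (x + t *\<^sub>R ?e)) integrable_on cbox 0 1" for t
      by (intro integrable_continuous continuous_on_compose2[OF g] continuous_intros) auto
  qed (use d in auto)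
  moreover have "((\<lambda>t. integral (cbox 0 1) (\<lambda>x. g (x + t *\<^sub>R ?e))) has_vector_derivative 0) (at 0 within {0..1})"
    by (rule has_vector_derivative_transform[where f = "\<lambda>t. integral (cbox 0 1) g"])
       (use integral_cell_shift[OF g per] in auto)
  ultimately have "integral (cbox 0 1) (\<lambda>x. g' (x + 0 *\<^sub>R ?e)) = 0"
    by (rule vector_derivative_unique_within[rotated]) (simp add: trivial_limit_within)
  then show ?thesis by (simp add: integral_cell(2)[OF g'])
qed

section \<open>Characters and test functions\<close>

definition charf :: "int^3 \<Rightarrow> real^3 \<Rightarrow> complex" where
  "charf m x = exp (\<i> * of_real (2 * pi * (ivec m \<bullet> x)))"

text \<open>The pairing is with \<open>charf m\<close> and not with its conjugate, as in
  \<open>fourier\<close>. So \<open>fc f m\<close> belongs to the mode \<open>charf (- m)\<close>,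
  on which i grad acts as 2 pi m; this is where the minus signs in later expansions come
  from.\<close>

definition fc :: "(real^3 \<Rightarrow> complex) \<Rightarrow> int^3 \<Rightarrow> complex" where
  "fc f m = (LINT x|cell. charf m x * f x)"

lemma fcoef_eq_fc: "fcoef u m = fc (rep_L2T u) m"
  by (simp add: fcoef_def fc_def charf_def)

lemma ivec_simps [simp]:
  "ivec 0 = 0" "ivec (m + n) = ivec m + ivec n" "ivec (- m) = - ivec m" "ivec (m - n) = ivec m - ivec n"
  "ivec m $ j = of_int (m $ j)"
  by (simp_all add: ivec_def vec_eq_iff)

lemma charf_0 [simp]: "charf 0 x = 1"
  by (simp add: charf_def)

lemma charf_add: "charf (m + n) x = charf m x * charf n x"
  by (simp add: charf_def inner_add_left algebra_simps flip: exp_add)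

lemma cnj_charf: "cnj (charf m x) = charf (- m) x"
  by (simp add: charf_def exp_cnj)

lemma norm_charf [simp]: "cmod (charf m x) = 1"
  by (simp add: charf_def)

lemma continuous_on_charf [continuous_intros]: "continuous_on S (charf m)"
  unfolding charf_def by (intro continuous_intros)

lemma measurable_charf [measurable]: "charf m \<in> borel_measurable cell"
  by (intro measurable_cell borel_measurable_continuous_onI continuous_on_charf)

lemma charf_periodic: "charf m (x + axis j 1) = charf m x"
proof -
  have "charf m (x + axis j 1) = charf m x * exp (of_real (2 * of_int (m $ j) * pi) * \<i>)"
    by (simp add: charf_def inner_add_right inner_axis algebra_simps flip: exp_add)
  also have "exp (of_real (2 * of_int (m $ j) * pi) * \<i>) = 1"
    by (rule exp_integer_2pi) simp
  finally show ?thesis by simp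
qed

lemma has_vector_derivative_charf:
  "((\<lambda>t. charf m (x + t *\<^sub>R axis j 1)) has_vector_derivative
     (2 * pi * \<i> * of_int (m $ j)) * charf m x) (at 0)"
proof -
  have "charf m (x + t *\<^sub>R axis j 1) = charf m x * exp (of_real t * (2 * pi * \<i> * of_int (m $ j)))" for t
    by (simp add: charf_def inner_add_right inner_axis algebra_simps flip: exp_add)
  moreover have "((\<lambda>t. charf m x * exp (of_real t * (2 * pi * \<i> * of_int (m $ j)))) has_vector_derivative
     (2 * pi * \<i> * of_int (m $ j)) * charf m x) (at 0)"
    by (rule has_vector_derivative_real_field) (auto intro!: derivative_eq_intros)
  ultimately show ?thesis by simp
qed

lemma partial_deriv_charf:
  "partial_deriv j (\<lambda>x. c * charf m x) = (\<lambda>x. (c * (2 * pi * \<i> * of_int (m $ j))) * charf m x)"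
proof
  fix x
  have "((\<lambda>t. c * charf m (x + t *\<^sub>R axis j 1)) has_vector_derivative
     c * ((2 * pi * \<i> * of_int (m $ j)) * charf m x)) (at 0)"
    by (intro has_vector_derivative_mult_right has_vector_derivative_charf)
  then show "partial_deriv j (\<lambda>x. c * charf m x) x = (c * (2 * pi * \<i> * of_int (m $ j))) * charf m x"
    unfolding partial_deriv_def by (simp add: vector_derivative_at mult.assoc)
qed

lemma C_k_charf: "C_k k (\<lambda>x. c * charf m x)"
proof (induction k arbitrary: c)
  case 0
  then show ?case by (auto intro!: continuous_intros)
next
  case (Suc k)
  have "(\<lambda>t. c * charf m (x + t *\<^sub>R axis j 1)) differentiable at 0" for x j
    by (intro differentiable_mult differentiable_const)
       (use has_vector_derivative_charf has_vector_derivative_def differentiable_def in blast)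
  then show ?case
    using Suc by (auto intro!: continuous_intros simp: partial_deriv_charf)
qed

text \<open>Characters are admissible test functions, so distributional identities can be read off
  one mode at a time.\<close>

lemma charf_test: "charf m \<in> torus_test_functions"
  using C_k_charf[of _ 1 m] by (auto simp: torus_test_functions_def smooth_def charf_periodic)

lemma test_continuous: "\<phi> \<in> torus_test_functions \<Longrightarrow> continuous_on UNIV \<phi>"
  using C_k.simps(1)[of \<phi>] by (auto simp: torus_test_functions_def smooth_def)

lemma test_has_derivative:
  assumes "\<phi> \<in> torus_test_functions"
  shows "((\<lambda>t. \<phi> (x + t *\<^sub>R axis j 1)) has_vector_derivative partial_deriv j \<phi> x) (at 0)"
proof -
  have "C_k (Suc 0) \<phi>"
    using assms unfolding torus_test_functions_def smooth_def by blast
  then show ?thesis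
    unfolding partial_deriv_def by (auto simp: vector_derivative_works)
qed

lemma test_partial_deriv:
  assumes "\<phi> \<in> torus_test_functions"
  shows "partial_deriv j \<phi> \<in> torus_test_functions"
proof -
  have "C_k k (partial_deriv j \<phi>)" for k
  proof -
    have "C_k (Suc k) \<phi>" using assms unfolding torus_test_functions_def smooth_def by blast
    then show ?thesis by simp
  qed
  moreover have "partial_deriv j \<phi> (x + axis i 1) = partial_deriv j \<phi> x" for x i
  proof -
    have "\<phi> (x + axis i 1 + t *\<^sub>R axis j 1) = \<phi> (x + t *\<^sub>R axis j 1)" for t
    proof -
      have "\<phi> (x + t *\<^sub>R axis j 1 + axis i 1) = \<phi> (x + t *\<^sub>R axis j 1)"
        using assms unfolding torus_test_functions_def by blast
      then show ?thesis by (simp add: algebra_simps)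
    qed
    then show ?thesis by (simp add: partial_deriv_def)
  qed
  ultimately show ?thesis by (simp add: torus_test_functions_def smooth_def)
qed

lemma test_integrable: "\<phi> \<in> torus_test_functions \<Longrightarrow> integrable cell \<phi>"
  by (intro integral_cell(1) test_continuous)

lemma test_measurable: "\<phi> \<in> torus_test_functions \<Longrightarrow> \<phi> \<in> borel_measurable cell"
  by (intro borel_measurable_integrable test_integrable)

lemma integrable_charf_mult:
  "integrable cell f \<Longrightarrow> integrable cell (\<lambda>x. charf m x * f x)"
  by (rule Bochner_Integration.integrable_bound[of _ f]) (auto simp: norm_mult)

lemma fc_partial_deriv:
  assumes "\<phi> \<in> torus_test_functions"
  shows "fc (partial_deriv j \<phi>) m = - (2 * pi * \<i> * of_int (m $ j)) * fc \<phi> m"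
proof -
  let ?c = "2 * pi * \<i> * of_int (m $ j) :: complex"
  note t = test_continuous[OF assms] test_continuous[OF test_partial_deriv[OF assms]]
  have "(LINT x|cell. charf m x * partial_deriv j \<phi> x + ?c * charf m x * \<phi> x) = 0"
  proof (rule integral_cell_derivative)
    show "charf m (x + axis j 1) * \<phi> (x + axis j 1) = charf m x * \<phi> x" for x
      using assms by (simp add: charf_periodic torus_test_functions_def)
    show "((\<lambda>t. charf m (x + t *\<^sub>R axis j 1) * \<phi> (x + t *\<^sub>R axis j 1)) has_vector_derivative
      charf m x * partial_deriv j \<phi> x + ?c * charf m x * \<phi> x) (at 0)" for x
      using has_vector_derivative_mult[OF has_vector_derivative_charf test_has_derivative[OF assms], of m x j x j]
      by simp
  qed (use t in \<open>auto intro!: continuous_intros\<close>)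
  moreover have "(LINT x|cell. charf m x * partial_deriv j \<phi> x + ?c * (charf m x * \<phi> x)) =
      fc (partial_deriv j \<phi>) m + ?c * fc \<phi> m"
    using integrable_charf_mult[OF test_integrable[OF test_partial_deriv[OF assms]], of m j]
      integrable_charf_mult[OF test_integrable[OF assms], of m]
    unfolding fc_def by (simp add: Bochner_Integration.integral_add)
  ultimately show ?thesis by (simp add: mult.assoc add_eq_0_iff2)
qed

lemma integral_charf: "(LINT x|cell. charf m x) = (if m = 0 then 1 else 0)"
proof (cases "m = 0")
  case False
  then obtain j where j: "m $ j \<noteq> 0" by (auto simp: vec_eq_iff)
  have "(LINT x|cell. 2 * pi * \<i> * of_int (m $ j) * charf m x) = 0"
    by (rule integral_cell_derivative[OF _ _ charf_periodic has_vector_derivative_charf])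
       (auto intro!: continuous_intros)
  then show ?thesis using j False by simp
qed (simp add: measure_cell)

lemma fc_charf: "fc (charf n) m = (if m = - n then 1 else 0)"
  by (simp add: fc_def integral_charf eq_neg_iff_add_eq_0 flip: charf_add)

section \<open>Absolute summability of the Fourier coefficients of test functions\<close>

lemma norm_fc_le:
  assumes "integrable cell f"
  shows "cmod (fc f m) \<le> (LINT x|cell. cmod (f x))"
  unfolding fc_def using integral_norm_bound[of cell "\<lambda>x. charf m x * f x"] by (simp add: norm_mult)

text \<open>Every finite set of lattice points lies in a box, and over a box the product weight sums
  to a product of three one-dimensional sums, each at most the full sum of 1 / (1 + k^2) over the
  integers.\<close>

lemma summable_lattice_weight:
  "(\<lambda>m::int^3. \<Prod>j\<in>UNIV. 1 / (1 + (real_of_int (m $ j))\<^sup>2)) summable_on UNIV"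
proof -
  define w where "w k = 1 / (1 + (real_of_int k)\<^sup>2)" for k
  have w0: "w k \<ge> 0" for k by (auto simp: w_def intro!: divide_nonneg_nonneg add_nonneg_nonneg)
  have nat: "(\<lambda>n. 1 / (1 + (real n)\<^sup>2)) summable_on UNIV"
  proof (rule norm_summable_imp_summable_on, rule summable_comparison_test')
    show "summable (\<lambda>n. 1 / (real n)\<^sup>2)"
      using inverse_power_summable[of 2, where 'a = real] by (simp add: inverse_eq_divide)
    show "norm (norm (1 / (1 + (real n)\<^sup>2))) \<le> 1 / (real n)\<^sup>2" if "n \<ge> 1" for n
      using that by (auto intro!: divide_left_mono mult_pos_pos add_pos_nonneg)
  qed
  have "w summable_on (range int \<union> range (\<lambda>n. - int n))"
  proof (rule summable_on_union)
    show "w summable_on range int"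
      using nat by (subst summable_on_reindex) (auto simp: w_def o_def)
    show "w summable_on range (\<lambda>n. - int n)"
      using nat by (subst summable_on_reindex) (auto simp: w_def o_def inj_def)
  qed
  moreover have "range int \<union> range (\<lambda>n. - int n) = UNIV"
    by (auto simp: image_iff) (metis int_cases2)
  ultimately have w: "w summable_on UNIV" by simp
  show ?thesis
  proof (rule nonneg_bdd_above_summable_on)
    show "0 \<le> (\<Prod>j\<in>UNIV. 1 / (1 + (real_of_int (m $ j))\<^sup>2))" for m :: "int^3"
      using w0 by (auto intro!: prod_nonneg simp: w_def)
    show "bdd_above (sum (\<lambda>m::int^3. \<Prod>j\<in>UNIV. 1 / (1 + (real_of_int (m $ j))\<^sup>2)) ` {F. F \<subseteq> UNIV \<and> finite F})"
    proof (rule bdd_aboveI2)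
      fix F :: "(int^3) set" assume "F \<in> {F. F \<subseteq> UNIV \<and> finite F}"
      then have F: "finite F" by simp
      define A where "A = (\<lambda>(m, j). m $ j) ` (F \<times> (UNIV :: 3 set))"
      have A: "finite A" using F by (simp add: A_def)
      have sub: "vec_nth ` F \<subseteq> PiE UNIV (\<lambda>_. A)"
        by (auto simp: A_def PiE_def)
      have "(\<Sum>m\<in>F. \<Prod>j\<in>UNIV. w (m $ j)) = (\<Sum>g\<in>vec_nth ` F. \<Prod>j\<in>UNIV. w (g j))"
        by (subst sum.reindex) (auto simp: inj_on_def vec_nth_inject)
      also have "\<dots> \<le> (\<Sum>g\<in>PiE UNIV (\<lambda>_. A). \<Prod>j\<in>(UNIV :: 3 set). w (g j))"
        by (rule sum_mono2[OF _ sub]) (auto intro!: finite_PiE prod_nonneg A w0)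
      also have "\<dots> = (\<Prod>j\<in>(UNIV :: 3 set). \<Sum>k\<in>A. w k)"
        using A by (intro prod_sum_PiE[symmetric]) auto
      also have "\<dots> \<le> (\<Prod>j\<in>(UNIV :: 3 set). infsum w UNIV)"
        by (intro prod_mono conjI sum_nonneg w0 finite_sum_le_infsum[OF w A]) auto
      finally show "(\<Sum>m\<in>F. \<Prod>j\<in>UNIV. 1 / (1 + (real_of_int (m $ j))\<^sup>2)) \<le> (\<Prod>j\<in>(UNIV :: 3 set). infsum w UNIV)"
        by (simp add: w_def)
    qed
  qed
qed

text \<open>Two derivatives in direction \<open>j\<close> multiply the modulus of a coefficient by
  (2 pi m_j)^2, which is at least m_j^2. The hypothesis ranges over all test functions because it is
  also applied to that second derivative.\<close>

lemma test_fc_weight_step: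
  assumes v: "\<forall>\<phi>\<in>torus_test_functions. \<exists>C. \<forall>m. v m * cmod (fc \<phi> m) \<le> C" and v0: "\<forall>m. v m \<ge> 0"
    and \<phi>: "\<phi> \<in> torus_test_functions"
  shows "\<exists>C. \<forall>m. (1 + (real_of_int (m $ j))\<^sup>2) * v m * cmod (fc \<phi> m) \<le> C"
proof -
  obtain C where C: "\<And>m. v m * cmod (fc \<phi> m) \<le> C" using bspec[OF v \<phi>] by blast
  obtain D where D: "\<And>m. v m * cmod (fc (partial_deriv j (partial_deriv j \<phi>)) m) \<le> D"
    using bspec[OF v test_partial_deriv[OF test_partial_deriv[OF \<phi>]]] by blast
  have "(1 + (real_of_int (m $ j))\<^sup>2) * v m * cmod (fc \<phi> m) \<le> C + D" for m
  proof -
    have "cmod (fc (partial_deriv j (partial_deriv j \<phi>)) m) = (2 * pi)\<^sup>2 * (real_of_int (m $ j))\<^sup>2 * cmod (fc \<phi> m)"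
      using \<phi> by (simp add: fc_partial_deriv test_partial_deriv norm_mult power2_eq_square)
    moreover
    have "(real_of_int (m $ j))\<^sup>2 * 1 \<le> (real_of_int (m $ j))\<^sup>2 * (2 * pi)\<^sup>2"
      using pi_gt3 by (intro mult_left_mono one_le_power) auto
    then have "((real_of_int (m $ j))\<^sup>2 * 1) * cmod (fc \<phi> m) \<le> ((real_of_int (m $ j))\<^sup>2 * (2 * pi)\<^sup>2) * cmod (fc \<phi> m)"
      by (rule mult_right_mono) simp
    ultimately have "(real_of_int (m $ j))\<^sup>2 * cmod (fc \<phi> m) \<le> cmod (fc (partial_deriv j (partial_deriv j \<phi>)) m)"
      by (simp add: mult_ac)
    then have "v m * ((real_of_int (m $ j))\<^sup>2 * cmod (fc \<phi> m)) \<le> D"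
      by (intro order_trans[OF mult_left_mono D[of m]]) (simp_all add: v0)
    then show ?thesis using C[of m] by (simp add: algebra_simps)
  qed
  then show ?thesis by (intro exI allI)
qed

lemma test_fc_summable:
  assumes "\<phi> \<in> torus_test_functions"
  shows "(\<lambda>m. cmod (fc \<phi> m)) summable_on UNIV"
proof -
  let ?w = "\<lambda>j m. 1 + (real_of_int (m $ j))\<^sup>2"
  have w0: "?w j m \<ge> 0" for j and m :: "int^3" by (simp add: add_nonneg_nonneg)
  \<comment> \<open>Starting from mere boundedness, one step per coordinate builds up the product
    weight of \<open>summable_lattice_weight\<close>.\<close>
  have 0: "\<forall>\<phi>\<in>torus_test_functions. \<exists>C. \<forall>m. (1::real) * cmod (fc \<phi> m) \<le> C"
    using norm_fc_le[OF test_integrable] by auto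
  have 1: "\<forall>\<phi>\<in>torus_test_functions. \<exists>C. \<forall>m. (?w 1 m * 1) * cmod (fc \<phi> m) \<le> C"
    using test_fc_weight_step[OF 0] by simp
  have 2: "\<forall>\<phi>\<in>torus_test_functions. \<exists>C. \<forall>m. (?w 2 m * (?w 1 m * 1)) * cmod (fc \<phi> m) \<le> C"
    using test_fc_weight_step[OF 1] w0 by simp
  have 3: "\<forall>\<phi>\<in>torus_test_functions. \<exists>C. \<forall>m. (?w 3 m * (?w 2 m * (?w 1 m * 1))) * cmod (fc \<phi> m) \<le> C"
    using test_fc_weight_step[OF 2] w0 by simp
  obtain C where C: "\<forall>m. (?w 3 m * (?w 2 m * (?w 1 m * 1))) * cmod (fc \<phi> m) \<le> C"
    using bspec[OF 3 assms] by (rule exE)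
  show ?thesis
  proof (rule summable_on_comparison_test[OF summable_on_cmult_right[OF summable_lattice_weight, of C]])
    fix m :: "int^3"
    have pos: "?w j m > 0" for j by (simp add: add_pos_nonneg)
    have p3: "(\<Prod>j\<in>UNIV. 1 / c j) = 1 / (c 3 * (c 2 * (c 1 * 1)))" for c :: "3 \<Rightarrow> real"
      unfolding UNIV_3 by (simp add: mult_ac)
    have W: "0 < ?w 3 m * (?w 2 m * (?w 1 m * 1))"
      by (intro mult_pos_pos pos zero_less_one)
    have "cmod (fc \<phi> m) \<le> C / (?w 3 m * (?w 2 m * (?w 1 m * 1)))"
      using spec[OF C, of m] unfolding pos_le_divide_eq[OF W] by (simp only: mult.commute)
    also have "\<dots> = C * (\<Prod>j\<in>UNIV. 1 / ?w j m)"
      unfolding p3[of "\<lambda>j. ?w j m"] by (simp only: times_divide_eq_right mult_1_right)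
    finally show "cmod (fc \<phi> m) \<le> C * (\<Prod>j\<in>UNIV. 1 / ?w j m)" .
  qed auto
qed

section \<open>Uniqueness of Fourier coefficients\<close>

lemma ivec_axis [simp]: "ivec (axis j 1) = axis j 1"
  by (simp add: ivec_def axis_def vec_eq_iff)

text \<open>The torus as a product of three unit circles in C^3. This turns trigonometric
  polynomials into polynomials on a compact set, where the Stone-Weierstrass theorem
  applies.\<close>

definition torus_embed :: "real^3 \<Rightarrow> complex^3" where
  "torus_embed x = (\<chi> j. charf (axis j 1) x)"

lemma continuous_torus_embed: "continuous_on S torus_embed"
  unfolding torus_embed_def by (intro continuous_intros)

text \<open>Coordinates with equal characters differ by an integer. Since opposite faces are glued,
  one point has to be interior; the integer then lies strictly between -1 and 1.\<close>

lemma torus_embed_inj: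
  assumes x: "x \<in> box 0 1" and y: "y \<in> cbox 0 1" and eq: "torus_embed x = torus_embed y"
  shows "x = y"
proof -
  have "x $ j = y $ j" for j
  proof -
    have "charf (axis j 1) x = charf (axis j 1) y"
      using eq by (simp add: torus_embed_def vec_eq_iff)
    then have "exp (\<i> * of_real (2 * pi * x $ j)) = exp (\<i> * of_real (2 * pi * y $ j))"
      by (simp add: charf_def inner_axis inner_commute[of "axis j 1"])
    then obtain n :: int where "\<i> * of_real (2 * pi * x $ j) = \<i> * of_real (2 * pi * y $ j) + of_int (2 * n) * pi * \<i>"
      unfolding exp_eq by blast
    then have "\<i> * of_real (2 * pi * x $ j) = \<i> * of_real (2 * pi * (y $ j + n))"
      by (simp add: algebra_simps)
    then have "of_real (2 * pi * x $ j) = (of_real (2 * pi * (y $ j + n)) :: complex)"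
      by (metis complex_i_not_zero mult_left_cancel)
    then have *: "x $ j = y $ j + n"
      unfolding of_real_eq_iff using pi_gt_zero by simp
    have "0 < x $ j" "x $ j < 1" "0 \<le> y $ j" "y $ j \<le> 1"
      using x y by (simp_all add: mem_box_cart)
    with * have "real_of_int n < 1" "real_of_int n > - 1" by linarith+
    then have "n = 0" by linarith
    then show ?thesis using * by simp
  qed
  then show ?thesis by (simp add: vec_eq_iff)
qed

inductive trig_poly :: "(real^3 \<Rightarrow> complex) \<Rightarrow> bool" where
  trig_char: "trig_poly (\<lambda>x. c * charf m x)"
| trig_add: "trig_poly g \<Longrightarrow> trig_poly h \<Longrightarrow> trig_poly (\<lambda>x. g x + h x)"

lemma trig_const: "trig_poly (\<lambda>x. c)"
  using trig_char[of c 0] by simp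

lemma trig_sum: "finite I \<Longrightarrow> (\<And>i. i \<in> I \<Longrightarrow> trig_poly (g i)) \<Longrightarrow> trig_poly (\<lambda>x. \<Sum>i\<in>I. g i x)"
proof (induction I rule: finite_induct)
  case empty
  then show ?case using trig_const[of 0] by simp
next
  case (insert i I)
  then show ?case by (auto intro!: trig_add)
qed

lemma trig_mult:
  assumes "trig_poly g" "trig_poly h" shows "trig_poly (\<lambda>x. g x * h x)"
  using assms
proof (induction arbitrary: h rule: trig_poly.induct)
  case (trig_char c m)
  from trig_char show ?case
  proof (induction rule: trig_poly.induct)
    case (trig_char d n)
    have "(\<lambda>x. c * charf m x * (d * charf n x)) = (\<lambda>x. (c * d) * charf (m + n) x)"
      by (simp add: charf_add algebra_simps)
    then show ?case by (simp add: trig_poly.trig_char)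
  next
    case (trig_add g h)
    then show ?case by (simp add: distrib_left trig_poly.trig_add)
  qed
next
  case (trig_add g g')
  then show ?case by (simp add: distrib_right trig_poly.trig_add)
qed

lemma trig_poly_bounded_measurable:
  assumes "trig_poly h" shows "h \<in> borel_measurable cell \<and> (\<exists>C. \<forall>x. cmod (h x) \<le> C)"
  using assms
proof induction
  case (trig_char c m)
  have "\<forall>x. cmod (c * charf m x) \<le> cmod c" by (simp add: norm_mult)
  then show ?case by auto
next
  case (trig_add g h)
  then obtain C D where "\<forall>x. cmod (g x) \<le> C" "\<forall>x. cmod (h x) \<le> D" by blast
  then have "\<forall>x. cmod (g x + h x) \<le> C + D" by (auto intro: norm_triangle_le add_mono)
  then show ?case using trig_add by auto
qed

lemma integrable_mult_bounded:
  fixes f h :: "'a \<Rightarrow> complex"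
  assumes f: "integrable M f" and h: "h \<in> borel_measurable M" "\<And>x. x \<in> space M \<Longrightarrow> cmod (h x) \<le> C"
  shows "integrable M (\<lambda>x. f x * h x)"
proof (rule Bochner_Integration.integrable_bound)
  show "integrable M (\<lambda>x. C * norm (f x))" using f by auto
  show "AE x in M. norm (f x * h x) \<le> norm (C * norm (f x))"
  proof (rule AE_I2)
    fix x assume x: "x \<in> space M"
    have "norm (f x * h x) \<le> norm (f x) * C"
      unfolding norm_mult by (intro mult_left_mono h(2) x) simp
    also have "\<dots> \<le> norm (C * norm (f x))" by (simp add: mult.commute)
    finally show "norm (f x * h x) \<le> norm (C * norm (f x))" .
  qed
qed (use f h in auto)

lemma trig_poly_integral_zero:
  assumes "trig_poly h" and f: "integrable cell f" and z: "\<And>m. fc f m = 0"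
  shows "(LINT x|cell. f x * h x) = 0"
  using assms(1)
proof induction
  case (trig_char c m)
  have "(LINT x|cell. f x * (c * charf m x)) = (LINT x|cell. c * (charf m x * f x))"
    by (simp add: mult_ac)
  also have "\<dots> = c * fc f m"
    unfolding fc_def by (rule Bochner_Integration.integral_mult_right_zero)
  finally show ?case using z by simp
next
  case (trig_add g h)
  have int: "integrable cell (\<lambda>x. f x * h x)" if h: "trig_poly h" for h
  proof -
    obtain C where "\<forall>x. cmod (h x) \<le> C" "h \<in> borel_measurable cell"
      using trig_poly_bounded_measurable[OF h] by blast
    then show ?thesis by (intro integrable_mult_bounded[OF f, of _ C]) auto
  qed
  show ?case
    using trig_add int by (simp add: distrib_left Bochner_Integration.integral_add)
qed

text \<open>A real polynomial on C^3 is built from real and imaginary parts of coordinates. On the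
  image of \<open>torus_embed\<close> these combine a character and its conjugate, which is a
  character again.\<close>

lemma trig_poly_real_polynomial:
  assumes "real_polynomial_function p"
  shows "trig_poly (\<lambda>x. of_real (p (torus_embed x)))"
  using assms
proof induction
  case (linear p)
  interpret bounded_linear p by fact
  have pz: "p z = (\<Sum>j\<in>UNIV. Re (z $ j) * p (axis j 1) + Im (z $ j) * p (axis j \<i>))" for z
  proof -
    have "z = (\<Sum>j\<in>UNIV. Re (z $ j) *\<^sub>R axis j 1 + Im (z $ j) *\<^sub>R axis j \<i>)"
      by (simp add: vec_eq_iff axis_def if_distrib[where f = "\<lambda>u. _ *\<^sub>R u"] sum.distrib complex_eq_iff
          cong: if_cong)
    then have "p z = p (\<Sum>j\<in>UNIV. Re (z $ j) *\<^sub>R axis j 1 + Im (z $ j) *\<^sub>R axis j \<i>)" by simp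
    also have "\<dots> = (\<Sum>j\<in>UNIV. Re (z $ j) * p (axis j 1) + Im (z $ j) * p (axis j \<i>))"
      by (simp add: sum add scaleR)
    finally show ?thesis .
  qed
  have ReIm: "of_real (Re z) = 1/2 * z + 1/2 * cnj z" "of_real (Im z) = (-\<i>/2) * z + (\<i>/2) * cnj z" for z
    by (simp_all add: complex_eq_iff)
  have "of_real (p (torus_embed x)) =
    (\<Sum>j\<in>UNIV. (1/2 * charf (axis j 1) x + 1/2 * cnj (charf (axis j 1) x)) * of_real (p (axis j 1)) +
       ((-\<i>/2) * charf (axis j 1) x + (\<i>/2) * cnj (charf (axis j 1) x)) * of_real (p (axis j \<i>)))" for x
    unfolding pz[of "torus_embed x"]
    by (simp only: torus_embed_def vec_lambda_beta of_real_sum of_real_add of_real_mult ReIm)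
  then show ?case
    by (simp only: cnj_charf) (intro trig_sum trig_poly.trig_add trig_mult trig_const trig_poly.trig_char finite)
qed (auto intro: trig_const trig_add trig_mult)

lemma AE_cell_box: "AE x in cell. x \<in> box 0 1"
proof -
  have "(1::real^3) \<bullet> b = 1" if "b \<in> Basis" for b
    using that by (auto simp: Basis_vec_def inner_axis)
  then have "emeasure lborel (cbox (0::real^3) 1 - box 0 1) = 0"
    using box_subset_cbox[of "0::real^3" 1]
    by (subst emeasure_Diff) (auto simp: emeasure_lborel_box_eq emeasure_lborel_cbox_eq)
  then have "AE x in lborel. x \<notin> cbox (0::real^3) 1 - box 0 1"
    by (intro AE_not_in) (auto simp: null_sets_def)
  then show ?thesis
    unfolding cell_def by (subst AE_restrict_space_iff) (auto elim: eventually_mono)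
qed

text \<open>Polynomials in \<open>torus_embed\<close> integrate to 0 against \<open>f\<close>. They
  can be chosen to converge boundedly on the embedded cell to the indicator of the compact image of
  \<open>A\<close>, so dominated convergence applies.\<close>

lemma integral_closed_zero:
  assumes f: "integrable cell f" and z: "\<And>m. fc f m = 0" and A: "closed A"
  shows "(LINT x|cell. f x * indicator A x) = 0"
proof (cases "A \<inter> cbox 0 1 = {}")
  case True
  then have "(LINT x|cell. f x * indicator A x) = (LINT x|cell. 0)"
    by (intro Bochner_Integration.integral_cong) (auto simp: space_cell indicator_def)
  then show ?thesis by simp
next
  case False
  define C where "C = torus_embed ` (A \<inter> cbox 0 1)"
  define S where "S = torus_embed ` cbox 0 1"
  have C: "compact C"
    unfolding C_def by (intro compact_continuous_image continuous_torus_embed closed_Int_compact A compact_cbox)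
  have S: "compact S"
    unfolding S_def by (intro compact_continuous_image continuous_torus_embed compact_cbox)
  have ne: "C \<noteq> {}" using False by (simp add: C_def)
  \<comment> \<open>Tent functions decreasing to the indicator of the closed set \<open>C\<close>;
    each is continuous, so a polynomial is within 1/(n+1) of it on \<open>S\<close>.\<close>
  define g where "g n z = max 0 (1 - real n * infdist z C)" for n z
  have "\<exists>p. real_polynomial_function p \<and> (\<forall>z\<in>S. \<bar>g n z - p z\<bar> < 1 / real (Suc n))" for n
    by (rule Stone_Weierstrass_real_polynomial_function[OF S, of "g n" "1 / real (Suc n)"])
       (auto simp: g_def intro!: continuous_intros)
  then obtain p where p: "\<And>n. real_polynomial_function (p n)"
    and pg: "\<And>n z. z \<in> S \<Longrightarrow> \<bar>g n z - p n z\<bar> < 1 / real (Suc n)"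
    by metis
  have g_lim: "(\<lambda>n. g n z) \<longlonglongrightarrow> indicator C z" for z
  proof (cases "z \<in> C")
    case True
    then show ?thesis using ne by (simp add: g_def infdist_zero)
  next
    case False
    then have pos: "infdist z C > 0"
      using C ne infdist_nonneg[of z C] in_closed_iff_infdist_zero[OF compact_imp_closed[OF C] ne, of z] by linarith
    obtain N where N: "1 < real N * infdist z C"
      using reals_Archimedean3[OF pos] by blast
    have "\<forall>\<^sub>F n in sequentially. g n z = 0"
    proof (rule eventually_sequentiallyI[of N])
      fix n assume "N \<le> n"
      then have "real N * infdist z C \<le> real n * infdist z C"
        using pos by (intro mult_right_mono) auto
      then show "g n z = 0" using N by (simp add: g_def)
    qed
    then show ?thesis using False by (simp add: tendsto_eventually)
  qed
  have p_lim: "(\<lambda>n. p n z) \<longlonglongrightarrow> indicator C z" if "z \<in> S" for z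
  proof -
    have "(\<lambda>n. g n z - p n z) \<longlonglongrightarrow> 0"
    proof (rule Lim_null_comparison)
      show "\<forall>\<^sub>F n in sequentially. norm (g n z - p n z) \<le> 1 / real (Suc n)"
        using pg[OF that] by (auto intro!: always_eventually less_imp_le)
      show "(\<lambda>n. 1 / real (Suc n)) \<longlonglongrightarrow> 0"
        using LIMSEQ_inverse_real_of_nat by (simp add: inverse_eq_divide)
    qed
    from tendsto_diff[OF g_lim[of z] this] show ?thesis by simp
  qed
  have p_bd: "\<bar>p n z\<bar> \<le> 2" if "z \<in> S" for n z
  proof -
    have "0 \<le> g n z" "g n z \<le> 1" by (auto simp: g_def infdist_nonneg)
    moreover have "1 / real (Suc n) \<le> 1" by simp
    ultimately show ?thesis using pg[OF that, of n] by linarith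
  qed
  have tp: "trig_poly (\<lambda>x. of_real (p n (torus_embed x)))" for n
    by (rule trig_poly_real_polynomial[OF p])
  have [measurable]: "f \<in> borel_measurable cell" using f by auto
  have [measurable]: "(\<lambda>x. complex_of_real (p n (torus_embed x))) \<in> borel_measurable cell" for n
    using trig_poly_bounded_measurable[OF tp] by blast
  have [measurable]: "torus_embed \<in> borel_measurable cell"
    by (intro measurable_cell borel_measurable_continuous_onI continuous_torus_embed)
  have [measurable]: "C \<in> sets borel" using compact_imp_closed[OF C] by auto
  have [measurable]: "(\<lambda>x. indicator A x :: complex) \<in> borel_measurable cell"
    using A by (intro measurable_cell) auto
  have [measurable]: "(\<lambda>x. complex_of_real (indicator C (torus_embed x))) \<in> borel_measurable cell"
    by (intro borel_measurable_of_real borel_measurable_indicator' measurable_compose[OF \<open>torus_embed \<in> _\<close>]) measurable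
  have "(\<lambda>n. LINT x|cell. f x * of_real (p n (torus_embed x))) \<longlonglongrightarrow>
      (LINT x|cell. f x * of_real (indicator C (torus_embed x)))"
  proof (rule integral_dominated_convergence)
    show "integrable cell (\<lambda>x. 2 * norm (f x))" using f by auto
    show "AE x in cell. (\<lambda>n. f x * of_real (p n (torus_embed x))) \<longlonglongrightarrow> f x * of_real (indicator C (torus_embed x))"
      by (auto intro!: AE_I2 tendsto_intros p_lim simp: space_cell S_def)
    show "AE x in cell. norm (f x * of_real (p n (torus_embed x))) \<le> 2 * norm (f x)" for n
    proof (rule AE_I2)
      fix x assume "x \<in> space cell"
      then have "\<bar>p n (torus_embed x)\<bar> \<le> 2" by (intro p_bd) (simp add: space_cell S_def)
      then have "\<bar>p n (torus_embed x)\<bar> * norm (f x) \<le> 2 * norm (f x)"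
        by (rule mult_right_mono) simp
      then show "norm (f x * of_real (p n (torus_embed x))) \<le> 2 * norm (f x)"
        by (simp add: norm_mult mult.commute)
    qed
  qed measurable
  moreover have "(LINT x|cell. f x * of_real (p n (torus_embed x))) = 0" for n
    by (rule trig_poly_integral_zero[OF tp f z])
  ultimately have "(LINT x|cell. f x * of_real (indicator C (torus_embed x))) = 0"
    by (simp add: LIMSEQ_const_iff)
  also have "(LINT x|cell. f x * of_real (indicator C (torus_embed x))) = (LINT x|cell. f x * indicator A x)"
  proof (rule integral_cong_AE)
    show "AE x in cell. f x * of_real (indicator C (torus_embed x)) = f x * indicator A x"
      using AE_cell_box
    proof eventually_elim
      case (elim x)
      then have x: "x \<in> cbox 0 1" using box_subset_cbox by blast
      \<comment> \<open>At an interior point the gluing of faces does no harm: no other point of the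
        closed cell has the same image.\<close>
      have "torus_embed x \<in> C \<longleftrightarrow> x \<in> A"
        unfolding C_def using x torus_embed_inj[OF elim] by blast
      then show ?case by (simp add: indicator_def)
    qed
  qed measurable
  finally show ?thesis .
qed

text \<open>The sets over which \<open>f\<close> integrates to 0 include the closed sets, an
  intersection-stable generator of the Borel sets, and survive complements (by the coefficient at 0)
  and disjoint unions. Hence they are all Borel sets.\<close>

lemma fc_zero_imp_AE_zero:
  assumes f: "integrable cell f" and z: "\<And>m. fc f m = 0"
  shows "AE x in cell. f x = 0"
proof -
  have [measurable]: "f \<in> borel_measurable cell" using f by auto
  have int: "integrable cell (\<lambda>x. f x * indicator A x)" if "A \<in> sets borel" for A
  proof (rule integrable_mult_bounded[OF f, of _ 1])
    show "indicator A \<in> borel_measurable cell" using that by (intro measurable_cell) auto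
  qed (auto simp: indicator_def)
  have st: "Int_stable (Collect (closed :: (real^3) set \<Rightarrow> bool))" by (auto simp: Int_stable_def)
  have sub: "Collect (closed :: (real^3) set \<Rightarrow> bool) \<subseteq> Pow UNIV" by simp
  have *: "(LINT x|cell. f x * indicator A x) = 0" if "A \<in> sets borel" for A
  proof -
    have "A \<in> sigma_sets UNIV (Collect closed)"
      using that by (simp add: borel_eq_closed)
    then show ?thesis
    proof (induction rule: sigma_sets_induct_disjoint[OF st sub, consumes 1, case_names basic empty compl union])
      case (basic A)
      then show ?case using integral_closed_zero[OF f z] by simp
    next
      case empty
      then show ?case by simp
    next
      case (compl A)
      then have A: "A \<in> sets borel" by (simp add: borel_eq_closed)
      have "(LINT x|cell. f x * indicator (UNIV - A) x) = (LINT x|cell. f x - f x * indicator A x)"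
        by (intro Bochner_Integration.integral_cong) (auto simp: indicator_def)
      also have "\<dots> = (LINT x|cell. f x) - (LINT x|cell. f x * indicator A x)"
        by (intro Bochner_Integration.integral_diff f int A)
      also have "(LINT x|cell. f x) = 0" using z[of 0] by (simp add: fc_def)
      finally show ?case using compl by simp
    next
      case (union A)
      then have A: "A i \<in> sets borel" for i by (auto simp: borel_eq_closed)
      have "(\<lambda>n. LINT x|cell. f x * indicator (\<Union>i<n. A i) x) \<longlonglongrightarrow> (LINT x|cell. f x * indicator (\<Union>i. A i) x)"
      proof (rule integral_dominated_convergence)
        show "integrable cell (\<lambda>x. norm (f x))" using f by auto
        show "(\<lambda>x. f x * indicator (\<Union>i<n. A i) x) \<in> borel_measurable cell" for n
          using int[of "\<Union>i<n. A i"] A by auto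
        show "(\<lambda>x. f x * indicator (\<Union>i. A i) x) \<in> borel_measurable cell"
          using int[of "\<Union>i. A i"] A by auto
        show "AE x in cell. (\<lambda>n. f x * indicator (\<Union>i<n. A i) x) \<longlonglongrightarrow> f x * indicator (\<Union>i. A i) x"
          by (intro AE_I2 tendsto_intros LIMSEQ_indicator_UN)
        show "AE x in cell. norm (f x * indicator (\<Union>i<n. A i) x) \<le> norm (f x)" for n
          by (auto intro!: AE_I2 simp: indicator_def)
      qed
      moreover have "(LINT x|cell. f x * indicator (\<Union>i<n. A i) x) = 0" for n
      proof -
        have "(LINT x|cell. f x * indicator (\<Union>i<n. A i) x) = (LINT x|cell. (\<Sum>i<n. f x * indicator (A i) x))"
          using union(1) by (subst indicator_UN_disjoint)
            (auto simp: sum_distrib_left disjoint_family_on_def)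
        also have "\<dots> = (\<Sum>i<n. LINT x|cell. f x * indicator (A i) x)"
          by (intro Bochner_Integration.integral_sum int A)
        finally show ?thesis using union by simp
      qed
      ultimately show ?case by (simp add: LIMSEQ_const_iff)
    qed
  qed
  show ?thesis
  proof (rule cell.density_zero[OF f])
    fix B assume "B \<in> sets cell"
    then obtain A where A: "A \<in> sets borel" "B = A \<inter> cbox 0 1"
      by (auto simp: cell_def sets_restrict_space)
    have "set_lebesgue_integral cell B f = (LINT x|cell. f x * indicator A x)"
      unfolding set_lebesgue_integral_def
      by (intro Bochner_Integration.integral_cong) (auto simp: A space_cell indicator_def)
    then show "set_lebesgue_integral cell B f = 0" using *[OF A(1)] by simp
  qed
qed

section \<open>Fourier series\<close>

lemma summable_on_uminus_iff:
  fixes f :: "int^3 \<Rightarrow> 'b::real_normed_vector"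
  shows "(\<lambda>m. f (- m)) summable_on UNIV \<longleftrightarrow> f summable_on UNIV"
  by (rule summable_on_reindex_bij_witness[of _ uminus uminus]) auto

lemma infsum_charf_mult:
  fixes c :: "int^3 \<Rightarrow> complex" and s :: "int^3 \<Rightarrow> int^3"
  assumes f: "integrable cell f" and c: "(\<lambda>m. cmod (c m)) summable_on UNIV"
  shows "AE x in cell. (\<lambda>m. cmod (c m * charf (s m) x * f x)) summable_on UNIV"
    and "integrable cell (\<lambda>x. \<Sum>\<^sub>\<infinity>m. c m * charf (s m) x * f x)"
    and "((\<lambda>m. c m * fc f (s m)) has_sum (LINT x|cell. (\<Sum>\<^sub>\<infinity>m. c m * charf (s m) x * f x))) UNIV"
proof -
  have int: "integrable cell (\<lambda>x. c m * charf (s m) x * f x)" for m :: "int^3"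
    using integrable_mult_right[OF integrable_charf_mult[OF f, of "s m"], of "c m"] by (simp add: mult.assoc)
  have "(LINT x|cell. norm (c m * charf (s m) x * f x)) = cmod (c m) * (LINT x|cell. norm (f x))" for m
    by (simp add: norm_mult)
  then have sm: "(\<lambda>m. LINT x|cell. norm (c m * charf (s m) x * f x)) summable_on UNIV"
    using summable_on_cmult_left[OF c, of "LINT x|cell. norm (f x)"] by simp
  note * = integral_infsum_countable[OF int sm]
  show "AE x in cell. (\<lambda>m. cmod (c m * charf (s m) x * f x)) summable_on UNIV"
    and "integrable cell (\<lambda>x. \<Sum>\<^sub>\<infinity>m. c m * charf (s m) x * f x)"
    by (fact *(1,2))+
  show "((\<lambda>m. c m * fc f (s m)) has_sum (LINT x|cell. (\<Sum>\<^sub>\<infinity>m. c m * charf (s m) x * f x))) UNIV"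
    using *(3) by (simp add: fc_def mult.assoc)
qed

text \<open>The series converges absolutely to an integrable function with the same coefficients as
  \<phi>, and uniqueness of coefficients identifies the two.\<close>

lemma test_eq_fourier_series:
  assumes \<phi>: "\<phi> \<in> torus_test_functions"
  shows "AE x in cell. \<phi> x = (\<Sum>\<^sub>\<infinity>m. fc \<phi> (- m) * charf m x)"
proof -
  have c: "(\<lambda>m. cmod (fc \<phi> (- m))) summable_on UNIV"
    using test_fc_summable[OF \<phi>] by (subst summable_on_uminus_iff)
  define g where "g x = (\<Sum>\<^sub>\<infinity>m. fc \<phi> (- m) * charf m x)" for x
  have one: "integrable cell (charf k)" for k
    by (intro test_integrable charf_test)
  have g: "integrable cell g"
    using infsum_charf_mult(2)[OF one[of 0] c, of "\<lambda>m. m"] by (simp add: g_def[abs_def])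
  have "fc g k = fc \<phi> k" for k
  proof -
    have eq: "(\<Sum>\<^sub>\<infinity>m. fc \<phi> (- m) * charf m x * charf k x) = charf k x * g x" for x
      unfolding g_def by (subst infsum_cmult_left') (simp add: mult.commute)
    have 1: "((\<lambda>m. fc \<phi> (- m) * fc (charf k) m) has_sum fc g k) UNIV"
      using infsum_charf_mult(3)[OF one[of k] c, of "\<lambda>m. m"] unfolding eq fc_def[of g] .
    have 2: "((\<lambda>m. fc \<phi> (- m) * fc (charf k) m) has_sum (\<Sum>m\<in>{-k}. fc \<phi> (- m) * fc (charf k) m)) UNIV"
      by (rule has_sum_finite_neutralI[where B = "{-k}"]) (auto simp: fc_charf)
    show ?thesis
      using has_sum_unique[OF 1 2] by (simp add: fc_charf)
  qed
  then have "fc (\<lambda>x. \<phi> x - g x) k = 0" for k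
    unfolding fc_def
    using integrable_charf_mult[OF test_integrable[OF \<phi>], of k] integrable_charf_mult[OF g, of k]
    by (simp add: right_diff_distrib Bochner_Integration.integral_diff flip: fc_def)
  then have "AE x in cell. \<phi> x - g x = 0"
    by (intro fc_zero_imp_AE_zero Bochner_Integration.integrable_diff test_integrable[OF \<phi>] g)
  then show ?thesis by (simp add: g_def)
qed

text \<open>A Parseval identity in which \<open>f\<close> is merely integrable, the absolute
  summability being supplied by \<phi>. This generality is what \<open>sigma_tilde\<close> calls
  for, which is handled below only as an integrable function.\<close>

lemma integral_mult_test:
  assumes f: "integrable cell f" and \<phi>: "\<phi> \<in> torus_test_functions"
  shows "((\<lambda>m. fc f m * fc \<phi> (- m)) has_sum dist_of_fun f \<phi>) UNIV"
proof -
  have c: "(\<lambda>m. cmod (fc \<phi> (- m))) summable_on UNIV"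
    using test_fc_summable[OF \<phi>] by (subst summable_on_uminus_iff)
  have eq: "(\<Sum>\<^sub>\<infinity>m. fc \<phi> (- m) * charf m x * f x) = f x * (\<Sum>\<^sub>\<infinity>m. fc \<phi> (- m) * charf m x)" for x
    by (subst infsum_cmult_left') (simp add: mult.commute)
  note * = infsum_charf_mult[OF f c, of "\<lambda>m. m"]
  have "(LINT x|cell. f x * \<phi> x) = (LINT x|cell. (\<Sum>\<^sub>\<infinity>m. fc \<phi> (- m) * charf m x * f x))"
  proof (rule integral_cong_AE)
    show "AE x in cell. f x * \<phi> x = (\<Sum>\<^sub>\<infinity>m. fc \<phi> (- m) * charf m x * f x)"
      using test_eq_fourier_series[OF \<phi>] by eventually_elim (simp only: eq)
  qed (use f test_measurable[OF \<phi>] *(2) in auto)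
  then show ?thesis
    using *(3) by (simp add: dist_of_fun_def mult.commute)
qed

lemma square_integrable_imp_integrable:
  assumes "square_integrable f" shows "integrable cell f"
proof (rule Bochner_Integration.integrable_bound)
  show "integrable cell (\<lambda>x. 1 + (cmod (f x))\<^sup>2)"
    using assms by (simp add: square_integrable_def)
  have "a \<le> 1 + a\<^sup>2" for a :: real
    using zero_le_power2[of "a - 1/2"] by (simp add: power2_eq_square algebra_simps)
  then show "AE x in cell. norm (f x) \<le> norm (1 + (cmod (f x))\<^sup>2)" by simp
qed (use assms in \<open>simp add: square_integrable_def\<close>)

lemma square_integrable_mult:
  assumes f: "square_integrable f" and g: "square_integrable g"
  shows "integrable cell (\<lambda>x. f x * cnj (g x))"
proof (rule Bochner_Integration.integrable_bound)
  show "integrable cell (\<lambda>x. (cmod (f x))\<^sup>2 + (cmod (g x))\<^sup>2)"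
    using assms by (simp add: square_integrable_def)
  have "a * b \<le> a\<^sup>2 + b\<^sup>2" if "a \<ge> 0" "b \<ge> 0" for a b :: real
  proof -
    have "2 * (a * b) \<le> a\<^sup>2 + b\<^sup>2"
      using zero_le_power2[of "a - b"] by (simp add: power2_eq_square algebra_simps)
    then show ?thesis using mult_nonneg_nonneg[OF that] by linarith
  qed
  then show "AE x in cell. norm (f x * cnj (g x)) \<le> norm ((cmod (f x))\<^sup>2 + (cmod (g x))\<^sup>2)"
    by (simp add: norm_mult)
  have [measurable]: "f \<in> borel_measurable cell" "g \<in> borel_measurable cell"
    using assms by (auto simp: square_integrable_def)
  have "(\<lambda>x. cnj (g x)) \<in> borel_measurable cell"
    by (rule measurable_compose[OF _ borel_measurable_continuous_onI]) (auto intro: continuous_intros)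
  then show "(\<lambda>x. f x * cnj (g x)) \<in> borel_measurable cell" by measurable
qed

lemma square_integrable_charf: "square_integrable (\<lambda>x. c * charf m x)"
  unfolding square_integrable_def by (auto simp: norm_mult)

lemma square_integrable_sum:
  "finite F \<Longrightarrow> (\<And>i. i \<in> F \<Longrightarrow> square_integrable (f i)) \<Longrightarrow> square_integrable (\<lambda>x. \<Sum>i\<in>F. f i x)"
  by (induction F rule: finite_induct) (auto intro: square_integrable_zero square_integrable_add)

definition norm2 :: "(real^3 \<Rightarrow> complex) \<Rightarrow> real" where
  "norm2 f = (LINT x|cell. (cmod (f x))\<^sup>2)"

lemma norm2_complex: "(LINT x|cell. f x * cnj (f x)) = of_real (norm2 f)"
  by (simp add: norm2_def complex_norm_square[symmetric] flip: integral_complex_of_real)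

definition trig_sum :: "(int^3 \<Rightarrow> complex) \<Rightarrow> (int^3) set \<Rightarrow> real^3 \<Rightarrow> complex" where
  "trig_sum c F x = (\<Sum>m\<in>F. c m * charf (- m) x)"

lemma square_integrable_trig_sum: "finite F \<Longrightarrow> square_integrable (trig_sum c F)"
  unfolding trig_sum_def[abs_def] by (intro square_integrable_sum square_integrable_charf)

lemma integral_cnj_trig_sum:
  assumes f: "square_integrable f" and F: "finite F"
  shows "(LINT x|cell. f x * cnj (trig_sum c F x)) = (\<Sum>m\<in>F. cnj (c m) * fc f m)"
proof -
  have "(LINT x|cell. f x * cnj (trig_sum c F x)) = (LINT x|cell. (\<Sum>m\<in>F. cnj (c m) * (charf m x * f x)))"
    unfolding trig_sum_def cnj_sum complex_cnj_mult cnj_charf minus_minus sum_distrib_left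
    by (simp only: mult.left_commute mult.commute)
  also have "\<dots> = (\<Sum>m\<in>F. LINT x|cell. cnj (c m) * (charf m x * f x))"
    by (intro Bochner_Integration.integral_sum integrable_mult_right integrable_charf_mult
        square_integrable_imp_integrable f)
  also have "\<dots> = (\<Sum>m\<in>F. cnj (c m) * fc f m)"
    by (simp add: fc_def)
  finally show ?thesis .
qed

lemma charf_diff: "charf (k - m) x = charf k x * charf (- m) x"
  using charf_add[of k "- m" x] by simp

lemma fc_trig_sum:
  assumes "finite F"
  shows "fc (trig_sum c F) k = (if k \<in> F then c k else 0)"
proof -
  have "fc (trig_sum c F) k = (LINT x|cell. (\<Sum>m\<in>F. c m * charf (k - m) x))"
    unfolding fc_def trig_sum_def sum_distrib_left charf_diff by (simp only: mult.left_commute)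
  also have "\<dots> = (\<Sum>m\<in>F. LINT x|cell. c m * charf (k - m) x)"
    by (intro Bochner_Integration.integral_sum integrable_mult_right test_integrable charf_test)
  also have "\<dots> = (\<Sum>m\<in>F. c m * (if k - m = 0 then 1 else 0))"
    by (simp add: integral_charf)
  also have "\<dots> = (if k \<in> F then c k else 0)"
    using assms by (simp add: if_distrib[where f = "\<lambda>u. _ * u"] cong: if_cong)
  finally show ?thesis .
qed

lemma norm2_trig_sum:
  assumes F: "finite F" shows "norm2 (trig_sum c F) = (\<Sum>m\<in>F. (cmod (c m))\<^sup>2)"
proof -
  have "complex_of_real (norm2 (trig_sum c F)) = (\<Sum>m\<in>F. cnj (c m) * fc (trig_sum c F) m)"
    using integral_cnj_trig_sum[OF square_integrable_trig_sum[OF F] F, of c c]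
    by (simp add: norm2_complex)
  also have "\<dots> = of_real (\<Sum>m\<in>F. (cmod (c m))\<^sup>2)"
    using F by (simp add: fc_trig_sum mult.commute flip: complex_norm_square)
  finally show ?thesis by (simp only: of_real_eq_iff)
qed

text \<open>Expand the nonnegative integral of |f - s|^2 for the partial Fourier sum s: the cross
  term and the square of s both equal the left-hand side.\<close>

lemma bessel:
  assumes f: "square_integrable f" and F: "finite F"
  shows "(\<Sum>m\<in>F. (cmod (fc f m))\<^sup>2) \<le> norm2 f"
proof -
  let ?s = "trig_sum (fc f) F"
  let ?S = "\<Sum>m\<in>F. (cmod (fc f m))\<^sup>2"
  have s: "square_integrable ?s" by (rule square_integrable_trig_sum[OF F])
  have fs: "(LINT x|cell. f x * cnj (?s x)) = of_real ?S"
    unfolding integral_cnj_trig_sum[OF f F] by (simp add: mult.commute flip: complex_norm_square)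
  have "0 \<le> (LINT x|cell. (cmod (f x - ?s x))\<^sup>2)" by simp
  also have "(\<lambda>x. (cmod (f x - ?s x))\<^sup>2) = (\<lambda>x. (cmod (f x))\<^sup>2 + (cmod (?s x))\<^sup>2 - 2 * Re (f x * cnj (?s x)))"
  proof
    have "(cmod (a - b))\<^sup>2 = (cmod a)\<^sup>2 + (cmod b)\<^sup>2 - 2 * Re (a * cnj b)" for a b
      unfolding cmod_power2 by (simp add: power2_eq_square algebra_simps)
    then show "(cmod (f x - ?s x))\<^sup>2 = (cmod (f x))\<^sup>2 + (cmod (?s x))\<^sup>2 - 2 * Re (f x * cnj (?s x))" for x .
  qed
  also have "(LINT x|cell. (cmod (f x))\<^sup>2 + (cmod (?s x))\<^sup>2 - 2 * Re (f x * cnj (?s x))) =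
      norm2 f + norm2 ?s - 2 * (LINT x|cell. Re (f x * cnj (?s x)))"
  proof -
    have "integrable cell (\<lambda>x. (cmod (f x))\<^sup>2)" "integrable cell (\<lambda>x. (cmod (?s x))\<^sup>2)"
      using f s by (simp_all add: square_integrable_def)
    moreover have "integrable cell (\<lambda>x. Re (f x * cnj (?s x)))"
      by (rule integrable_Re[OF square_integrable_mult[OF f s]])
    ultimately show ?thesis
      unfolding norm2_def by (simp del: times_complex.sel complex_cnj_mult)
  qed
  also have "(LINT x|cell. Re (f x * cnj (?s x))) = ?S"
    using integral_Re[OF square_integrable_mult[OF f s]] fs by simp
  finally show ?thesis using norm2_trig_sum[OF F, of "fc f"] by simp
qed

section \<open>The Riesz-Fischer theorem and Parseval's identity\<close>

lemma has_sum_diff: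
  fixes f g :: "'i \<Rightarrow> 'b::real_normed_vector"
  assumes "(f has_sum a) A" "(g has_sum b) A"
  shows "((\<lambda>x. f x - g x) has_sum (a - b)) A"
  using has_sum_add[OF assms(1), of "\<lambda>x. - g x" "- b"] assms(2) by (simp add: has_sum_uminus)

lemma fc_cong_AE:
  assumes "AE x in cell. f x = g x" "f \<in> borel_measurable cell" "g \<in> borel_measurable cell"
  shows "fc f m = fc g m"
  unfolding fc_def using assms by (intro integral_cong_AE) (auto elim: eventually_mono)

lemma fc_add:
  assumes "integrable cell f" "integrable cell g"
  shows "fc (\<lambda>x. f x + g x) m = fc f m + fc g m"
  unfolding fc_def distrib_left
  by (intro Bochner_Integration.integral_add integrable_charf_mult assms)

lemma fc_cmult: "fc (\<lambda>x. c * f x) m = c * fc f m"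
  unfolding fc_def mult.left_commute[of _ c] by (rule integral_mult_right_zero)

text \<open>Partial sums over sets with geometrically small tails have L^1-summable differences, so
  they converge almost everywhere and in L^1, which fixes the coefficients of the limit. Fatou's
  lemma bounds its L^2 norm; that bound is the missing half of Parseval's identity.\<close>

lemma riesz_fischer:
  assumes c: "(\<lambda>m. (cmod (c m))\<^sup>2) summable_on UNIV"
  shows "\<exists>f. square_integrable f \<and> (\<forall>m. fc f m = c m) \<and> norm2 f \<le> (\<Sum>\<^sub>\<infinity>m. (cmod (c m))\<^sup>2)"
proof -
  define S where "S = (\<Sum>\<^sub>\<infinity>m. (cmod (c m))\<^sup>2)"
  have bd: "(\<Sum>m\<in>G. (cmod (c m))\<^sup>2) \<le> S" if "finite G" for G
    unfolding S_def by (rule finite_sum_le_infsum[OF c that]) auto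
  have "\<exists>F. finite F \<and> (\<forall>G. finite G \<and> G \<inter> F = {} \<longrightarrow> (\<Sum>m\<in>G. (cmod (c m))\<^sup>2) \<le> (1/4)^n)" for n
  proof -
    have "((\<lambda>m. (cmod (c m))\<^sup>2) has_sum S) UNIV"
      unfolding S_def using c by (rule has_sum_infsum)
    then have "\<forall>\<^sub>F F in finite_subsets_at_top UNIV. dist (\<Sum>m\<in>F. (cmod (c m))\<^sup>2) S < (1/4)^n"
      unfolding has_sum_def by (rule tendstoD) simp
    then obtain F where F: "finite F" "dist (\<Sum>m\<in>F. (cmod (c m))\<^sup>2) S < (1/4)^n"
      unfolding eventually_finite_subsets_at_top by blast
    have "(\<Sum>m\<in>G. (cmod (c m))\<^sup>2) \<le> (1/4)^n" if G: "finite G" "G \<inter> F = {}" for G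
    proof -
      have "(\<Sum>m\<in>G. (cmod (c m))\<^sup>2) + (\<Sum>m\<in>F. (cmod (c m))\<^sup>2) = (\<Sum>m\<in>G \<union> F. (cmod (c m))\<^sup>2)"
        using G F by (simp add: sum.union_disjoint)
      also have "\<dots> \<le> S" using G F by (intro bd) auto
      finally show ?thesis using F(2) unfolding dist_real_def by linarith
    qed
    then show ?thesis using F by blast
  qed
  then obtain F where F: "\<And>n. finite (F n)"
    and tail: "\<And>n G. finite G \<Longrightarrow> G \<inter> F n = {} \<Longrightarrow> (\<Sum>m\<in>G. (cmod (c m))\<^sup>2) \<le> (1/4)^n"
    by metis
  define s where "s n = trig_sum c (F n)" for n
  define h where "h n x = s (Suc n) x - s n x" for n x
  have sq_s: "square_integrable (s n)" for n
    unfolding s_def by (rule square_integrable_trig_sum[OF F])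
  have h_eq: "h n = trig_sum (\<lambda>m. (if m \<in> F (Suc n) then c m else 0) - (if m \<in> F n then c m else 0)) (F n \<union> F (Suc n))" for n
  proof
    fix x
    have "trig_sum c (F (Suc n)) x = (\<Sum>m\<in>F n \<union> F (Suc n). (if m \<in> F (Suc n) then c m else 0) * charf (- m) x)"
      unfolding trig_sum_def by (rule sum.mono_neutral_cong_left) (use F in auto)
    moreover have "trig_sum c (F n) x = (\<Sum>m\<in>F n \<union> F (Suc n). (if m \<in> F n then c m else 0) * charf (- m) x)"
      unfolding trig_sum_def by (rule sum.mono_neutral_cong_left) (use F in auto)
    ultimately show "h n x = trig_sum (\<lambda>m. (if m \<in> F (Suc n) then c m else 0) - (if m \<in> F n then c m else 0)) (F n \<union> F (Suc n)) x"
      by (simp add: h_def s_def trig_sum_def[of _ "F n \<union> F (Suc n)"] left_diff_distrib sum_subtractf)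
  qed
  have sq_h: "square_integrable (h n)" for n
    unfolding h_eq by (rule square_integrable_trig_sum) (use F in auto)
  have norm2_h: "norm2 (h n) \<le> 2 * (1/4)^n" for n
  proof -
    have "norm2 (h n) = (\<Sum>m\<in>F n \<union> F (Suc n). (cmod ((if m \<in> F (Suc n) then c m else 0) - (if m \<in> F n then c m else 0)))\<^sup>2)"
      unfolding h_eq by (rule norm2_trig_sum) (use F in auto)
    \<comment> \<open>The sets \<open>F n\<close> are not nested, so the difference lives on a
      symmetric difference; each half avoids one of the two sets and is a tail.\<close>
    also have "\<dots> = (\<Sum>m\<in>(F n - F (Suc n)) \<union> (F (Suc n) - F n). (cmod (c m))\<^sup>2)"
      by (rule sum.mono_neutral_cong_right) (use F in auto)
    also have "\<dots> = (\<Sum>m\<in>F n - F (Suc n). (cmod (c m))\<^sup>2) + (\<Sum>m\<in>F (Suc n) - F n. (cmod (c m))\<^sup>2)"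
      by (rule sum.union_disjoint) (use F in auto)
    also have "\<dots> \<le> (1/4)^Suc n + (1/4)^n"
      by (intro add_mono tail) (use F in auto)
    also have "\<dots> \<le> 2 * (1/4)^n" by simp
    finally show ?thesis .
  qed
  have int_h: "integrable cell (h n)" for n
    by (rule square_integrable_imp_integrable[OF sq_h])
  have L1_h: "(LINT x|cell. cmod (h n x)) \<le> 2 * (1/2)^n" for n
  proof -
    let ?t = "(1/2)^n :: real"
    have t: "?t > 0" by simp
    have tt: "(1/4)^n = ?t * ?t" by (simp flip: power_mult_distrib)
    \<comment> \<open>The weighted inequality between arithmetic and geometric mean, with weight
      (1/2)^n matched to the size of \<open>h n\<close>, takes the place of the Cauchy-Schwarz
      inequality.\<close>
    have pw: "a \<le> 1/2 * ?t + 1/(2 * ?t) * a\<^sup>2" for a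
    proof -
      have "2 * (a * ?t) \<le> ?t * ?t + a\<^sup>2"
        using zero_le_power2[of "a - ?t"] by (simp add: power2_eq_square algebra_simps)
      then have "(2 * (a * ?t)) / (2 * ?t) \<le> (?t * ?t + a\<^sup>2) / (2 * ?t)"
        using t by (intro divide_right_mono) auto
      then show ?thesis using t by (simp add: add_divide_distrib)
    qed
    have i2: "integrable cell (\<lambda>x. (cmod (h n x))\<^sup>2)"
      using sq_h[of n] by (simp add: square_integrable_def)
    have "(LINT x|cell. cmod (h n x)) \<le> (LINT x|cell. 1/2 * ?t + 1/(2 * ?t) * (cmod (h n x))\<^sup>2)"
      by (intro integral_mono integrable_norm int_h pw Bochner_Integration.integrable_add
          integrable_mult_right i2 cell.integrable_const)
    also have "\<dots> = 1/2 * ?t + 1/(2 * ?t) * norm2 (h n)"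
      unfolding norm2_def using i2
      by (subst Bochner_Integration.integral_add) (auto simp: measure_cell)
    also have "\<dots> \<le> 1/2 * ?t + 1/(2 * ?t) * (2 * (?t * ?t))"
      using norm2_h[of n] t unfolding tt by (intro add_left_mono mult_left_mono) auto
    also have "\<dots> \<le> 2 * ?t" using t by simp
    finally show ?thesis .
  qed
  have smh: "(\<lambda>n. LINT x|cell. cmod (h n x)) summable_on UNIV"
  proof (rule norm_summable_imp_summable_on, rule summable_comparison_test')
    show "summable (\<lambda>n. 2 * (1/2 :: real)^n)" by (intro summable_mult summable_geometric) auto
    show "norm (norm (LINT x|cell. cmod (h n x))) \<le> 2 * (1/2)^n" if "n \<ge> 0" for n
      using L1_h[of n] by simp
  qed
  define f where "f x = s 0 x + (\<Sum>\<^sub>\<infinity>n. h n x)" for x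
  have int_s: "integrable cell (s n)" for n
    by (rule square_integrable_imp_integrable[OF sq_s])
  note ii = integral_infsum_countable[OF int_h smh]
  have int_f: "integrable cell f"
    unfolding f_def by (intro Bochner_Integration.integrable_add int_s ii(2))
  have tele: "(\<Sum>n<N. h n x) = s N x - s 0 x" for N x
    unfolding h_def by (rule sum_lessThan_telescope)
  have lim: "AE x in cell. (\<lambda>n. s n x) \<longlonglongrightarrow> f x"
    using ii(1)
  proof eventually_elim
    case (elim x)
    then have "(\<lambda>n. h n x) summable_on UNIV"
      by (simp add: summable_on_iff_abs_summable_on_complex)
    then have "(\<lambda>n. h n x) sums (\<Sum>\<^sub>\<infinity>n. h n x)"
      by (intro has_sum_imp_sums has_sum_infsum)
    then have "(\<lambda>N. s 0 x + (s N x - s 0 x)) \<longlonglongrightarrow> s 0 x + (\<Sum>\<^sub>\<infinity>n. h n x)"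
      unfolding sums_def tele by (intro tendsto_intros)
    then show ?case by (simp add: f_def)
  qed
  have fc_f: "fc f k = c k" for k
  proof -
    have int_kh: "integrable cell (\<lambda>x. charf k x * h n x)" for n
      by (rule integrable_charf_mult[OF int_h])
    have "(\<lambda>n. LINT x|cell. cmod (charf k x * h n x)) summable_on UNIV"
      using smh by (simp add: norm_mult)
    from integral_infsum_countable(3)[OF int_kh this]
    have "((\<lambda>n. fc (h n) k) has_sum fc (\<lambda>x. \<Sum>\<^sub>\<infinity>n. h n x) k) UNIV"
      unfolding fc_def infsum_cmult_right' .
    then have sums: "(\<lambda>n. fc (h n) k) sums fc (\<lambda>x. \<Sum>\<^sub>\<infinity>n. h n x) k"
      by (rule has_sum_imp_sums)
    have fch: "fc (h n) k = fc (s (Suc n)) k - fc (s n) k" for n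
      unfolding h_def[abs_def] fc_def right_diff_distrib
      by (intro Bochner_Integration.integral_diff integrable_charf_mult int_s)
    have "(\<Sum>n<N. fc (h n) k) = fc (s N) k - fc (s 0) k" for N
      unfolding fch by (rule sum_lessThan_telescope)
    then have "(\<lambda>N. fc (s N) k - fc (s 0) k) \<longlonglongrightarrow> fc (\<lambda>x. \<Sum>\<^sub>\<infinity>n. h n x) k"
      using sums by (simp add: sums_def)
    then have "(\<lambda>N. fc (s 0) k + (fc (s N) k - fc (s 0) k)) \<longlonglongrightarrow> fc (s 0) k + fc (\<lambda>x. \<Sum>\<^sub>\<infinity>n. h n x) k"
      by (intro tendsto_intros)
    then have l1: "(\<lambda>N. fc (s N) k) \<longlonglongrightarrow> fc f k"
      unfolding f_def[abs_def] by (subst fc_add[OF int_s ii(2)]) simp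
    have "(\<lambda>N. (cmod (c k - fc (s N) k))\<^sup>2) \<longlonglongrightarrow> 0"
    proof (rule tendsto_sandwich[of "\<lambda>_. 0"])
      \<comment> \<open>Either \<open>k\<close> lies in \<open>F N\<close> and the difference is 0,
        or \<open>{k}\<close> is disjoint from \<open>F N\<close> and counts as a tail.\<close>
      have "(cmod (c k - fc (s N) k))\<^sup>2 \<le> (1/4)^N" for N
        using tail[of "{k}" N] F[of N] by (auto simp: s_def fc_trig_sum)
      then show "\<forall>\<^sub>F N in sequentially. (cmod (c k - fc (s N) k))\<^sup>2 \<le> (1/4)^N" by simp
    qed (auto intro: LIMSEQ_realpow_zero)
    then have "(\<lambda>N. cmod (c k - fc (s N) k)) \<longlonglongrightarrow> 0"
      using tendsto_real_sqrt by fastforce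
    then have "(\<lambda>N. c k - fc (s N) k) \<longlonglongrightarrow> 0" by (rule tendsto_norm_zero_cancel)
    from tendsto_diff[OF tendsto_const[of "c k"] this] have "(\<lambda>N. fc (s N) k) \<longlonglongrightarrow> c k" by simp
    with l1 show ?thesis by (rule LIMSEQ_unique)
  qed
  have [measurable]: "f \<in> borel_measurable cell" "s n \<in> borel_measurable cell" for n
    using int_f int_s by auto
  have S0: "S \<ge> 0" unfolding S_def by (intro infsum_nonneg) auto
  have "(\<integral>\<^sup>+x. ennreal ((cmod (f x))\<^sup>2) \<partial>cell) = (\<integral>\<^sup>+x. liminf (\<lambda>n. ennreal ((cmod (s n x))\<^sup>2)) \<partial>cell)"
  proof (rule nn_integral_cong_AE, use lim in eventually_elim)
    case (elim x)
    then have "(\<lambda>n. ennreal ((cmod (s n x))\<^sup>2)) \<longlonglongrightarrow> ennreal ((cmod (f x))\<^sup>2)"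
      by (intro tendsto_intros)
    then show ?case by (intro lim_imp_Liminf[symmetric]) auto
  qed
  also have "\<dots> \<le> liminf (\<lambda>n. \<integral>\<^sup>+x. ennreal ((cmod (s n x))\<^sup>2) \<partial>cell)"
    by (rule nn_integral_liminf) measurable
  also have "\<dots> \<le> liminf (\<lambda>n::nat. ennreal S)"
  proof (rule Liminf_mono, rule always_eventually, rule allI)
    fix n
    have "(\<integral>\<^sup>+x. ennreal ((cmod (s n x))\<^sup>2) \<partial>cell) = ennreal (norm2 (s n))"
      unfolding norm2_def using sq_s[of n] by (intro nn_integral_eq_integral) (auto simp: square_integrable_def)
    also have "norm2 (s n) \<le> S"
      unfolding s_def norm2_trig_sum[OF F] by (rule bd[OF F])
    finally show "(\<integral>\<^sup>+x. ennreal ((cmod (s n x))\<^sup>2) \<partial>cell) \<le> ennreal S" by (simp add: ennreal_leI)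
  qed
  also have "\<dots> = ennreal S" by (simp add: Liminf_const)
  finally have nn: "(\<integral>\<^sup>+x. ennreal ((cmod (f x))\<^sup>2) \<partial>cell) \<le> ennreal S" .
  have "integrable cell (\<lambda>x. (cmod (f x))\<^sup>2)"
    using nn by (intro integrableI_nonneg) (auto intro: le_less_trans)
  moreover have "norm2 f \<le> S"
    unfolding norm2_def using nn S0
    by (subst integral_eq_nn_integral) (auto intro: enn2real_leI)
  ultimately show ?thesis
    using fc_f unfolding S_def by (intro exI[of _ f]) (simp add: square_integrable_def)
qed

lemma fc_inj:
  assumes f: "integrable cell f" and g: "integrable cell g" and eq: "\<And>m. fc f m = fc g m"
  shows "AE x in cell. f x = g x"
proof -
  have "fc (\<lambda>x. f x + (- 1) * g x) m = fc f m + (- 1) * fc g m" for m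
    unfolding fc_cmult[symmetric] by (rule fc_add) (use f g in auto)
  then have "AE x in cell. f x + (- 1) * g x = 0"
    using f g eq by (intro fc_zero_imp_AE_zero) auto
  then show ?thesis by simp
qed

text \<open>Riesz-Fischer rebuilds from the coefficients of \<open>f\<close> a function whose
  squared norm is at most their sum. By uniqueness it equals \<open>f\<close> almost everywhere,
  which reverses Bessel's inequality.\<close>

lemma parseval_norm2:
  assumes f: "square_integrable f"
  shows "((\<lambda>m. (cmod (fc f m))\<^sup>2) has_sum norm2 f) UNIV"
proof -
  have sm: "(\<lambda>m. (cmod (fc f m))\<^sup>2) summable_on UNIV"
    by (rule nonneg_bdd_above_summable_on) (auto intro!: bdd_aboveI2[of _ _ "norm2 f"] bessel[OF f])
  obtain g where g: "square_integrable g" "\<And>m. fc g m = fc f m" "norm2 g \<le> (\<Sum>\<^sub>\<infinity>m. (cmod (fc f m))\<^sup>2)"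
    using riesz_fischer[OF sm] by blast
  have "AE x in cell. f x = g x"
    by (intro fc_inj square_integrable_imp_integrable f g) (simp add: g)
  then have "norm2 f = norm2 g"
    unfolding norm2_def using f g(1)
    by (intro integral_cong_AE) (auto simp: square_integrable_def elim: eventually_mono)
  moreover have "(\<Sum>\<^sub>\<infinity>m. (cmod (fc f m))\<^sup>2) \<le> norm2 f"
    by (rule infsum_le_finite_sums[OF sm]) (rule bessel[OF f])
  ultimately have "(\<Sum>\<^sub>\<infinity>m. (cmod (fc f m))\<^sup>2) = norm2 f" using g(3) by linarith
  then show ?thesis using has_sum_infsum[OF sm] by simp
qed

text \<open>The factors 1 and -1 are written out so that all four squares are instances of one
  pattern \<open>a + w * b\<close>.\<close>

lemma polarization:
  "4 * (a * cnj b) = of_real ((cmod (a + 1 * b))\<^sup>2) - of_real ((cmod (a + (- 1) * b))\<^sup>2)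
     + \<i> * of_real ((cmod (a + \<i> * b))\<^sup>2) - \<i> * of_real ((cmod (a + (- \<i>) * b))\<^sup>2)"
  unfolding cmod_power2 by (simp add: complex_eq_iff power2_eq_square algebra_simps)

lemma parseval:
  assumes f: "square_integrable f" and g: "square_integrable g"
  shows "((\<lambda>m. fc f m * cnj (fc g m)) has_sum (LINT x|cell. f x * cnj (g x))) UNIV"
proof -
  define P where "P w = norm2 (\<lambda>x. f x + w * g x)" for w
  have sq: "square_integrable (\<lambda>x. f x + w * g x)" for w
    by (intro square_integrable_add square_integrable_scale f g)
  have fc: "fc (\<lambda>x. f x + w * g x) m = fc f m + w * fc g m" for w m
    unfolding fc_cmult[symmetric]
    by (intro fc_add integrable_mult_right square_integrable_imp_integrable f g)
  have 1: "((\<lambda>m. complex_of_real ((cmod (fc f m + w * fc g m))\<^sup>2)) has_sum of_real (P w)) UNIV" for w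
    using parseval_norm2[OF sq[of w]] unfolding P_def fc by (rule has_sum_of_real)
  have int: "integrable cell (\<lambda>x. complex_of_real ((cmod (f x + w * g x))\<^sup>2))" for w
    using sq[of w] unfolding square_integrable_def by (intro integrable_of_real) simp
  have P: "(LINT x|cell. complex_of_real ((cmod (f x + w * g x))\<^sup>2)) = of_real (P w)" for w
    unfolding P_def norm2_def by (rule integral_complex_of_real)
  have comb: "(LINT x|cell. a x - b x + c x - d x) = (LINT x|cell. a x) - (LINT x|cell. b x) + (LINT x|cell. c x) - (LINT x|cell. d x)"
    if "integrable cell a" "integrable cell b" "integrable cell c" "integrable cell d" for a b c d :: "real^3 \<Rightarrow> complex"
    using that by simp
  have "4 * (LINT x|cell. f x * cnj (g x)) = (LINT x|cell. 4 * (f x * cnj (g x)))"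
    by (rule integral_mult_right_zero[symmetric])
  also have "\<dots> = of_real (P 1) - of_real (P (- 1)) + \<i> * of_real (P \<i>) - \<i> * of_real (P (- \<i>))"
    unfolding polarization P[symmetric] integral_mult_right_zero[symmetric]
    by (intro comb int integrable_mult_right)
  finally have "4 * (LINT x|cell. f x * cnj (g x)) = of_real (P 1) - of_real (P (- 1)) + \<i> * of_real (P \<i>) - \<i> * of_real (P (- \<i>))" .
  moreover have "((\<lambda>m. 4 * (fc f m * cnj (fc g m))) has_sum
      of_real (P 1) - of_real (P (- 1)) + \<i> * of_real (P \<i>) - \<i> * of_real (P (- \<i>))) UNIV"
    unfolding polarization by (intro has_sum_add has_sum_diff has_sum_cmult_right 1)
  ultimately have "((\<lambda>m. 4 * (fc f m * cnj (fc g m))) has_sum 4 * (LINT x|cell. f x * cnj (g x))) UNIV" by simp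
  from has_sum_cmult_right[OF this, of "1/4"] show ?thesis by simp
qed

section \<open>Fourier representation of the operators\<close>

lemma square_integrable_rep: "square_integrable (rep_L2T u)"
  using Quotient_rep_reflp[OF Quotient_L2T, of u] by (simp add: L2_eq_def)

lemma integrable_rep: "integrable cell (rep_L2T u)"
  by (rule square_integrable_imp_integrable[OF square_integrable_rep])

lemma abs_rep_L2T: "abs_L2T (rep_L2T u) = u"
  by (rule Quotient_abs_rep[OF Quotient_L2T])

lemma L2_eq_rep: "L2_eq (rep_L2T u) (rep_L2T u)"
  using square_integrable_rep by (simp add: L2_eq_def)

lemma fcoef_abs: "square_integrable f \<Longrightarrow> fcoef (abs_L2T f) m = fc f m"
proof -
  assume f: "square_integrable f"
  then have "L2_eq (rep_L2T (abs_L2T f)) f"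
    by (intro Quotient_rep_abs[OF Quotient_L2T]) (simp add: L2_eq_def)
  then show ?thesis
    unfolding fcoef_eq_fc by (intro fc_cong_AE) (auto simp: L2_eq_def square_integrable_def)
qed

text \<open>With \<open>fcoef_surj\<close> this makes the coefficients faithful coordinates on the
  quotient type, so that later identities are checked mode by mode without choosing
  representatives.\<close>

lemma fcoef_inject:
  assumes "\<And>m. fcoef u m = fcoef v m" shows "u = v"
proof -
  have "AE x in cell. rep_L2T u x = rep_L2T v x"
    using assms by (intro fc_inj integrable_rep) (simp add: fcoef_eq_fc)
  then have "L2_eq (rep_L2T u) (rep_L2T v)" by (simp add: L2_eq_def square_integrable_rep)
  then show ?thesis using Quotient_rel_rep[OF Quotient_L2T] by blast
qed

lemma fcoef_surj:
  assumes "(\<lambda>m. (cmod (c m))\<^sup>2) summable_on UNIV"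
  shows "\<exists>u. \<forall>m. fcoef u m = c m"
  using riesz_fischer[OF assms] fcoef_abs by metis

lemma fcoef_add [simp]: "fcoef (u + v) m = fcoef u m + fcoef v m"
proof -
  have "u + v = abs_L2T (\<lambda>x. rep_L2T u x + rep_L2T v x)"
    using plus_L2T.abs_eq[OF L2_eq_rep L2_eq_rep, of u v] by (simp add: abs_rep_L2T)
  then show ?thesis
    by (simp add: fcoef_abs square_integrable_add square_integrable_rep fc_add integrable_rep flip: fcoef_eq_fc)
qed

lemma fcoef_scale [simp]: "fcoef (scale_L2 c u) m = c * fcoef u m"
proof -
  have "scale_L2 c u = abs_L2T (\<lambda>x. c * rep_L2T u x)"
    using scale_L2.abs_eq[OF L2_eq_rep, of c u] by (simp add: abs_rep_L2T)
  then show ?thesis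
    by (simp add: fcoef_abs square_integrable_scale square_integrable_rep fc_cmult flip: fcoef_eq_fc)
qed

lemma fcoef_zero [simp]: "fcoef 0 m = 0"
  using fcoef_add[of 0 0 m] by simp

lemma fcoef_uminus [simp]: "fcoef (- u) m = - fcoef u m"
proof -
  have "fcoef u m + fcoef (- u) m = 0"
    using fcoef_add[of u "- u" m] by simp
  then show ?thesis by (metis add.commute eq_neg_iff_add_eq_0)
qed

lemma fcoef_sum [simp]: "fcoef (\<Sum>i\<in>I. f i) m = (\<Sum>i\<in>I. fcoef (f i) m)"
  by (induction I rule: infinite_finite_induct) auto

lemma L2_parseval: "((\<lambda>m. fcoef u m * cnj (fcoef v m)) has_sum inner_L2 u v) UNIV"
  unfolding fcoef_eq_fc inner_L2_def by (intro parseval square_integrable_rep)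

lemma L2_parseval_norm: "((\<lambda>m. (cmod (fcoef u m))\<^sup>2) has_sum Re (inner_L2 u u)) UNIV"
proof -
  have "Re (z * cnj z) = (cmod z)\<^sup>2" for z
    unfolding cmod_power2 by (simp add: power2_eq_square)
  then show ?thesis using has_sum_Re[OF L2_parseval[of u u]] by simp
qed

lemma inner_L2_add_left: "inner_L2 (u + v) w = inner_L2 u w + inner_L2 v w"
proof -
  have "((\<lambda>m. fcoef (u + v) m * cnj (fcoef w m)) has_sum (inner_L2 u w + inner_L2 v w)) UNIV"
    unfolding fcoef_add distrib_right by (intro has_sum_add L2_parseval)
  with L2_parseval show ?thesis by (rule has_sum_unique)
qed

lemma inner_L2_scale_left: "inner_L2 (scale_L2 c u) w = c * inner_L2 u w"
proof -
  have "((\<lambda>m. fcoef (scale_L2 c u) m * cnj (fcoef w m)) has_sum (c * inner_L2 u w)) UNIV"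
    unfolding fcoef_scale mult.assoc by (intro has_sum_cmult_right L2_parseval)
  with L2_parseval show ?thesis by (rule has_sum_unique)
qed

lemma inner_L2_cnj: "cnj (inner_L2 u v) = inner_L2 v u"
proof -
  have "((\<lambda>m. cnj (fcoef u m * cnj (fcoef v m))) has_sum cnj (inner_L2 u v)) UNIV"
    unfolding has_sum_cnj_iff by (rule L2_parseval)
  then have "((\<lambda>m. fcoef v m * cnj (fcoef u m)) has_sum cnj (inner_L2 u v)) UNIV"
    by (simp add: mult.commute)
  then show ?thesis using L2_parseval has_sum_unique by blast
qed

lemma inner_L2_ge0: "0 \<le> Re (inner_L2 u u)"
  by (rule has_sum_nonneg[OF L2_parseval_norm]) simp

lemma inner_L2_eq0:
  assumes "Re (inner_L2 u u) = 0" shows "u = 0"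
proof (rule fcoef_inject)
  fix m
  have "((\<lambda>m. (cmod (fcoef u m))\<^sup>2) has_sum 0) UNIV"
    using L2_parseval_norm[of u] assms by simp
  then have "(cmod (fcoef u m))\<^sup>2 = 0"
    by (rule nonneg_has_sum_le_0D) auto
  then show "fcoef u m = fcoef 0 m" by simp
qed

lemma summable_fcoef_mult_bounded:
  assumes "\<And>m. cmod (w m) \<le> C"
  shows "(\<lambda>m. (cmod (w m * fcoef u m))\<^sup>2) summable_on UNIV"
proof (rule summable_on_comparison_test)
  show "(\<lambda>m. C\<^sup>2 * (cmod (fcoef u m))\<^sup>2) summable_on UNIV"
    using L2_parseval_norm[of u] by (intro summable_on_cmult_right) (auto simp: summable_on_def)
  show "(cmod (w m * fcoef u m))\<^sup>2 \<le> C\<^sup>2 * (cmod (fcoef u m))\<^sup>2" for m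
    using assms[of m] by (simp add: norm_mult power_mult_distrib mult_right_mono power_mono)
qed auto

lemma has_sum_finite_sum:
  fixes f :: "'i \<Rightarrow> 'a \<Rightarrow> 'b::topological_comm_monoid_add"
  assumes "finite I" "\<And>i. i \<in> I \<Longrightarrow> (f i has_sum s i) A"
  shows "((\<lambda>x. \<Sum>i\<in>I. f i x) has_sum (\<Sum>i\<in>I. s i)) A"
  using assms by (induction I rule: finite_induct) (auto intro!: has_sum_add)

definition freq :: "real^3 \<Rightarrow> int^3 \<Rightarrow> real^3" where
  "freq \<theta> m = (2 * pi) *\<^sub>R ivec m + \<theta>"

lemma freq_nth: "freq \<theta> m $ j = 2 * pi * of_int (m $ j) + \<theta> $ j"
  by (simp add: freq_def)

lemma dist_of_has_sum:
  "\<phi> \<in> torus_test_functions \<Longrightarrow> ((\<lambda>m. fcoef u m * fc \<phi> (- m)) has_sum dist_of u \<phi>) UNIV"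
  unfolding dist_of_def fcoef_eq_fc by (intro integral_mult_test integrable_rep)

text \<open>All derivatives fall on the test function, so \<open>u\<close> may be any element of
  L^2. Direction \<open>j\<close> contributes the symbol (2 pi m_j + \<theta>_j)^2.\<close>

lemma bloch_laplacian_has_sum:
  assumes \<phi>: "\<phi> \<in> torus_test_functions"
  shows "((\<lambda>m. of_real ((norm (freq \<theta> m))\<^sup>2) * fcoef u m * fc \<phi> (- m)) has_sum bloch_laplacian \<theta> (dist_of u) \<phi>) UNIV"
proof -
  have 1: "((\<lambda>m. - (fcoef u m * fc (partial_deriv j (partial_deriv j \<phi>)) (- m))
      - 2 * \<i> * of_real (\<theta> $ j) * (fcoef u m * fc (partial_deriv j \<phi>) (- m))
      + (of_real (\<theta> $ j))\<^sup>2 * (fcoef u m * fc \<phi> (- m))) has_sum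
      (- dist_of u (partial_deriv j (partial_deriv j \<phi>))
       - 2 * \<i> * of_real (\<theta> $ j) * dist_of u (partial_deriv j \<phi>) + (of_real (\<theta> $ j))\<^sup>2 * dist_of u \<phi>)) UNIV" for j
    by (intro has_sum_add has_sum_diff has_sum_uminusI has_sum_cmult_right dist_of_has_sum test_partial_deriv \<phi>)
  have 2: "- dist_of u (partial_deriv j (partial_deriv j \<phi>))
       - 2 * \<i> * of_real (\<theta> $ j) * dist_of u (partial_deriv j \<phi>) + (of_real (\<theta> $ j))\<^sup>2 * dist_of u \<phi>
     = bloch_deriv \<theta> j (bloch_deriv \<theta> j (dist_of u)) \<phi>" for j
    by (simp add: bloch_deriv_def dist_deriv_def algebra_simps power2_eq_square)
  have 3: "- (fcoef u m * fc (partial_deriv j (partial_deriv j \<phi>)) (- m))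
      - 2 * \<i> * of_real (\<theta> $ j) * (fcoef u m * fc (partial_deriv j \<phi>) (- m))
      + (of_real (\<theta> $ j))\<^sup>2 * (fcoef u m * fc \<phi> (- m)) = of_real ((freq \<theta> m $ j)\<^sup>2) * fcoef u m * fc \<phi> (- m)" for j m
    using \<phi> by (simp add: fc_partial_deriv test_partial_deriv freq_nth power2_eq_square algebra_simps)
  have "((\<lambda>m. \<Sum>j\<in>UNIV. of_real ((freq \<theta> m $ j)\<^sup>2) * fcoef u m * fc \<phi> (- m)) has_sum bloch_laplacian \<theta> (dist_of u) \<phi>) UNIV"
    unfolding bloch_laplacian_def using 1 unfolding 2 3 by (intro has_sum_finite_sum) auto
  moreover have "(norm (freq \<theta> m))\<^sup>2 = (\<Sum>j\<in>UNIV. (freq \<theta> m $ j)\<^sup>2)" for m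
    unfolding power2_norm_eq_inner inner_vec_def by (simp add: power2_eq_square)
  ultimately show ?thesis
    by (simp only: of_real_sum sum_distrib_right)
qed

lemma bloch_laplacian_charf: "bloch_laplacian \<theta> (dist_of u) (charf k) = of_real ((norm (freq \<theta> k))\<^sup>2) * fcoef u k"
proof -
  have "((\<lambda>m. of_real ((norm (freq \<theta> m))\<^sup>2) * fcoef u m * fc (charf k) (- m)) has_sum
    (\<Sum>m\<in>{k}. of_real ((norm (freq \<theta> m))\<^sup>2) * fcoef u m * fc (charf k) (- m))) UNIV"
    by (rule has_sum_finite_neutralI[where B = "{k}"]) (auto simp: fc_charf)
  from has_sum_unique[OF bloch_laplacian_has_sum[OF charf_test] this] show ?thesis
    by (simp add: fc_charf)
qed

text \<open>The definite description needs a unique solution. Riesz-Fischer supplies one with the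
  coefficients a(m)/|xi|^2; testing against characters shows that any solution has these
  coefficients, as xi is never 0.\<close>

lemma fcoef_G_op:
  assumes \<theta>: "\<And>m. freq \<theta> m \<noteq> 0"
    and F: "\<And>\<phi>. \<phi> \<in> torus_test_functions \<Longrightarrow> ((\<lambda>m. a m * fc \<phi> (- m)) has_sum F \<phi>) UNIV"
    and sm: "(\<lambda>m. (cmod (a m / of_real ((norm (freq \<theta> m))\<^sup>2)))\<^sup>2) summable_on UNIV"
  shows "fcoef (G_op \<theta> F) m = a m / of_real ((norm (freq \<theta> m))\<^sup>2)"
proof -
  have F_charf: "F (charf k) = a k" for k
  proof -
    have "((\<lambda>m. a m * fc (charf k) (- m)) has_sum (\<Sum>m\<in>{k}. a m * fc (charf k) (- m))) UNIV"
      by (rule has_sum_finite_neutralI[where B = "{k}"]) (auto simp: fc_charf)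
    from has_sum_unique[OF F[OF charf_test] this] show ?thesis by (simp add: fc_charf)
  qed
  obtain u where u: "\<And>m. fcoef u m = a m / of_real ((norm (freq \<theta> m))\<^sup>2)"
    using fcoef_surj[OF sm] by blast
  have "G_op \<theta> F = u"
    unfolding G_op_def
  proof (rule the_equality)
    show "dist_eq (bloch_laplacian \<theta> (dist_of u)) F"
      unfolding dist_eq_def
    proof
      fix \<phi> :: "real^3 \<Rightarrow> complex" assume \<phi>: "\<phi> \<in> torus_test_functions"
      have eq: "of_real ((norm (freq \<theta> m))\<^sup>2) * fcoef u m * fc \<phi> (- m) = a m * fc \<phi> (- m)" for m
        using \<theta>[of m] by (simp add: u)
      have "((\<lambda>m. a m * fc \<phi> (- m)) has_sum bloch_laplacian \<theta> (dist_of u) \<phi>) UNIV"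
        using bloch_laplacian_has_sum[OF \<phi>, of \<theta> u] unfolding eq .
      then show "bloch_laplacian \<theta> (dist_of u) \<phi> = F \<phi>"
        using F[OF \<phi>] by (rule has_sum_unique)
    qed
  next
    fix v assume v: "dist_eq (bloch_laplacian \<theta> (dist_of v)) F"
    show "v = u"
    proof (rule fcoef_inject)
      fix m
      have "of_real ((norm (freq \<theta> m))\<^sup>2) * fcoef v m = a m"
        using v charf_test[of m] F_charf[of m] bloch_laplacian_charf[of \<theta> v m] by (simp add: dist_eq_def)
      then show "fcoef v m = fcoef u m"
        unfolding u using \<theta>[of m] by (auto simp: field_simps)
    qed
  qed
  then show ?thesis by (simp add: u)
qed

lemma fcoef_H0_op:
  assumes "(u, f) \<in> H0_op \<theta>"
  shows "fcoef f m = 1/2 * of_real ((norm (freq \<theta> m))\<^sup>2) * fcoef u m"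
proof -
  have "1/2 * bloch_laplacian \<theta> (dist_of u) (charf m) = dist_of f (charf m)"
    using assms charf_test[of m] by (simp add: H0_op_def dist_eq_def)
  moreover have "dist_of f (charf m) = fcoef f m"
    by (simp add: dist_of_def dist_of_fun_def fcoef_eq_fc fc_def mult.commute)
  ultimately show ?thesis by (simp add: bloch_laplacian_charf)
qed

section \<open>Periodization over the lattice and the Fourier transform of \<sigma>\<close>

lemma AE_lborel_box: "AE x in lborel. x \<notin> cbox (0::real^3) 1 - box 0 1"
  using AE_cell_box unfolding cell_def
  by (subst (asm) AE_restrict_space_iff) (auto elim: eventually_mono)

text \<open>Labels the half-open unit cell containing a point. These cells partition space, while
  the closed ones overlap on faces; the difference is a null set.\<close>

definition floor_vec :: "real^3 \<Rightarrow> int^3" where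
  "floor_vec x = (\<chi> j. \<lfloor>x $ j\<rfloor>)"

lemma floor_vec_add: "floor_vec (ivec n + x) = n + floor_vec x"
  by (simp add: floor_vec_def vec_eq_iff)

lemma floor_vec_eq_iff: "floor_vec x = n \<longleftrightarrow> (\<forall>j. \<lfloor>x $ j\<rfloor> = n $ j)"
  by (auto simp: floor_vec_def vec_eq_iff)

lemma floor_vec_eq_0: "x \<in> box 0 1 \<Longrightarrow> floor_vec x = 0" "floor_vec x = 0 \<Longrightarrow> x \<in> cbox 0 1"
proof -
  show "floor_vec x = 0" if "x \<in> box 0 1"
    using that unfolding floor_vec_eq_iff mem_box_cart by (auto simp: floor_eq_iff less_imp_le)
  show "x \<in> cbox 0 1" if "floor_vec x = 0"
    using that unfolding floor_vec_eq_iff mem_box_cart by (auto simp: floor_eq_iff less_imp_le)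
qed

lemma floor_vec_sets: "{x. floor_vec x = n} \<in> sets borel"
proof -
  have "{x. floor_vec x = n} = (\<Inter>j. {x. \<lfloor>x $ j\<rfloor> = n $ j})"
    by (auto simp: floor_vec_eq_iff)
  moreover have "{x::real^3. \<lfloor>x $ j\<rfloor> = n $ j} \<in> sets borel" for j
    by measurable
  ultimately show ?thesis by auto
qed

lemma indicator_floor_vec_shift:
  "indicator {x. floor_vec x = n} (ivec n + y) = indicator {x. floor_vec x = 0} y"
  by (simp add: floor_vec_add indicator_def)

lemma AE_indicator_floor_vec:
  "AE y in lborel. indicator {x. floor_vec x = 0} y = indicator (cbox 0 1) y"
  using AE_lborel_box by eventually_elim (auto simp: indicator_def dest: floor_vec_eq_0)

text \<open>\<open>H\<close> is split along the half-open cells and each piece is translated to the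
  base cell. The pieces have disjoint supports, so their L^1 norms sum to at most that of
  \<open>H\<close>.\<close>

lemma lattice_tiling:
  fixes H :: "real^3 \<Rightarrow> complex"
  assumes H: "integrable lborel H"
  shows "integrable cell (\<lambda>y. H (ivec n + y))"
    and "(\<lambda>n. LINT y|cell. cmod (H (ivec n + y))) summable_on UNIV"
    and "((\<lambda>n. LINT y|cell. H (ivec n + y)) has_sum (LINT x|lborel. H x)) UNIV"
proof -
  have [measurable]: "{x. floor_vec x = n} \<in> sets borel" for n by (rule floor_vec_sets)
  have [measurable]: "H \<in> borel_measurable borel" using H by auto
  define f where "f n x = indicator {x. floor_vec x = n} x * H x" for n x
  have int_f: "integrable lborel (f n)" for n
    unfolding f_def[abs_def] mult.commute[of "indicator _ _"]
  proof (rule integrable_mult_bounded[OF H, of _ 1])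
    show "(\<lambda>x. indicator {x. floor_vec x = n} x) \<in> borel_measurable lborel" by measurable
  qed (auto simp: indicator_def)
  have shift: "(LINT x|lborel. h x) = (LINT y|lborel. h (ivec n + y))"
    if "h \<in> borel_measurable borel" for n and h :: "real^3 \<Rightarrow> 'b::{banach, second_countable_topology}"
    using integral_distr[of "(+) (ivec n)" lborel borel h] that by (simp add: lborel_distr_plus)
  have cell_eq: "(LINT x|lborel. f n x) = (LINT y|cell. H (ivec n + y))" for n
  proof -
    have "(LINT x|lborel. f n x) = (LINT y|lborel. indicator {x. floor_vec x = 0} y * H (ivec n + y))"
      unfolding indicator_floor_vec_shift[symmetric, of _ n] f_def by (rule shift) measurable
    also have "\<dots> = (LINT y|lborel. indicator (cbox 0 1) y *\<^sub>R H (ivec n + y))"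
    proof (rule integral_cong_AE)
      show "AE y in lborel. indicator {x. floor_vec x = 0} y * H (ivec n + y) = indicator (cbox 0 1) y *\<^sub>R H (ivec n + y)"
        using AE_indicator_floor_vec[where 'a = real] by eventually_elim (auto simp: indicator_def split: if_splits)
    qed measurable
    finally show ?thesis by (simp add: cell_def integral_restrict_space)
  qed
  have cell_norm: "(LINT x|lborel. cmod (f n x)) = (LINT y|cell. cmod (H (ivec n + y)))" for n
  proof -
    have "(LINT x|lborel. cmod (f n x)) = (LINT y|lborel. indicator {x. floor_vec x = 0} y * cmod (H (ivec n + y)))"
    proof -
      have "cmod (f n x) = indicator {x. floor_vec x = n} x * cmod (H x)" for x
        by (simp add: f_def indicator_def)
      then show ?thesis
        unfolding indicator_floor_vec_shift[symmetric, of _ n] by (simp only:) (rule shift, measurable)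
    qed
    also have "\<dots> = (LINT y|lborel. indicator (cbox 0 1) y *\<^sub>R cmod (H (ivec n + y)))"
    proof (rule integral_cong_AE)
      show "AE y in lborel. indicator {x. floor_vec x = 0} y * cmod (H (ivec n + y)) = indicator (cbox 0 1) y *\<^sub>R cmod (H (ivec n + y))"
        using AE_indicator_floor_vec[where 'a = real] by eventually_elim simp
    qed measurable
    finally show ?thesis by (simp add: cell_def integral_restrict_space)
  qed
  have sm: "(\<lambda>n. LINT x|lborel. cmod (f n x)) summable_on UNIV"
  proof (rule nonneg_bdd_above_summable_on)
    show "bdd_above (sum (\<lambda>n. LINT x|lborel. cmod (f n x)) ` {F. F \<subseteq> UNIV \<and> finite F})"
    proof (rule bdd_aboveI2)
      fix F :: "(int^3) set" assume "F \<in> {F. F \<subseteq> UNIV \<and> finite F}"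
      then have F: "finite F" by simp
      have "(\<Sum>n\<in>F. LINT x|lborel. cmod (f n x)) = (LINT x|lborel. (\<Sum>n\<in>F. cmod (f n x)))"
        by (intro Bochner_Integration.integral_sum[symmetric] integrable_norm int_f)
      also have "\<dots> \<le> (LINT x|lborel. cmod (H x))"
      proof (intro integral_mono integrable_norm H Bochner_Integration.integrable_sum int_f)
        fix x
        \<comment> \<open>Adjoining the label of \<open>x\<close> makes the sum collapse to the
          single piece that is nonzero at \<open>x\<close>.\<close>
        have "(\<Sum>n\<in>F. cmod (f n x)) \<le> (\<Sum>n\<in>insert (floor_vec x) F. cmod (f n x))"
          using F by (intro sum_mono2) auto
        also have "\<dots> = (\<Sum>n\<in>{floor_vec x}. cmod (f n x))"
          using F by (intro sum.mono_neutral_right) (auto simp: f_def indicator_def split: if_splits)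
        also have "\<dots> = cmod (H x)" by (simp add: f_def)
        finally show "(\<Sum>n\<in>F. cmod (f n x)) \<le> cmod (H x)" .
      qed
      finally show "(\<Sum>n\<in>F. LINT x|lborel. cmod (f n x)) \<le> (LINT x|lborel. cmod (H x))" .
    qed
  qed simp
  show "(\<lambda>n. LINT y|cell. cmod (H (ivec n + y))) summable_on UNIV"
    using sm unfolding cell_norm .
  have "(\<Sum>\<^sub>\<infinity>n. f n x) = H x" for x
  proof -
    have "((\<lambda>n. f n x) has_sum H x) UNIV"
      by (rule has_sum_finite_neutralI[where B = "{floor_vec x}"]) (auto simp: f_def indicator_def)
    then show ?thesis by (rule infsumI)
  qed
  then show "((\<lambda>n. LINT y|cell. H (ivec n + y)) has_sum (LINT x|lborel. H x)) UNIV"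
    using integral_infsum_countable(3)[OF int_f sm] by (simp add: cell_eq)
  have "integrable lborel (\<lambda>y. H (ivec n + y))"
  proof -
    have "integrable (distr lborel borel ((+) (ivec n))) H" using H by (simp add: lborel_distr_plus)
    then show ?thesis by (subst (asm) integrable_distr_eq) auto
  qed
  then have "integrable lborel (\<lambda>y. indicator (cbox 0 1) y *\<^sub>R H (ivec n + y))"
    by (intro integrable_mult_indicator) auto
  then show "integrable cell (\<lambda>y. H (ivec n + y))"
    by (simp add: cell_def integrable_restrict_space)
qed

lemma charf_ivec: "charf m (ivec n + y) = charf m y"
proof -
  have "ivec m \<bullet> (ivec n + y) = of_int (\<Sum>j\<in>UNIV. m $ j * n $ j) + ivec m \<bullet> y"
    unfolding inner_add_right by (simp add: inner_vec_def)
  then have "charf m (ivec n + y) = charf m y * exp (of_real (2 * of_int (\<Sum>j\<in>UNIV. m $ j * n $ j) * pi) * \<i>)"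
    by (simp add: charf_def algebra_simps del: of_int_sum flip: exp_add)
  also have "exp (of_real (2 * of_int (\<Sum>j\<in>UNIV. m $ j * n $ j) * pi) * \<i>) = 1"
    by (rule exp_integer_2pi[OF Ints_of_int])
  finally show ?thesis by simp
qed

text \<open>\<open>charf m\<close> is lattice periodic, so it can be evaluated at n + y and merges
  with the Bloch phase into exp(i xi (n + y)), xi = \<open>freq \<theta> m\<close>. The sum over
  cells then reassembles the integral over the whole space.\<close>

lemma sigma_tilde_fc:
  assumes \<sigma>: "integrable lborel \<sigma>"
  shows "integrable cell (sigma_tilde \<sigma> \<theta>)"
    and "fc (sigma_tilde \<sigma> \<theta>) m = fourier \<sigma> (freq \<theta> m)"
proof -
  define H where "H \<xi> x = exp (\<i> * of_real (\<xi> \<bullet> x)) * of_real (\<sigma> x)" for \<xi> x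
  have H: "integrable lborel (H \<xi>)" for \<xi>
    unfolding H_def[abs_def] mult.commute[of "exp _"]
    by (rule integrable_mult_bounded[OF integrable_of_real[OF \<sigma>], of _ 1])
       (auto intro!: borel_measurable_continuous_onI continuous_intros)
  have st: "sigma_tilde \<sigma> \<theta> = (\<lambda>y. \<Sum>\<^sub>\<infinity>n. H \<theta> (ivec n + y))"
    by (simp add: sigma_tilde_def H_def fun_eq_iff)
  note t = lattice_tiling[OF H]
  show int: "integrable cell (sigma_tilde \<sigma> \<theta>)"
    unfolding st by (rule integral_infsum_countable(2)[OF t(1,2)])
  have eq: "charf m y * H \<theta> (ivec n + y) = H (freq \<theta> m) (ivec n + y)" for n y
  proof -
    have "charf m (ivec n + y) * H \<theta> (ivec n + y) = H (freq \<theta> m) (ivec n + y)"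
      by (simp add: charf_def H_def freq_def inner_add_left distrib_left flip: exp_add)
    then show ?thesis by (simp add: charf_ivec)
  qed
  have "fc (sigma_tilde \<sigma> \<theta>) m = (LINT y|cell. (\<Sum>\<^sub>\<infinity>n. H (freq \<theta> m) (ivec n + y)))"
    unfolding fc_def st infsum_cmult_right'[symmetric] eq ..
  moreover have "((\<lambda>n. LINT y|cell. H (freq \<theta> m) (ivec n + y)) has_sum
      (LINT y|cell. (\<Sum>\<^sub>\<infinity>n. H (freq \<theta> m) (ivec n + y)))) UNIV"
    by (rule integral_infsum_countable(3)[OF t(1,2)])
  ultimately have "fc (sigma_tilde \<sigma> \<theta>) m = (LINT x|lborel. H (freq \<theta> m) x)"
    using t(3)[of "freq \<theta> m"] has_sum_unique by metis
  then show "fc (sigma_tilde \<sigma> \<theta>) m = fourier \<sigma> (freq \<theta> m)"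
    by (simp add: fourier_def H_def)
qed

text \<open>Dominated convergence with dominating function |\<sigma>|. Continuity feeds the
  compactness argument of \<open>uniform_T_op\<close>.\<close>

lemma continuous_fourier:
  assumes \<sigma>: "integrable lborel \<sigma>"
  shows "continuous_on UNIV (fourier \<sigma>)"
proof (rule continuous_at_imp_continuous_on, rule ballI)
  fix \<xi> :: "real^3"
  have [measurable]: "\<sigma> \<in> borel_measurable borel" using \<sigma> by auto
  have [measurable]: "(\<lambda>x. exp (\<i> * complex_of_real (\<xi> \<bullet> x))) \<in> borel_measurable borel" for \<xi> :: "real^3"
    by (auto intro!: borel_measurable_continuous_onI continuous_intros)
  show "isCont (fourier \<sigma>) \<xi>"
    unfolding continuous_at_sequentially o_def
  proof (intro allI impI)
    fix X assume X: "X \<longlonglongrightarrow> \<xi>"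
    show "(\<lambda>n. fourier \<sigma> (X n)) \<longlonglongrightarrow> fourier \<sigma> \<xi>"
      unfolding fourier_def
    proof (rule integral_dominated_convergence)
      show "integrable lborel (\<lambda>x. \<bar>\<sigma> x\<bar>)" using \<sigma> by auto
      show "AE x in lborel. (\<lambda>n. exp (\<i> * of_real (X n \<bullet> x)) * of_real (\<sigma> x)) \<longlonglongrightarrow> exp (\<i> * of_real (\<xi> \<bullet> x)) * of_real (\<sigma> x)"
        by (intro AE_I2 tendsto_intros X)
      show "AE x in lborel. norm (exp (\<i> * of_real (X n \<bullet> x)) * of_real (\<sigma> x)) \<le> \<bar>\<sigma> x\<bar>" for n
        by (auto simp: norm_mult)
    qed measurable
  qed
qed

section \<open>The operators S and T in Fourier variables\<close>

definition freq_dot :: "real^3 \<Rightarrow> int^3 \<Rightarrow> complex^3 \<Rightarrow> complex" where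
  "freq_dot \<theta> m q = (\<Sum>j\<in>UNIV. of_real (freq \<theta> m $ j) * q $ j)"

text \<open>On the mode \<open>charf (- m)\<close> the operator grad - i \<theta> acts as -i xi with
  xi = \<open>freq \<theta> m\<close>.\<close>

lemma S_source_has_sum:
  assumes \<sigma>: "integrable lborel \<sigma>" and \<phi>: "\<phi> \<in> torus_test_functions"
  shows "((\<lambda>m. - \<i> * freq_dot \<theta> m q * fourier \<sigma> (freq \<theta> m) * fc \<phi> (- m)) has_sum S_source \<sigma> \<theta> q \<phi>) UNIV"
proof -
  let ?s = "sigma_tilde \<sigma> \<theta>"
  note st = sigma_tilde_fc[OF \<sigma>, of \<theta>]
  have "((\<lambda>m. \<Sum>j\<in>UNIV. q $ j * (- (fc ?s m * fc (partial_deriv j \<phi>) (- m)) - \<i> * of_real (\<theta> $ j) * (fc ?s m * fc \<phi> (- m))))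
      has_sum S_source \<sigma> \<theta> q \<phi>) UNIV"
    unfolding S_source_def dist_deriv_def
    by (intro has_sum_finite_sum has_sum_cmult_right has_sum_diff has_sum_uminusI integral_mult_test st
        test_partial_deriv \<phi> finite)
  moreover have "(\<Sum>j\<in>UNIV. q $ j * (- (fc ?s m * fc (partial_deriv j \<phi>) (- m)) - \<i> * of_real (\<theta> $ j) * (fc ?s m * fc \<phi> (- m))))
      = - \<i> * freq_dot \<theta> m q * fourier \<sigma> (freq \<theta> m) * fc \<phi> (- m)" for m
  proof -
    have "q $ j * (- (fc ?s m * fc (partial_deriv j \<phi>) (- m)) - \<i> * of_real (\<theta> $ j) * (fc ?s m * fc \<phi> (- m)))
      = - \<i> * (of_real (freq \<theta> m $ j) * q $ j) * fourier \<sigma> (freq \<theta> m) * fc \<phi> (- m)" for j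
      by (simp add: fc_partial_deriv[OF \<phi>] st freq_nth algebra_simps)
    then show ?thesis
      by (simp add: freq_dot_def sum_distrib_left sum_distrib_right mult.assoc)
  qed
  ultimately show ?thesis by simp
qed

text \<open>A divergent \<open>infsum\<close> has the default value 0, and the zero matrix is not
  positive definite. So positive definiteness already entails convergence of the series.\<close>

lemma Sigma_mat_summable:
  assumes "positive_definite (Sigma_mat \<sigma> \<theta>)"
  shows "((\<lambda>m. Sigma_summand \<sigma> (freq \<theta> m)) has_sum Sigma_mat \<sigma> \<theta>) UNIV"
proof (cases "(\<lambda>m. Sigma_summand \<sigma> (freq \<theta> m)) summable_on UNIV")
  case True
  then show ?thesis
    unfolding Sigma_mat_def freq_def by (rule has_sum_infsum)
next
  case False
  then have "Sigma_mat \<sigma> \<theta> = 0"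
    unfolding Sigma_mat_def freq_def by (rule infsum_not_exists)
  moreover have "axis 1 1 \<noteq> (0 :: real^3)" by (simp add: axis_eq_0_iff)
  ultimately show ?thesis
    using assms unfolding positive_definite_def by force
qed

lemma has_sum_bounded_linear_image:
  assumes "bounded_linear h" "(f has_sum s) A" shows "((\<lambda>x. h (f x)) has_sum h s) A"
proof -
  interpret bounded_linear h by fact
  have "((\<lambda>F. h (sum f F)) \<longlongrightarrow> h s) (finite_subsets_at_top A)"
    using assms(2) unfolding has_sum_def by (rule tendsto)
  then show ?thesis by (simp add: has_sum_def sum)
qed

lemma Sigma_entry_has_sum:
  assumes "positive_definite (Sigma_mat \<sigma> \<theta>)"
  shows "((\<lambda>m. freq \<theta> m $ i * freq \<theta> m $ j / (norm (freq \<theta> m))\<^sup>2 * (cmod (fourier \<sigma> (freq \<theta> m)))\<^sup>2)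
     has_sum Sigma_mat \<sigma> \<theta> $ i $ j) UNIV"
proof -
  have bl: "bounded_linear (\<lambda>A :: real^3^3. A $ i $ j)"
    by (intro bounded_linear_compose[OF bounded_linear_vec_nth] bounded_linear_vec_nth)
  show ?thesis
    using has_sum_bounded_linear_image[OF bl Sigma_mat_summable[OF assms]]
    by (simp add: Sigma_summand_def)
qed

text \<open>The contribution of mode \<open>m\<close> to the quadratic form of T at
  \<open>q\<close>.\<close>

definition sigma_weight :: "(real^3 \<Rightarrow> real) \<Rightarrow> real^3 \<Rightarrow> complex^3 \<Rightarrow> int^3 \<Rightarrow> real" where
  "sigma_weight \<sigma> \<theta> q m = (cmod (freq_dot \<theta> m q * fourier \<sigma> (freq \<theta> m)))\<^sup>2 / (norm (freq \<theta> m))\<^sup>2"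

lemma sigma_weight_nonneg: "0 \<le> sigma_weight \<sigma> \<theta> q m"
  by (simp add: sigma_weight_def)

text \<open>Each summand of \<Sigma> is a nonnegative multiple of the rank one matrix of xi, whose
  form at a complex \<open>q\<close> is the squared modulus of xi.q because xi is real.\<close>

lemma T_op_has_sum:
  assumes "positive_definite (Sigma_mat \<sigma> \<theta>)"
  shows "(sigma_weight \<sigma> \<theta> q has_sum Re (inner_C3 (T_op \<sigma> \<theta> q) q)) UNIV"
proof -
  have "((\<lambda>m. \<Sum>i\<in>UNIV. \<Sum>j\<in>UNIV. of_real (freq \<theta> m $ i * freq \<theta> m $ j / (norm (freq \<theta> m))\<^sup>2 * (cmod (fourier \<sigma> (freq \<theta> m)))\<^sup>2) * (q $ j * cnj (q $ i)))
     has_sum (\<Sum>i\<in>UNIV. \<Sum>j\<in>UNIV. of_real (Sigma_mat \<sigma> \<theta> $ i $ j) * (q $ j * cnj (q $ i)))) UNIV"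
    by (intro has_sum_finite_sum has_sum_cmult_left has_sum_of_real Sigma_entry_has_sum assms finite)
  moreover have "(\<Sum>i\<in>UNIV. \<Sum>j\<in>UNIV. of_real (Sigma_mat \<sigma> \<theta> $ i $ j) * (q $ j * cnj (q $ i))) = inner_C3 (T_op \<sigma> \<theta> q) q"
    by (simp add: inner_C3_def T_op_def matrix_vector_mult_def sum_distrib_right mult.assoc)
  moreover have "(\<Sum>i\<in>UNIV. \<Sum>j\<in>UNIV. of_real (freq \<theta> m $ i * freq \<theta> m $ j / (norm (freq \<theta> m))\<^sup>2 * (cmod (fourier \<sigma> (freq \<theta> m)))\<^sup>2) * (q $ j * cnj (q $ i)))
     = of_real (sigma_weight \<sigma> \<theta> q m)" for m
  proof -
    let ?c = "complex_of_real ((cmod (fourier \<sigma> (freq \<theta> m)))\<^sup>2 / (norm (freq \<theta> m))\<^sup>2)"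
    have "(\<Sum>i\<in>UNIV. \<Sum>j\<in>UNIV. of_real (freq \<theta> m $ i * freq \<theta> m $ j / (norm (freq \<theta> m))\<^sup>2 * (cmod (fourier \<sigma> (freq \<theta> m)))\<^sup>2) * (q $ j * cnj (q $ i)))
      = (\<Sum>i\<in>UNIV. \<Sum>j\<in>UNIV. ?c * ((of_real (freq \<theta> m $ j) * q $ j) * cnj (of_real (freq \<theta> m $ i) * q $ i)))"
      by (intro sum.cong refl) simp
    also have "\<dots> = ?c * (freq_dot \<theta> m q * cnj (freq_dot \<theta> m q))"
      unfolding freq_dot_def cnj_sum sum_product
      by (subst sum.swap) (simp only: sum_distrib_left)
    also have "\<dots> = of_real (sigma_weight \<sigma> \<theta> q m)"
      unfolding sigma_weight_def norm_mult
      by (simp add: power_mult_distrib mult.commute flip: complex_norm_square)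
    finally show ?thesis .
  qed
  ultimately have "((\<lambda>m. complex_of_real (sigma_weight \<sigma> \<theta> q m)) has_sum inner_C3 (T_op \<sigma> \<theta> q) q) UNIV"
    by simp
  from has_sum_Re[OF this] show ?thesis by simp
qed

lemma inner_C3_axis: "inner_C3 p (axis j 1) = p $ j"
  by (simp add: inner_C3_def axis_def if_distrib[where f = cnj] if_distrib[where f = "\<lambda>u. _ * u"] cong: if_cong)

lemma inner_C3_self: "inner_C3 q q = of_real (\<Sum>j\<in>UNIV. (cmod (q $ j))\<^sup>2)"
  by (simp add: inner_C3_def flip: complex_norm_square)

lemma inner_C3_cnj: "cnj (inner_C3 p q) = inner_C3 q p"
  by (simp add: inner_C3_def mult.commute)

lemma inner_C3_add_left: "inner_C3 (p + q) r = inner_C3 p r + inner_C3 q r"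
  by (simp add: inner_C3_def distrib_right sum.distrib)

lemma inner_C3_scale_left: "inner_C3 (c *s p) r = c * inner_C3 p r"
  by (simp add: inner_C3_def sum_distrib_left mult.assoc)

context
  fixes \<sigma> :: "real^3 \<Rightarrow> real" and \<theta> :: "real^3" and c :: real
  assumes \<sigma>: "integrable lborel \<sigma>" and pd: "positive_definite (Sigma_mat \<sigma> \<theta>)" and c: "c > 0"
    and gap: "\<And>m. c * (1 + (norm (ivec m))\<^sup>2) \<le> (norm (freq \<theta> m))\<^sup>2"
begin

lemma gap_c: "c \<le> (norm (freq \<theta> m))\<^sup>2"
proof -
  have "c * 1 \<le> c * (1 + (norm (ivec m))\<^sup>2)" using c by (intro mult_left_mono) auto
  then show ?thesis using gap[of m] by simp
qed

lemma freq_nz: "freq \<theta> m \<noteq> 0"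
  using gap_c[of m] c by auto

lemma fcoef_G_L2: "fcoef (G_op \<theta> (dist_of u)) m = fcoef u m / of_real ((norm (freq \<theta> m))\<^sup>2)"
proof (rule fcoef_G_op[OF freq_nz])
  have "cmod (1 / of_real ((norm (freq \<theta> m))\<^sup>2)) \<le> 1 / c" for m
  proof -
    have "1 / (norm (freq \<theta> m))\<^sup>2 \<le> 1 / c"
      using gap_c[of m] c freq_nz[of m] by (intro divide_left_mono) auto
    then show ?thesis by (simp add: norm_divide norm_power)
  qed
  from summable_fcoef_mult_bounded[OF this, where u = u]
  show "(\<lambda>m. (cmod (fcoef u m / of_real ((norm (freq \<theta> m))\<^sup>2)))\<^sup>2) summable_on UNIV"
    by simp
qed (rule dist_of_has_sum)

text \<open>The source of S need not be square integrable, but after division by |xi|^2 its squared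
  coefficients are \<open>sigma_weight\<close> over |xi|^2, hence summable by convergence of the
  form of T and the lower bound \<open>c\<close> on |xi|^2.\<close>

lemma fcoef_S_op:
  "fcoef (S_op e Z \<sigma> \<theta> q) m =
    of_real (e * sqrt Z) * (- \<i> * freq_dot \<theta> m q * fourier \<sigma> (freq \<theta> m) / of_real ((norm (freq \<theta> m))\<^sup>2))"
proof -
  have "fcoef (G_op \<theta> (S_source \<sigma> \<theta> q)) m = - \<i> * freq_dot \<theta> m q * fourier \<sigma> (freq \<theta> m) / of_real ((norm (freq \<theta> m))\<^sup>2)" for m
  proof (rule fcoef_G_op[OF freq_nz S_source_has_sum[OF \<sigma>]])
    show "(\<lambda>m. (cmod (- \<i> * freq_dot \<theta> m q * fourier \<sigma> (freq \<theta> m) / of_real ((norm (freq \<theta> m))\<^sup>2)))\<^sup>2) summable_on UNIV"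
    proof (rule summable_on_comparison_test)
      show "(\<lambda>m. 1 / c * sigma_weight \<sigma> \<theta> q m) summable_on UNIV"
        using T_op_has_sum[OF pd, of q] by (intro summable_on_cmult_right) (auto simp: summable_on_def)
      show "(cmod (- \<i> * freq_dot \<theta> m q * fourier \<sigma> (freq \<theta> m) / of_real ((norm (freq \<theta> m))\<^sup>2)))\<^sup>2 \<le> 1 / c * sigma_weight \<sigma> \<theta> q m" for m
      proof -
        let ?n = "(norm (freq \<theta> m))\<^sup>2"
        have n: "?n > 0" using freq_nz by simp
        have "(cmod (- \<i> * freq_dot \<theta> m q * fourier \<sigma> (freq \<theta> m) / of_real ?n))\<^sup>2 = sigma_weight \<sigma> \<theta> q m / ?n"
          unfolding sigma_weight_def using n
          by (simp add: norm_mult norm_divide power_divide power_mult_distrib norm_power power2_eq_square)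
        also have "\<dots> \<le> sigma_weight \<sigma> \<theta> q m / c"
          using gap_c[of m] c n by (intro divide_left_mono sigma_weight_nonneg) auto
        finally show ?thesis by simp
      qed
    qed simp
  qed
  then show ?thesis by (simp add: S_op_def)
qed

text \<open>Linearity of S in \<open>q\<close>, in the form that exhibits the vector representing
  the adjoint.\<close>

lemma S_op_inner: "inner_L2 u (S_op e Z \<sigma> \<theta> q) = (\<Sum>j\<in>UNIV. inner_L2 u (S_op e Z \<sigma> \<theta> (axis j 1)) * cnj (q $ j))"
proof -
  have dot: "freq_dot \<theta> m q = (\<Sum>j\<in>UNIV. q $ j * freq_dot \<theta> m (axis j 1))" for m
  proof -
    have "freq_dot \<theta> m (axis j 1) = of_real (freq \<theta> m $ j)" for j
      by (simp add: freq_dot_def axis_def if_distrib[where f = "\<lambda>u. _ * u"] cong: if_cong)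
    then show ?thesis by (simp add: freq_dot_def mult.commute)
  qed
  have S: "fcoef (S_op e Z \<sigma> \<theta> q) m = (\<Sum>j\<in>UNIV. q $ j * fcoef (S_op e Z \<sigma> \<theta> (axis j 1)) m)" for m
    unfolding fcoef_S_op dot[of m]
    by (simp only: sum_distrib_left sum_distrib_right sum_divide_distrib)
       (simp add: mult_ac sum_distrib_left sum_negf sum_divide_distrib)
  have "((\<lambda>m. \<Sum>j\<in>UNIV. fcoef u m * cnj (fcoef (S_op e Z \<sigma> \<theta> (axis j 1)) m) * cnj (q $ j)) has_sum
    (\<Sum>j\<in>UNIV. inner_L2 u (S_op e Z \<sigma> \<theta> (axis j 1)) * cnj (q $ j))) UNIV"
    by (intro has_sum_finite_sum has_sum_cmult_left L2_parseval finite)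
  moreover have "(\<Sum>j\<in>UNIV. fcoef u m * cnj (fcoef (S_op e Z \<sigma> \<theta> (axis j 1)) m) * cnj (q $ j)) = fcoef u m * cnj (fcoef (S_op e Z \<sigma> \<theta> q) m)" for m
    unfolding S by (simp add: sum_distrib_left mult_ac)
  ultimately show ?thesis using L2_parseval[of u "S_op e Z \<sigma> \<theta> q"] has_sum_unique by fastforce
qed

text \<open>Unfolds the definite description: \<open>S_op_inner\<close> gives a representing vector,
  and the coordinate vectors determine it.\<close>

lemma S_adj_inner: "inner_C3 (S_adj e Z \<sigma> \<theta> u) q = inner_L2 u (S_op e Z \<sigma> \<theta> q)"
proof -
  let ?P = "\<lambda>p. \<forall>q. inner_C3 p q = inner_L2 u (S_op e Z \<sigma> \<theta> q)"
  let ?p = "\<chi> j. inner_L2 u (S_op e Z \<sigma> \<theta> (axis j 1))"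
  have "?P ?p" by (subst S_op_inner) (simp add: inner_C3_def)
  moreover have "p = ?p" if "?P p" for p
  proof -
    have "p $ j = ?p $ j" for j
      using spec[OF that, of "axis j 1"] by (simp add: inner_C3_axis)
    then show ?thesis by (simp add: vec_eq_iff)
  qed
  ultimately have "?P (THE p. ?P p)" by (rule theI)
  then show ?thesis by (simp add: S_adj_def)
qed

end

section \<open>The quadratic form of \<open>B(\<theta>)\<close>\<close>

definition form_density :: "real \<Rightarrow> (real^3 \<Rightarrow> real) \<Rightarrow> real^3 \<Rightarrow> L2T \<Rightarrow> L2T \<Rightarrow> complex^3 \<Rightarrow> int^3 \<Rightarrow> real" where
  "form_density k \<sigma> \<theta> u v q m =
     (norm (freq \<theta> m))\<^sup>2 * ((cmod (fcoef u m))\<^sup>2 + (cmod (fcoef v m))\<^sup>2)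
     + (cmod (of_real (2 * k) * fcoef u m - \<i> * freq_dot \<theta> m q * fourier \<sigma> (freq \<theta> m)))\<^sup>2 / (norm (freq \<theta> m))\<^sup>2"

text \<open>Here a is a coefficient of u, w = -i (xi.q) times the transform of \<sigma>, and n =
  |xi|^2. The left side collects the u-row of B (kinetic term, G and S), the adjoint of S from the
  q-row, and T; the two S contributions are equal and form the cross term of the square.\<close>

lemma complete_square:
  fixes a w :: complex and n k :: real
  assumes "n > 0"
  shows "Re ((of_real n * a + of_real (4 * k\<^sup>2 / n) * a + of_real (2 * k / n) * w) * cnj a)
      + 2 * Re (a * cnj (of_real (k / n) * w)) + (cmod w)\<^sup>2 / n
    = n * (cmod a)\<^sup>2 + (cmod (of_real (2 * k) * a + w))\<^sup>2 / n"
proof -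
  have 1: "Re ((of_real x * a + of_real y * a + of_real z * w) * cnj a) = (x + y) * (cmod a)\<^sup>2 + z * Re (w * cnj a)" for x y z
    unfolding cmod_power2 by (simp add: power2_eq_square algebra_simps)
  have 2: "Re (a * cnj (of_real x * w)) = x * Re (w * cnj a)" for x
    by (simp add: algebra_simps)
  have 3: "(cmod (of_real (2 * k) * a + w))\<^sup>2 = 4 * k\<^sup>2 * (cmod a)\<^sup>2 + 4 * k * Re (w * cnj a) + (cmod w)\<^sup>2"
    unfolding cmod_power2 by (simp add: power2_eq_square algebra_simps)
  show ?thesis
    unfolding 1 2 3 using assms by (simp add: field_simps)
qed

context
  fixes e M Z c :: real and \<sigma> :: "real^3 \<Rightarrow> real" and \<theta> :: "real^3"
  assumes pos: "e > 0" "M > 0" "Z > 0"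
    and \<sigma>: "integrable lborel \<sigma>" and pd: "positive_definite (Sigma_mat \<sigma> \<theta>)" and c: "c > 0"
    and gap: "\<And>m. c * (1 + (norm (ivec m))\<^sup>2) \<le> (norm (freq \<theta> m))\<^sup>2"
begin

text \<open>The variable \<open>p\<close> carries no Fourier index and decouples, so its share |p|^2
  / M is split off and only the rest is a sum over modes.\<close>

lemma B_op_form:
  assumes "((u, v, q, p), b) \<in> B_op e M Z \<sigma> \<theta>"
  shows "(form_density (e * sqrt Z) \<sigma> \<theta> u v q has_sum (Re (inner_X b (u, v, q, p)) - Re (inner_C3 p p) / M)) UNIV"
proof -
  note S = fcoef_S_op[OF \<sigma> pd c gap]
  note G = fcoef_G_L2[OF \<sigma> pd c gap]
  let ?S = "S_op e Z \<sigma> \<theta> q"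
  define k where "k = e * sqrt Z"
  obtain f g where f: "(u, f) \<in> H0_op \<theta>" and g: "(v, g) \<in> H0_op \<theta>"
    and b: "b = (scale_L2 2 f + scale_L2 (of_real (4 * e\<^sup>2 * sqrt Z)) (G_op \<theta> (dist_of (scale_L2 (of_real (sqrt Z)) u)))
          + scale_L2 2 ?S, scale_L2 2 g, 2 *s S_adj e Z \<sigma> \<theta> u + T_op \<sigma> \<theta> q, of_real (inverse M) *s p)"
    using assms unfolding B_op_def by blast
  define X where "X = scale_L2 2 f + scale_L2 (of_real (4 * e\<^sup>2 * sqrt Z)) (G_op \<theta> (dist_of (scale_L2 (of_real (sqrt Z)) u)))
          + scale_L2 2 ?S"
  define w where "w m = - \<i> * freq_dot \<theta> m q * fourier \<sigma> (freq \<theta> m)" for m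
  define n where "n m = (norm (freq \<theta> m))\<^sup>2" for m
  have n: "n m > 0" for m
    using freq_nz[OF \<sigma> pd c gap, of m] by (simp add: n_def)
  have fS: "fcoef ?S m = of_real (k / n m) * w m" for m
    unfolding S k_def w_def n_def by simp
  have k2: "k\<^sup>2 = e\<^sup>2 * Z" using pos by (simp add: k_def power_mult_distrib)
  have fX: "fcoef X m = of_real (n m) * fcoef u m + of_real (4 * k\<^sup>2 / n m) * fcoef u m + of_real (2 * k / n m) * w m" for m
  proof -
    have "of_real (4 * e\<^sup>2 * r) * (of_real r * a / of_real N) = of_real (4 * (e\<^sup>2 * (r * r)) / N) * a"
      for r N and a :: complex
      by simp
    from this[of "sqrt Z"] pos
    have ZZ: "of_real (4 * e\<^sup>2 * sqrt Z) * (of_real (sqrt Z) * a / of_real N) = of_real (4 * (e\<^sup>2 * Z) / N) * a"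
      for N and a :: complex
      by simp
    have half: "2 * (1 / 2 * of_real N * a) = of_real N * a" "2 * (of_real (k / N) * a) = of_real (2 * k / N) * a"
      for N and a :: complex
      by simp_all
    show ?thesis
      unfolding X_def fcoef_add fcoef_scale G fcoef_H0_op[OF f] fS k2 n_def half ZZ ..
  qed
  have "((\<lambda>m. Re (fcoef X m * cnj (fcoef u m)) + Re (fcoef (scale_L2 2 g) m * cnj (fcoef v m))
      + 2 * Re (fcoef u m * cnj (fcoef ?S m)) + sigma_weight \<sigma> \<theta> q m) has_sum
      (Re (inner_L2 X u) + Re (inner_L2 (scale_L2 2 g) v) + 2 * Re (inner_L2 u ?S) + Re (inner_C3 (T_op \<sigma> \<theta> q) q))) UNIV"
    by (intro has_sum_add has_sum_cmult_right has_sum_Re L2_parseval T_op_has_sum pd)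
  moreover have "Re (inner_L2 X u) + Re (inner_L2 (scale_L2 2 g) v) + 2 * Re (inner_L2 u ?S) + Re (inner_C3 (T_op \<sigma> \<theta> q) q)
      = Re (inner_X b (u, v, q, p)) - Re (inner_C3 p p) / M"
    unfolding b X_def[symmetric] inner_X_def
    by (simp add: inner_C3_add_left inner_C3_scale_left S_adj_inner[OF \<sigma> pd c gap] inverse_eq_divide
        flip: of_real_inverse)
  moreover have "Re (fcoef X m * cnj (fcoef u m)) + Re (fcoef (scale_L2 2 g) m * cnj (fcoef v m))
      + 2 * Re (fcoef u m * cnj (fcoef ?S m)) + sigma_weight \<sigma> \<theta> q m = form_density k \<sigma> \<theta> u v q m" for m
  proof -
    have "Re (fcoef (scale_L2 2 g) m * cnj (fcoef v m)) = n m * (cmod (fcoef v m))\<^sup>2"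
      unfolding fcoef_scale fcoef_H0_op[OF g] cmod_power2 n_def by (simp add: power2_eq_square algebra_simps)
    moreover have "sigma_weight \<sigma> \<theta> q m = (cmod (w m))\<^sup>2 / n m"
      by (simp add: sigma_weight_def w_def n_def norm_mult)
    moreover have "form_density k \<sigma> \<theta> u v q m = n m * (cmod (fcoef u m))\<^sup>2 + (cmod (of_real (2 * k) * fcoef u m + w m))\<^sup>2 / n m
        + n m * (cmod (fcoef v m))\<^sup>2"
      by (simp add: form_density_def w_def n_def algebra_simps)
    ultimately show ?thesis
      unfolding fX fS using complete_square[OF n[of m], of "fcoef u m" k "w m"] by linarith
  qed
  ultimately show ?thesis by (simp add: k_def)
qed

lemma norm_split: "Re (inner_X (u, v, q, p) (u, v, q, p)) =
    Re (inner_L2 u u) + Re (inner_L2 v v) + Re (inner_C3 q q) + Re (inner_C3 p p)"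
  by (simp add: inner_X_def)

lemma inner_C3_self_nonneg: "0 \<le> Re (inner_C3 q q)"
  unfolding inner_C3_self by (simp add: sum_nonneg)

text \<open>The kinetic terms control u and v directly. The charge oscillation can screen
  \<open>q\<close> inside the completed square, so \<open>q\<close> is recovered from that square
  together with the bound on u, and then from the lower bound \<open>s\<close> on T.\<close>

lemma B_op_coercive:
  assumes B: "(z, b) \<in> B_op e M Z \<sigma> \<theta>"
    and s: "s > 0" "\<And>q. s * Re (inner_C3 q q) \<le> Re (inner_C3 (T_op \<sigma> \<theta> q) q)"
  shows "Re (inner_X z z) \<le> (1 / c + (2 + 8 * (e * sqrt Z)\<^sup>2 / c\<^sup>2) / s + M) * Re (inner_X b z)"
proof -
  obtain u v q p where z: "z = (u, v, q, p)" by (cases z)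
  define k where "k = e * sqrt Z"
  define D where "D = form_density k \<sigma> \<theta> u v q"
  define A where "A = Re (inner_X b z) - Re (inner_C3 p p) / M"
  \<comment> \<open>The 2 and the 8 come from |w|^2 <= 2 |2 k a + w|^2 + 2 |2 k a|^2.\<close>
  define L where "L = 2 + 8 * k\<^sup>2 / c\<^sup>2"
  have L: "L > 0" unfolding L_def by (intro add_pos_nonneg divide_nonneg_nonneg) auto
  have D: "(D has_sum A) UNIV"
    using B_op_form B unfolding z D_def A_def k_def by blast
  have n: "c \<le> (norm (freq \<theta> m))\<^sup>2" for m by (rule gap_c[OF \<sigma> pd c gap])
  have D0: "c * ((cmod (fcoef u m))\<^sup>2 + (cmod (fcoef v m))\<^sup>2) \<le> D m" for m
  proof -
    have "c * ((cmod (fcoef u m))\<^sup>2 + (cmod (fcoef v m))\<^sup>2) \<le> (norm (freq \<theta> m))\<^sup>2 * ((cmod (fcoef u m))\<^sup>2 + (cmod (fcoef v m))\<^sup>2)"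
      by (intro mult_right_mono n) auto
    also have "\<dots> \<le> D m" by (simp add: D_def form_density_def)
    finally show ?thesis .
  qed
  have uv: "c * (Re (inner_L2 u u) + Re (inner_L2 v v)) \<le> A"
    by (rule has_sum_mono[OF has_sum_cmult_right[OF has_sum_add[OF L2_parseval_norm L2_parseval_norm]] D D0])
  have A0: "A \<ge> 0"
    using uv c inner_L2_ge0[of u] inner_L2_ge0[of v] by (meson add_nonneg_nonneg less_imp_le mult_nonneg_nonneg order_trans)
  have D1: "sigma_weight \<sigma> \<theta> q m \<le> L * D m" for m
  proof -
    define t where "t = (norm (freq \<theta> m))\<^sup>2"
    define a where "a = fcoef u m"
    define w where "w = - \<i> * freq_dot \<theta> m q * fourier \<sigma> (freq \<theta> m)"
    define y where "y = (cmod (of_real (2 * k) * a + w))\<^sup>2"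
    have t: "c \<le> t" "t > 0" using n[of m] c by (auto simp: t_def)
    have "(cmod w)\<^sup>2 \<le> 2 * y + 8 * k\<^sup>2 * (cmod a)\<^sup>2"
    proof -
      have "cmod w \<le> cmod (of_real (2 * k) * a + w) + cmod (of_real (2 * k) * a)"
        using norm_triangle_ineq4[of "of_real (2 * k) * a + w" "of_real (2 * k) * a"] by simp
      then have "(cmod w)\<^sup>2 \<le> (cmod (of_real (2 * k) * a + w) + cmod (of_real (2 * k) * a))\<^sup>2"
        by (intro power_mono) auto
      also have "\<dots> \<le> 2 * (cmod (of_real (2 * k) * a + w))\<^sup>2 + 2 * (cmod (of_real (2 * k) * a))\<^sup>2"
        by (smt (verit) sum_squares_bound power2_sum)
      also have "(cmod (of_real (2 * k) * a))\<^sup>2 = 4 * k\<^sup>2 * (cmod a)\<^sup>2"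
        by (simp add: norm_mult power_mult_distrib)
      finally show ?thesis by (simp add: y_def)
    qed
    then have "(cmod w)\<^sup>2 / t \<le> (2 * y + 8 * k\<^sup>2 * (cmod a)\<^sup>2) / t"
      using t by (intro divide_right_mono) auto
    also have "\<dots> = 2 * (y / t) + 8 * k\<^sup>2 * (cmod a)\<^sup>2 * (1 / t)"
      by (simp add: add_divide_distrib)
    \<comment> \<open>The term |a|^2 / t has to be traded for t |a|^2, the one present in the
      density; t >= c makes this cost 1 / c^2.\<close>
    also have "\<dots> \<le> 2 * (y / t) + 8 * k\<^sup>2 * (cmod a)\<^sup>2 * (t / c\<^sup>2)"
    proof -
      have "c\<^sup>2 \<le> t * t" using t c by (simp add: power2_eq_square mult_mono)
      then have "1 / t \<le> t / c\<^sup>2" using t c by (simp add: field_simps)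
      then show ?thesis by (intro add_left_mono mult_left_mono) auto
    qed
    also have "\<dots> \<le> L * (y / t + t * (cmod a)\<^sup>2)"
    proof -
      define P where "P = 8 * k\<^sup>2 / c\<^sup>2"
      have "0 \<le> P * (y / t)" "0 \<le> 2 * (t * (cmod a)\<^sup>2)"
        using t by (auto simp: y_def P_def)
      moreover have "8 * k\<^sup>2 * (cmod a)\<^sup>2 * (t / c\<^sup>2) = P * (t * (cmod a)\<^sup>2)"
        by (simp add: P_def)
      moreover have "L * (y / t + t * (cmod a)\<^sup>2) = 2 * (y / t) + P * (y / t) + 2 * (t * (cmod a)\<^sup>2) + P * (t * (cmod a)\<^sup>2)"
        unfolding L_def P_def[symmetric] distrib_left distrib_right by simp
      ultimately show ?thesis by linarith
    qed
    also have "\<dots> \<le> L * D m"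
      using L t unfolding D_def form_density_def
      by (intro mult_left_mono) (auto simp: y_def t_def a_def w_def algebra_simps)
    finally show ?thesis by (simp add: sigma_weight_def w_def t_def norm_mult)
  qed
  have "Re (inner_C3 (T_op \<sigma> \<theta> q) q) \<le> L * A"
    by (rule has_sum_mono[OF T_op_has_sum[OF pd] has_sum_cmult_right[OF D] D1])
  then have "s * Re (inner_C3 q q) \<le> L * A" using s(2)[of q] by linarith
  then have q: "Re (inner_C3 q q) \<le> L / s * A" using s by (simp add: field_simps)
  have uv': "Re (inner_L2 u u) + Re (inner_L2 v v) \<le> 1 / c * A"
    using uv c by (simp add: field_simps)
  have p: "Re (inner_C3 p p) = M * (Re (inner_X b z) - A)" using pos by (simp add: A_def)
  have pA: "A \<le> Re (inner_X b z)"
    using inner_C3_self_nonneg[of p] pos by (simp add: A_def)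
  have "Re (inner_X z z) \<le> (1 / c + L / s) * A + M * (Re (inner_X b z) - A)"
    unfolding z norm_split using q uv' p unfolding z by (simp add: distrib_right)
  also have "\<dots> \<le> (1 / c + L / s) * Re (inner_X b z) + M * Re (inner_X b z)"
    using pA A0 pos c s L by (intro add_mono mult_left_mono) (auto intro!: add_nonneg_nonneg)
  finally show ?thesis by (simp add: L_def k_def distrib_right)
qed

text \<open>With \<open>q\<close> and \<open>p\<close> gone, the kinetic term alone suffices and the
  completed square is dropped as nonnegative. \<open>R\<close> bounds the squared length of the
  modes.\<close>

lemma B_op_high_frequency:
  assumes B: "((u, v, 0, 0), b) \<in> B_op e M Z \<sigma> \<theta>"
    and R: "\<And>m. (norm (ivec m))\<^sup>2 \<le> R \<Longrightarrow> fcoef u m = 0 \<and> fcoef v m = 0"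
  shows "c * (1 + R) * Re (inner_X (u, v, 0, 0) (u, v, 0, 0)) \<le> Re (inner_X b (u, v, 0, 0))"
proof -
  have D: "(form_density (e * sqrt Z) \<sigma> \<theta> u v 0 has_sum Re (inner_X b (u, v, 0, 0))) UNIV"
    using B_op_form[OF B] by (simp add: inner_C3_def)
  have "c * (1 + R) * ((cmod (fcoef u m))\<^sup>2 + (cmod (fcoef v m))\<^sup>2) \<le> form_density (e * sqrt Z) \<sigma> \<theta> u v 0 m" for m
  proof (cases "(norm (ivec m))\<^sup>2 \<le> R")
    case True
    then show ?thesis using R by (simp add: form_density_def)
  next
    case False
    then have "c * (1 + R) \<le> c * (1 + (norm (ivec m))\<^sup>2)" using c by (intro mult_left_mono) auto
    then have "c * (1 + R) \<le> (norm (freq \<theta> m))\<^sup>2" using gap[of m] by linarith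
    then have "c * (1 + R) * ((cmod (fcoef u m))\<^sup>2 + (cmod (fcoef v m))\<^sup>2) \<le> (norm (freq \<theta> m))\<^sup>2 * ((cmod (fcoef u m))\<^sup>2 + (cmod (fcoef v m))\<^sup>2)"
      by (intro mult_right_mono) auto
    also have "\<dots> \<le> form_density (e * sqrt Z) \<sigma> \<theta> u v 0 m" by (simp add: form_density_def)
    finally show ?thesis .
  qed
  from has_sum_mono[OF has_sum_cmult_right[OF has_sum_add[OF L2_parseval_norm[of u] L2_parseval_norm[of v]]] D this]
  show ?thesis by (simp add: norm_split inner_C3_def)
qed

end

section \<open>Counting low modes, and constants uniform over Q\<close>

lemma lattice_ball:
  assumes "R \<ge> 0"
  shows "finite {m. norm (ivec m) \<le> R}" and "real (card {m. norm (ivec m) \<le> R}) \<le> (2 * R + 1) ^ 3"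
proof -
  define N where "N = \<lfloor>R\<rfloor>"
  have N: "N \<ge> 0" using assms by (simp add: N_def)
  let ?B = "{m. norm (ivec m) \<le> R}"
  let ?P = "PiE (UNIV :: 3 set) (\<lambda>_. {- N..N})"
  have sub: "vec_nth ` ?B \<subseteq> ?P"
  proof clarify
    fix m assume m: "norm (ivec m) \<le> R"
    have "m $ j \<in> {- N..N}" for j
    proof -
      have "\<bar>ivec m $ j\<bar> \<le> norm (ivec m)" by (rule component_le_norm_cart)
      then have "\<bar>real_of_int (m $ j)\<bar> \<le> R" using m by simp
      then have "real_of_int \<bar>m $ j\<bar> \<le> R" by simp
      then have "\<bar>m $ j\<bar> \<le> N" by (simp add: N_def le_floor_iff)
      then show ?thesis by auto
    qed
    then show "vec_nth m \<in> ?P" by auto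
  qed
  have inj: "inj_on vec_nth ?B" by (auto simp: inj_on_def vec_nth_inject)
  have finP: "finite ?P" by (intro finite_PiE) auto
  show "finite ?B" using finite_imageD[OF finite_subset[OF sub finP] inj] .
  have "card ?B \<le> card ?P"
    using card_mono[OF finP sub] card_image[OF inj] by simp
  also have "\<dots> = nat (2 * N + 1) ^ 3" by (simp add: card_PiE)
  finally have "real (card ?B) \<le> real (nat (2 * N + 1)) ^ 3"
    by (metis of_nat_le_iff of_nat_power)
  also have "\<dots> = (2 * of_int N + 1) ^ 3" using N by simp
  also have "\<dots> \<le> (2 * R + 1) ^ 3"
    using N by (intro power_mono) (auto simp: N_def)
  finally show "real (card ?B) \<le> (2 * R + 1) ^ 3" .
qed

text \<open>On \<open>Pi_star\<close> the sum of coordinates bounds |\<theta>| by 6 pi, so |xi| >= 2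
  pi |m| - 6 pi >= pi |m| as soon as |m| >= 6.\<close>

lemma freq_lower_bound_far:
  assumes \<theta>: "\<theta> \<in> Pi_star" and m: "norm (ivec m) \<ge> 6"
  shows "1/2 * (1 + (norm (ivec m))\<^sup>2) \<le> (norm (freq \<theta> m))\<^sup>2"
proof -
  have "\<bar>\<theta> $ j\<bar> \<le> 2 * pi" for j
    using \<theta> by (simp add: Pi_star_def mem_box_cart)
  then have "norm \<theta> \<le> (\<Sum>j\<in>(UNIV :: 3 set). 2 * pi)"
    by (intro order_trans[OF norm_le_l1_cart] sum_mono) auto
  then have "norm \<theta> \<le> 6 * pi" by simp
  moreover have "norm (ivec m) * pi \<ge> 6 * pi" using m by (intro mult_right_mono) auto
  moreover have "norm (ivec m) * pi \<ge> norm (ivec m) * 1"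
    using pi_gt3 by (intro mult_left_mono) auto
  moreover have "2 * (norm (ivec m) * pi) \<le> norm (freq \<theta> m) + norm \<theta>"
    using norm_triangle_ineq4[of "freq \<theta> m" \<theta>] by (simp add: freq_def mult_ac)
  ultimately have "norm (ivec m) \<le> norm (freq \<theta> m)" by linarith
  then have 1: "(norm (ivec m))\<^sup>2 \<le> (norm (freq \<theta> m))\<^sup>2" by (intro power_mono) auto
  have "1 \<le> (norm (ivec m))\<^sup>2" using m by (intro one_le_power) auto
  then have "1/2 * (1 + (norm (ivec m))\<^sup>2) \<le> (norm (ivec m))\<^sup>2" by simp
  then show ?thesis using 1 by (rule order_trans)
qed

text \<open>A single mode has a positive minimum of |xi|^2 on the compact set, since xi = 0 would
  put \<theta> into \<open>Gamma_star\<close>. The minimum over all modes is reduced to finitely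
  many by \<open>freq_lower_bound_far\<close>.\<close>

lemma uniform_gap:
  assumes Q: "compact Q" "Q \<subseteq> Pi_star - Gamma_star"
  shows "\<exists>c>0. \<forall>\<theta>\<in>Q. \<forall>m. c * (1 + (norm (ivec m))\<^sup>2) \<le> (norm (freq \<theta> m))\<^sup>2"
proof (cases "Q = {}")
  case True
  then show ?thesis by (intro exI[of _ 1]) auto
next
  case ne: False
  have pos: "0 < 1 + (norm (ivec m))\<^sup>2" for m by (simp add: add_pos_nonneg)
  have "\<exists>c>0. \<forall>\<theta>\<in>Q. c * (1 + (norm (ivec m))\<^sup>2) \<le> (norm (freq \<theta> m))\<^sup>2" for m
  proof -
    have "continuous_on Q (\<lambda>\<theta>. (norm (freq \<theta> m))\<^sup>2)"
      unfolding freq_def by (intro continuous_intros)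
    then obtain \<theta>0 where \<theta>0: "\<theta>0 \<in> Q" "\<And>\<theta>. \<theta> \<in> Q \<Longrightarrow> (norm (freq \<theta>0 m))\<^sup>2 \<le> (norm (freq \<theta> m))\<^sup>2"
      using continuous_attains_inf[OF Q(1) ne] by blast
    have "freq \<theta>0 m \<noteq> 0"
    proof
      assume "freq \<theta>0 m = 0"
      then have "\<theta>0 = (2 * pi) *\<^sub>R ivec (- m)"
        by (simp add: freq_def eq_neg_iff_add_eq_0 add.commute)
      then have "\<theta>0 \<in> Gamma_star" unfolding Gamma_star_def by (rule range_eqI)
      then show False using \<theta>0(1) Q(2) by blast
    qed
    then have "0 < (norm (freq \<theta>0 m))\<^sup>2 / (1 + (norm (ivec m))\<^sup>2)" using pos by simp
    moreover have "(norm (freq \<theta>0 m))\<^sup>2 / (1 + (norm (ivec m))\<^sup>2) * (1 + (norm (ivec m))\<^sup>2) = (norm (freq \<theta>0 m))\<^sup>2"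
      using pos[of m] by simp
    ultimately show ?thesis using \<theta>0(2) by metis
  qed
  then obtain c where c: "\<And>m. c m > 0"
    "\<And>m \<theta>. \<theta> \<in> Q \<Longrightarrow> c m * (1 + (norm (ivec m))\<^sup>2) \<le> (norm (freq \<theta> m))\<^sup>2"
    by metis
  define F where "F = {m. norm (ivec m) \<le> 6}"
  have F: "finite F" unfolding F_def by (rule lattice_ball) simp
  define d where "d = Min (insert (1/2) (c ` F))"
  have "d > 0" using F c by (simp add: d_def)
  moreover have "d * (1 + (norm (ivec m))\<^sup>2) \<le> (norm (freq \<theta> m))\<^sup>2" if \<theta>: "\<theta> \<in> Q" for \<theta> m
  proof (cases "m \<in> F")
    case True
    then have "d \<le> c m" using F by (simp add: d_def)
    then have "d * (1 + (norm (ivec m))\<^sup>2) \<le> c m * (1 + (norm (ivec m))\<^sup>2)"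
      using pos[of m] by (intro mult_right_mono) auto
    then show ?thesis using c(2)[OF \<theta>, of m] by linarith
  next
    case False
    have "d \<le> 1/2" unfolding d_def by (rule Min_le) (use F in auto)
    then have "d * (1 + (norm (ivec m))\<^sup>2) \<le> 1/2 * (1 + (norm (ivec m))\<^sup>2)"
      using pos[of m] by (intro mult_right_mono) auto
    also have "\<dots> \<le> (norm (freq \<theta> m))\<^sup>2"
      using \<theta> Q(2) False by (intro freq_lower_bound_far) (auto simp: F_def)
    finally show ?thesis .
  qed
  ultimately show ?thesis by blast
qed

lemma norm_C3: "Re (inner_C3 q q) = (norm q)\<^sup>2"
  unfolding inner_C3_self by (simp add: norm_vec_def L2_set_def sum_nonneg)

lemma sigma_weight_scale: "sigma_weight \<sigma> \<theta> (r *\<^sub>R q) m = r\<^sup>2 * sigma_weight \<sigma> \<theta> q m"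
proof -
  have "freq_dot \<theta> m (r *\<^sub>R q) = of_real r * freq_dot \<theta> m q"
    unfolding freq_dot_def sum_distrib_left vector_scaleR_component
    by (simp add: scaleR_conv_of_real mult.left_commute)
  then show ?thesis by (simp add: sigma_weight_def norm_mult power_mult_distrib)
qed

text \<open>Positive definiteness speaks of real vectors. If all weights of a complex
  \<open>q\<close> vanished, those of its real and imaginary parts would too, because xi is real,
  and one of the two parts is nonzero.\<close>

lemma sigma_weight_pos:
  assumes pd: "positive_definite (Sigma_mat \<sigma> \<theta>)" and q: "q \<noteq> 0"
  shows "\<exists>m. 0 < sigma_weight \<sigma> \<theta> q m"
proof (rule ccontr)
  assume neg: "\<nexists>m. 0 < sigma_weight \<sigma> \<theta> q m"
  define x where "x = (if (\<chi> j. Re (q $ j)) \<noteq> 0 then (\<chi> j. Re (q $ j)) else (\<chi> j. Im (q $ j)))"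
  define cx where "cx = (\<chi> j. complex_of_real (x $ j))"
  have x: "x \<noteq> 0" using q by (auto simp: x_def vec_eq_iff complex_eq_iff)
  have wx: "sigma_weight \<sigma> \<theta> cx m = 0" for m
  proof -
    have w0: "sigma_weight \<sigma> \<theta> q m = 0"
      using neg sigma_weight_nonneg[of \<sigma> \<theta> q m] by (metis antisym_conv not_le)
    consider "freq \<theta> m = 0" | "fourier \<sigma> (freq \<theta> m) = 0" | "freq_dot \<theta> m q = 0"
      using w0 by (auto simp: sigma_weight_def)
    then show ?thesis
    proof cases
      case 3
      have "Re (freq_dot \<theta> m q) = (\<Sum>j\<in>UNIV. freq \<theta> m $ j * Re (q $ j))"
        "Im (freq_dot \<theta> m q) = (\<Sum>j\<in>UNIV. freq \<theta> m $ j * Im (q $ j))"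
        by (simp_all add: freq_dot_def)
      then have "(\<Sum>j\<in>UNIV. freq \<theta> m $ j * x $ j) = 0"
        using 3 by (auto simp: x_def)
      then have "complex_of_real (\<Sum>j\<in>UNIV. freq \<theta> m $ j * x $ j) = 0" by simp
      then have "freq_dot \<theta> m cx = 0"
        by (simp add: freq_dot_def cx_def)
      then show ?thesis by (simp add: sigma_weight_def)
    qed (simp_all add: sigma_weight_def)
  qed
  have "inner_C3 (T_op \<sigma> \<theta> cx) cx = of_real (x \<bullet> (Sigma_mat \<sigma> \<theta> *v x))"
    by (simp add: inner_C3_def T_op_def matrix_vector_mult_def inner_vec_def cx_def mult.commute)
  then have "(sigma_weight \<sigma> \<theta> cx has_sum x \<bullet> (Sigma_mat \<sigma> \<theta> *v x)) UNIV"
    using T_op_has_sum[OF pd, of cx] by simp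
  then have "x \<bullet> (Sigma_mat \<sigma> \<theta> *v x) = 0"
    by (rule has_sum_unique) (rule has_sum_0, rule wx)
  then show False using pd x unfolding positive_definite_def by force
qed

text \<open>Compactness is applied to finite partial sums: each weight is continuous and nonnegative
  in (\<theta>, q), and at every point of \<open>Q\<close> times the unit sphere some weight is
  positive. Finitely many suffice for the whole compact set, and their sum attains a positive
  minimum below the form of T.\<close>

lemma uniform_T_op:
  assumes \<sigma>: "integrable lborel \<sigma>" and Q: "compact Q" "Q \<subseteq> Pi_star_plus \<sigma>"
  shows "\<exists>s>0. \<forall>\<theta>\<in>Q. \<forall>q. s * Re (inner_C3 q q) \<le> Re (inner_C3 (T_op \<sigma> \<theta> q) q)"
proof (cases "Q = {}")
  case True
  then show ?thesis by (intro exI[of _ 1]) auto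
next
  case ne: False
  have pd: "positive_definite (Sigma_mat \<sigma> \<theta>)" if "\<theta> \<in> Q" for \<theta>
    using that Q(2) by (auto simp: Pi_star_plus_def)
  obtain c where c: "c > 0" "\<And>\<theta> m. \<theta> \<in> Q \<Longrightarrow> c * (1 + (norm (ivec m))\<^sup>2) \<le> (norm (freq \<theta> m))\<^sup>2"
    using uniform_gap[OF Q(1)] Q(2) unfolding Pi_star_plus_def by blast
  define K where "K = Q \<times> sphere (0 :: complex^3) 1"
  have K: "compact K" unfolding K_def by (intro compact_Times Q compact_sphere)
  have neK: "K \<noteq> {}"
  proof -
    have "axis 1 1 \<in> sphere (0 :: complex^3) 1" by simp
    then show ?thesis using ne unfolding K_def by blast
  qed
  define g where "g m y = sigma_weight \<sigma> (fst y) (snd y) m" for m y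
  have cont: "continuous_on K (g m)" for m
  proof -
    have "norm (freq (fst y) m) \<noteq> 0" if "y \<in> K" for y
      using that freq_nz[OF \<sigma> pd c(1) c(2)] by (auto simp: K_def)
    then show ?thesis
      unfolding g_def sigma_weight_def freq_dot_def freq_def
      by (intro continuous_intros continuous_on_compose2[OF continuous_fourier[OF \<sigma>]]) (auto simp: freq_def)
  qed
  have "\<exists>T. open T \<and> K \<inter> g m -` {0<..} = K \<inter> T" for m
    using continuous_openin_preimage_gen[OF cont[of m], of "{0<..}"] by (simp add: openin_open)
  then obtain T where T: "\<And>m. open (T m)" "\<And>m. K \<inter> g m -` {0<..} = K \<inter> T m" by metis
  have "K \<subseteq> (\<Union>m. T m)"
  proof
    fix y assume y: "y \<in> K"
    then have "snd y \<noteq> 0" by (auto simp: K_def)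
    then obtain m where "0 < g m y"
      using sigma_weight_pos[OF pd, of "fst y" "snd y"] y by (auto simp: g_def K_def)
    then show "y \<in> (\<Union>m. T m)" using T(2)[of m] y by blast
  qed
  then obtain F where F: "finite F" "K \<subseteq> (\<Union>m\<in>F. T m)"
    using compactE_image[OF K, of UNIV T] T(1) by (metis subset_UNIV)
  have "continuous_on K (\<lambda>y. \<Sum>m\<in>F. g m y)"
    by (intro continuous_intros cont)
  then obtain y0 where y0: "y0 \<in> K" "\<And>y. y \<in> K \<Longrightarrow> (\<Sum>m\<in>F. g m y0) \<le> (\<Sum>m\<in>F. g m y)"
    using continuous_attains_inf[OF K neK] by blast
  define s where "s = (\<Sum>m\<in>F. g m y0)"
  have "s > 0"
  proof -
    obtain m where m: "m \<in> F" "y0 \<in> T m" using F(2) y0(1) by blast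
    then have "0 < g m y0" using T(2)[of m] y0(1) by blast
    then show ?thesis
      unfolding s_def using F(1) m(1) by (intro sum_pos2) (auto simp: g_def sigma_weight_nonneg)
  qed
  moreover have "s * Re (inner_C3 q q) \<le> Re (inner_C3 (T_op \<sigma> \<theta> q) q)" if \<theta>: "\<theta> \<in> Q" for \<theta> q
  proof (cases "q = 0")
    case True
    then show ?thesis by (simp add: inner_C3_def)
  next
    case False
    define q' where "q' = (1 / norm q) *\<^sub>R q"
    have q: "q = norm q *\<^sub>R q'" using False by (simp add: q'_def)
    have "(\<theta>, q') \<in> K" using \<theta> False by (simp add: K_def q'_def)
    then have "s \<le> (\<Sum>m\<in>F. sigma_weight \<sigma> \<theta> q' m)" using y0(2) unfolding s_def g_def by force
    then have "s * (norm q)\<^sup>2 \<le> (\<Sum>m\<in>F. sigma_weight \<sigma> \<theta> q' m) * (norm q)\<^sup>2"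
      by (rule mult_right_mono) simp
    also have "\<dots> = (\<Sum>m\<in>F. sigma_weight \<sigma> \<theta> q m)"
      by (subst (2) q) (simp add: sigma_weight_scale sum_distrib_right mult.commute)
    also have "\<dots> \<le> Re (inner_C3 (T_op \<sigma> \<theta> q) q)"
      by (rule finite_sum_le_has_sum[OF T_op_has_sum[OF pd[OF \<theta>]] F(1)]) (auto simp: sigma_weight_nonneg)
    finally show ?thesis by (simp add: norm_C3)
  qed
  ultimately show ?thesis by blast
qed

text \<open>Elimination of one unknown per equation. The unknowns are coefficients over an index
  set, so the vectors they multiply may coincide or be dependent.\<close>

lemma homogeneous_system:
  fixes a :: "'p \<Rightarrow> 'i \<Rightarrow> complex"
  assumes "finite P" "finite I" "card P < card I"
  shows "\<exists>c. (\<exists>i\<in>I. c i \<noteq> 0) \<and> (\<forall>p\<in>P. (\<Sum>i\<in>I. c i * a p i) = 0)"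
  using assms
proof (induction P arbitrary: I a rule: finite_induct)
  case empty
  then have "I \<noteq> {}" by auto
  then show ?case by (intro exI[of _ "\<lambda>_. 1"]) auto
next
  case (insert r P)
  show ?case
  proof (cases "\<forall>i\<in>I. a r i = 0")
    case True
    have "card P < card I" using insert by simp
    then obtain c where "\<exists>i\<in>I. c i \<noteq> 0" "\<forall>p\<in>P. (\<Sum>i\<in>I. c i * a p i) = 0"
      using insert.IH[OF insert.prems(1), of a] by blast
    then show ?thesis using True by (intro exI[of _ c]) auto
  next
    case False
    then obtain k where k: "k \<in> I" "a r k \<noteq> 0" by blast
    define J where "J = I - {k}"
    have J: "finite J" "I = insert k J" "k \<notin> J" "card P < card J"
      using insert k by (auto simp: J_def)
    obtain c where c: "\<exists>i\<in>J. c i \<noteq> 0"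
      "\<forall>p\<in>P. (\<Sum>i\<in>J. c i * (a p i - a r i / a r k * a p k)) = 0"
      using insert.IH[OF J(1,4), of "\<lambda>p i. a p i - a r i / a r k * a p k"] by blast
    define d where "d i = (if i = k then - (\<Sum>i\<in>J. c i * a r i) / a r k else c i)" for i
    have sum_d: "(\<Sum>i\<in>I. d i * a p i) = (\<Sum>i\<in>J. c i * (a p i - a r i / a r k * a p k))" for p
    proof -
      have "(\<Sum>i\<in>I. d i * a p i) = d k * a p k + (\<Sum>i\<in>J. d i * a p i)"
        unfolding J(2) using J(1,3) by simp
      also have "(\<Sum>i\<in>J. d i * a p i) = (\<Sum>i\<in>J. c i * a p i)"
        using J(3) by (intro sum.cong) (auto simp: d_def)
      also have "d k * a p k = - (\<Sum>i\<in>J. c i * (a r i / a r k * a p k))"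
        by (simp add: d_def sum_distrib_right sum_divide_distrib mult.assoc)
      finally show ?thesis by (simp add: right_diff_distrib sum_subtractf)
    qed
    have "(\<Sum>i\<in>I. d i * a p i) = 0" if "p \<in> insert r P" for p
      unfolding sum_d using that c(2) k(2) by auto
    moreover have "\<exists>i\<in>I. d i \<noteq> 0" using c(1) J by (auto simp: d_def)
    ultimately show ?thesis by blast
  qed
qed

section \<open>Eigenvectors of \<open>K(\<theta>)\<close>\<close>

lemma inner_X_add_left: "inner_X (x + y) z = inner_X x z + inner_X y z"
  by (cases x; cases y; cases z) (simp add: inner_X_def inner_L2_add_left inner_C3_add_left)

lemma inner_X_scale_left: "inner_X (scale_X c x) z = c * inner_X x z"
  by (cases x; cases z) (simp add: inner_X_def scale_X_def inner_L2_scale_left inner_C3_scale_left distrib_left)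

lemma inner_X_cnj: "cnj (inner_X x y) = inner_X y x"
  by (cases x; cases y) (simp add: inner_X_def inner_L2_cnj inner_C3_cnj)

lemma inner_X_add_right: "inner_X z (x + y) = inner_X z x + inner_X z y"
  using inner_X_add_left[of x y z] by (metis inner_X_cnj complex_cnj_add)

lemma inner_X_scale_right: "inner_X z (scale_X c x) = cnj c * inner_X z x"
  using inner_X_scale_left[of c x z] by (metis inner_X_cnj complex_cnj_mult)

lemma inner_X_zero [simp]: "inner_X 0 z = 0" "inner_X z 0 = 0"
  using inner_X_scale_left[of 0 0 z] inner_X_scale_right[of z 0 0] by simp_all

lemma inner_X_sum_left: "inner_X (\<Sum>i\<in>I. f i) z = (\<Sum>i\<in>I. inner_X (f i) z)"
  by (induction I rule: infinite_finite_induct) (auto simp: inner_X_add_left)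

lemma inner_X_sum_right: "inner_X z (\<Sum>i\<in>I. f i) = (\<Sum>i\<in>I. inner_X z (f i))"
  by (induction I rule: infinite_finite_induct) (auto simp: inner_X_add_right)

lemma inner_X_ge0: "0 \<le> Re (inner_X x x)"
  by (cases x) (simp add: inner_X_def inner_L2_ge0 norm_C3)

lemma inner_X_eq0:
  assumes "Re (inner_X x x) \<le> 0" shows "x = 0"
proof -
  obtain u v q p where x: "x = (u, v, q, p)" by (cases x)
  have "Re (inner_L2 u u) + Re (inner_L2 v v) + (norm q)\<^sup>2 + (norm p)\<^sup>2 \<le> 0"
    using assms by (simp add: x inner_X_def norm_C3)
  then have "Re (inner_L2 u u) = 0" "Re (inner_L2 v v) = 0" "(norm q)\<^sup>2 = 0" "(norm p)\<^sup>2 = 0"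
    using inner_L2_ge0[of u] inner_L2_ge0[of v] zero_le_power2[of "norm q"] zero_le_power2[of "norm p"]
    by linarith+
  then show ?thesis by (simp add: x inner_L2_eq0 zero_prod_def)
qed

definition iJ :: "state \<Rightarrow> state" where
  "iJ x = scale_X \<i> (J_op x)"

lemma iJ_eq: "iJ (u, v, q, p) = (scale_L2 (\<i>/2) v, scale_L2 (-\<i>/2) u, \<i> *s p, (-\<i>) *s q)"
proof -
  have "scale_L2 \<i> (scale_L2 (1/2) v) = scale_L2 (\<i>/2) v" "scale_L2 \<i> (scale_L2 (-1/2) u) = scale_L2 (-\<i>/2) u"
    by (auto intro!: fcoef_inject)
  then show ?thesis by (simp add: iJ_def scale_X_def J_op_def vec_eq_iff)
qed

lemma iJ_add: "iJ (x + y) = iJ x + iJ y"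
  by (cases x; cases y) (auto simp: iJ_eq vec_eq_iff algebra_simps intro!: fcoef_inject)

lemma iJ_scale: "iJ (scale_X c x) = scale_X c (iJ x)"
  by (cases x) (auto simp: iJ_eq scale_X_def vec_eq_iff intro!: fcoef_inject)

lemma inner_L2_scale_right: "inner_L2 u (scale_L2 c v) = cnj c * inner_L2 u v"
  using inner_L2_scale_left[of c v u] by (metis inner_L2_cnj complex_cnj_mult)

lemma inner_C3_scale_right: "inner_C3 u (c *s v) = cnj c * inner_C3 u v"
  using inner_C3_scale_left[of c v u] by (metis inner_C3_cnj complex_cnj_mult)

lemma inner_C3_uminus: "inner_C3 (- p) q = - inner_C3 p q" "inner_C3 p (- q) = - inner_C3 p q"
  by (simp_all add: inner_C3_def sum_negf)

lemma iJ_symmetric: "inner_X (iJ x) y = inner_X x (iJ y)"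
  by (cases x; cases y)
     (simp add: iJ_eq inner_X_def inner_L2_scale_left inner_L2_scale_right inner_C3_scale_left inner_C3_scale_right inner_C3_uminus)

text \<open>\<open>iJ\<close> swaps components with the factor 1/2 on the two L^2 parts and the
  factor 1, up to phase, on the two finite-dimensional parts.\<close>

lemma norm_iJ: "Re (inner_X x x) \<le> 4 * Re (inner_X (iJ x) (iJ x))"
proof -
  obtain u v q p where x: "x = (u, v, q, p)" by (cases x)
  have "4 * inner_X (iJ x) (iJ x) = inner_L2 u u + inner_L2 v v + 4 * inner_C3 q q + 4 * inner_C3 p p"
    unfolding x iJ_eq inner_X_def
    by (simp add: inner_L2_scale_left inner_L2_scale_right inner_C3_scale_left inner_C3_scale_right inner_C3_uminus algebra_simps)
  then have "Re (4 * inner_X (iJ x) (iJ x)) = Re (inner_L2 u u + inner_L2 v v + 4 * inner_C3 q q + 4 * inner_C3 p p)"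
    by simp
  then have "4 * Re (inner_X (iJ x) (iJ x)) = Re (inner_L2 u u) + Re (inner_L2 v v) + 4 * (norm q)\<^sup>2 + 4 * (norm p)\<^sup>2"
    by (simp add: norm_C3)
  moreover have "Re (inner_X x x) = Re (inner_L2 u u) + Re (inner_L2 v v) + (norm q)\<^sup>2 + (norm p)\<^sup>2"
    by (simp add: x inner_X_def norm_C3)
  ultimately show ?thesis
    using zero_le_power2[of "norm q"] zero_le_power2[of "norm p"] by linarith
qed

lemma inner_iJ_bound:
  assumes s: "s = 1 \<or> s = -1"
  shows "s * Re (inner_X x (iJ x)) \<le> 2 * Re (inner_X (iJ x) (iJ x))"
proof -
  let ?y = "iJ x" and ?h = "scale_X (1/2) x"
  \<comment> \<open>At r = -s this is the squared norm of x/2 - s (iJ x), hence nonnegative. The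
    resulting |x|^2 / 4 is then bounded by \<open>norm_iJ\<close>.\<close>
  have sy: "Re (inner_X (?h + scale_X (of_real r) ?y) (?h + scale_X (of_real r) ?y)) =
      1/4 * Re (inner_X x x) + r * Re (inner_X x ?y) + r\<^sup>2 * Re (inner_X ?y ?y)" for r
    using arg_cong[OF iJ_symmetric[of x x], of Re]
    by (simp add: inner_X_add_left inner_X_add_right inner_X_scale_left inner_X_scale_right power2_eq_square algebra_simps)
  have "(- s)\<^sup>2 = 1" using s by auto
  then show ?thesis
    using sy[of "- s"] inner_X_ge0[of "?h + scale_X (of_real (- s)) ?y"] norm_iJ[of x] by simp
qed

lemma state_sum_components:
  fixes z :: "'i \<Rightarrow> state"
  shows "fst (\<Sum>i\<in>I. scale_X (c i) (z i)) = (\<Sum>i\<in>I. scale_L2 (c i) (fst (z i)))"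
    "fst (snd (\<Sum>i\<in>I. scale_X (c i) (z i))) = (\<Sum>i\<in>I. scale_L2 (c i) (fst (snd (z i))))"
    "fst (snd (snd (\<Sum>i\<in>I. scale_X (c i) (z i)))) = (\<Sum>i\<in>I. c i *s fst (snd (snd (z i))))"
    "snd (snd (snd (\<Sum>i\<in>I. scale_X (c i) (z i)))) = (\<Sum>i\<in>I. c i *s snd (snd (snd (z i))))"
  by (simp_all add: fst_sum snd_sum scale_X_def case_prod_beta)

section \<open>Graphs that equal their adjoint, and the operator K\<close>

context
  fixes L :: oper
  assumes sa: "selfadjoint_oper L"
begin

text \<open>Membership becomes a family of conditions additive and homogeneous in the pair; symmetry
  and closure under linear combinations both follow from it.\<close>

lemma oper_mem_iff: "(y, z) \<in> L \<longleftrightarrow> (\<forall>(x, w)\<in>L. inner_X w y = inner_X x z)"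
proof -
  have "adjoint_oper L = L" using sa by (simp add: selfadjoint_oper_def)
  then have "(y, z) \<in> L \<longleftrightarrow> (y, z) \<in> adjoint_oper L" by simp
  then show ?thesis by (simp only: adjoint_oper_def mem_Collect_eq prod.case)
qed

lemma oper_symmetric: "(x, w) \<in> L \<Longrightarrow> (y, z) \<in> L \<Longrightarrow> inner_X w y = inner_X x z"
  using oper_mem_iff by blast

lemma oper_memI: "(\<And>x w. (x, w) \<in> L \<Longrightarrow> inner_X w y = inner_X x z) \<Longrightarrow> (y, z) \<in> L"
  using oper_mem_iff by blast

lemma oper_zero: "(0, 0) \<in> L"
  by (rule oper_memI) simp

lemma oper_add: "(x, w) \<in> L \<Longrightarrow> (y, z) \<in> L \<Longrightarrow> (x + y, w + z) \<in> L"
  by (rule oper_memI) (simp add: inner_X_add_right oper_symmetric)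

lemma oper_scale: "(x, w) \<in> L \<Longrightarrow> (scale_X c x, scale_X c w) \<in> L"
  by (rule oper_memI) (simp add: inner_X_scale_right oper_symmetric)

lemma oper_sum: "finite I \<Longrightarrow> (\<And>i. i \<in> I \<Longrightarrow> (x i, y i) \<in> L) \<Longrightarrow>
    ((\<Sum>i\<in>I. scale_X (c i) (x i)), (\<Sum>i\<in>I. scale_X (c i) (y i))) \<in> L"
  by (induction I rule: finite_induct) (auto intro: oper_zero oper_add oper_scale)

lemma K_op_E:
  assumes "(x, x') \<in> K_op L"
  obtains y where "(x, y) \<in> L" "(iJ y, x') \<in> L"
proof -
  obtain y w where "(x, y) \<in> L" "(y, w) \<in> iJ_op" "(w, x') \<in> L"
    using assms unfolding K_op_def by blast
  moreover from this(2) have "w = iJ y" by (auto simp: iJ_op_def iJ_def)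
  ultimately show ?thesis using that by simp
qed

text \<open>The point is that \<open>x\<close> lies in the range of \<open>\<Lambda>\<close> and \<open>z\<close> in the domain of \<open>\<Lambda>\<^sup>2 = B\<close>, so that the
  explicit form of \<open>B\<close> applies to \<open>z\<close>.\<close>

lemma K_op_eigenvector:
  assumes "x \<in> eigenspace (K_op L) (of_real \<mu>)" "\<mu> \<noteq> 0"
  obtains y z where "(x, y) \<in> L" "(z, x) \<in> L" "iJ y = scale_X (of_real \<mu>) z"
proof -
  obtain y where y: "(x, y) \<in> L" "(iJ y, scale_X (of_real \<mu>) x) \<in> L"
    using assms(1) unfolding eigenspace_def mem_Collect_eq by (rule K_op_E)
  define z where "z = scale_X (of_real (1 / \<mu>)) (iJ y)"
  have inv: "complex_of_real \<mu> * of_real (1 / \<mu>) = 1" "of_real (1 / \<mu>) * complex_of_real \<mu> = 1"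
    using assms(2) by (simp_all flip: of_real_mult)
  have "(z, scale_X (of_real (1 / \<mu>)) (scale_X (of_real \<mu>) x)) \<in> L"
    unfolding z_def by (rule oper_scale[OF y(2)])
  then have "(z, x) \<in> L" unfolding X.scale_scale inv by simp
  moreover have "iJ y = scale_X (of_real \<mu>) z" unfolding z_def X.scale_scale inv by simp
  ultimately show ?thesis using that y(1) by blast
qed

text \<open>The pairing of \<open>iJ y\<close> with \<open>y'\<close> is evaluated twice. Symmetry
  of \<Lambda> turns it into \<mu> times, and symmetry of \<open>iJ\<close> into \<nu> times, the
  inner product of \<open>x\<close> and \<open>x'\<close>.\<close>

lemma eigenvectors_orthogonal:
  assumes "(x, y) \<in> L" "(z, x) \<in> L" "iJ y = scale_X (of_real \<mu>) z"
    and "(x', y') \<in> L" "(z', x') \<in> L" "iJ y' = scale_X (of_real \<nu>) z'" and "\<mu> \<noteq> \<nu>"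
  shows "inner_X x x' = 0"
proof -
  have "inner_X (iJ y) y' = of_real \<mu> * inner_X x x'"
    unfolding assms(3) inner_X_scale_left using oper_symmetric[OF assms(2,4)] by simp
  moreover have "inner_X y (iJ y') = of_real \<nu> * inner_X x x'"
    unfolding assms(6) inner_X_scale_right using oper_symmetric[OF assms(1,5)] by simp
  ultimately have "of_real \<mu> * inner_X x x' = of_real \<nu> * inner_X x x'"
    by (metis iJ_symmetric)
  then show ?thesis using assms(7) by auto
qed

text \<open>The quadratic form of \<open>K\<^sup>-\<^sup>1 = \<Lambda>\<^sup>-\<^sup>1 (iJ)\<^sup>-\<^sup>1 \<Lambda>\<^sup>-\<^sup>1\<close> on a span of eigenvectors with
  eigenvalues of one sign \<open>s\<close>.\<close>

lemma eigenvector_span_bound: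
  fixes \<mu> :: "'i \<Rightarrow> real"
  assumes I: "finite I" and s: "s = 1 \<or> s = -1"
    and \<mu>: "\<And>i. i \<in> I \<Longrightarrow> 0 < s * \<mu> i \<and> s * \<mu> i \<le> r"
    and ev: "\<And>i. i \<in> I \<Longrightarrow> (x i, y i) \<in> L \<and> (z i, x i) \<in> L \<and> iJ (y i) = scale_X (of_real (\<mu> i)) (z i)"
    and X: "X = (\<Sum>i\<in>I. scale_X (c i) (x i))" and Z: "Z = (\<Sum>i\<in>I. scale_X (c i) (z i))"
  shows "Re (inner_X X X) \<le> 2 * r * Re (inner_X Z Z)"
    and "Re (inner_X X X) = (\<Sum>\<nu>\<in>\<mu> ` I. Re (inner_X (\<Sum>i\<in>{i\<in>I. \<mu> i = \<nu>}. scale_X (c i) (x i)) (\<Sum>i\<in>{i\<in>I. \<mu> i = \<nu>}. scale_X (c i) (x i))))"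
proof -
  \<comment> \<open>The component of X for the eigenvalue \<nu>. Vectors of one eigenspace need not
    be orthogonal, so orthogonality is used between these blocks only.\<close>
  define E where "E \<nu> = (\<Sum>i\<in>{i\<in>I. \<mu> i = \<nu>}. scale_X (c i) (x i))" for \<nu>
  \<comment> \<open>\<open>X'\<close> is the inverse of K applied to X, and T = \<Lambda> X'
    satisfies iJ T = Z. Thus the pairing of T with Z equals that of \<open>X'\<close> with X, the
    form of the inverse of K.\<close>
  define T where "T = (\<Sum>i\<in>I. scale_X (c i * of_real (1 / \<mu> i)) (y i))"
  define X' where "X' = (\<Sum>i\<in>I. scale_X (c i * of_real (1 / \<mu> i)) (x i))"
  have nz: "\<mu> i \<noteq> 0" if "i \<in> I" for i using \<mu>[OF that] by auto
  have X'T: "(X', T) \<in> L" unfolding X'_def T_def using I ev by (intro oper_sum) auto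
  have ZX: "(Z, X) \<in> L" unfolding X Z using I ev by (intro oper_sum) auto
  have iJ_sum: "iJ (\<Sum>i\<in>A. f i) = (\<Sum>i\<in>A. iJ (f i))" if "finite A" for A and f :: "'i \<Rightarrow> state"
    using that
  proof (induction A rule: finite_induct)
    case empty
    then show ?case using iJ_scale[of 0 0] by simp
  qed (simp add: iJ_add)
  have iJT: "iJ T = Z"
    unfolding T_def Z iJ_sum[OF I]
  proof (rule sum.cong[OF refl])
    fix i assume i: "i \<in> I"
    have "complex_of_real (1 / \<mu> i) * of_real (\<mu> i) = 1"
      using nz[OF i] by (simp flip: of_real_mult)
    then show "iJ (scale_X (c i * of_real (1 / \<mu> i)) (y i)) = scale_X (c i) (z i)"
      unfolding iJ_scale using ev[OF i] nz[OF i] by (simp add: X.scale_scale mult.assoc)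
  qed
  have grp: "(\<Sum>i\<in>I. f i) = (\<Sum>\<nu>\<in>\<mu> ` I. \<Sum>i\<in>{i\<in>I. \<mu> i = \<nu>}. f i)" for f :: "'i \<Rightarrow> state"
    by (rule sum.image_gen[OF I])
  have XE: "X = (\<Sum>\<nu>\<in>\<mu> ` I. E \<nu>)" unfolding X E_def by (rule grp)
  have X'E: "X' = (\<Sum>\<nu>\<in>\<mu> ` I. scale_X (of_real (1 / \<nu>)) (E \<nu>))"
    unfolding X'_def grp[of "\<lambda>i. scale_X (c i * of_real (1 / \<mu> i)) (x i)"] E_def X.scale_sum_right
    by (intro sum.cong refl) (simp add: X.scale_scale mult.commute)
  have orth: "inner_X (E \<nu>) (E \<kappa>) = 0" if "\<nu> \<noteq> \<kappa>" for \<nu> \<kappa>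
    unfolding E_def inner_X_sum_left
  proof (intro sum.neutral ballI)
    fix i assume i: "i \<in> {i \<in> I. \<mu> i = \<nu>}"
    show "inner_X (scale_X (c i) (x i)) (\<Sum>j\<in>{j\<in>I. \<mu> j = \<kappa>}. scale_X (c j) (x j)) = 0"
      unfolding inner_X_sum_right
    proof (intro sum.neutral ballI)
      fix j assume "j \<in> {j \<in> I. \<mu> j = \<kappa>}"
      then have "inner_X (x i) (x j) = 0"
        using eigenvectors_orthogonal[of "x i" "y i" "z i" "\<mu> i" "x j" "y j" "z j" "\<mu> j"] ev[of i] ev[of j] that i by auto
      then show "inner_X (scale_X (c i) (x i)) (scale_X (c j) (x j)) = 0"
        by (simp add: inner_X_scale_left inner_X_scale_right)
    qed
  qed
  have fin: "finite (\<mu> ` I)" using I by simp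
  have diag: "inner_X (\<Sum>\<nu>\<in>\<mu> ` I. scale_X (d \<nu>) (E \<nu>)) X = (\<Sum>\<nu>\<in>\<mu> ` I. d \<nu> * inner_X (E \<nu>) (E \<nu>))" for d
  proof -
    have "inner_X (E \<nu>) X = inner_X (E \<nu>) (E \<nu>)" if "\<nu> \<in> \<mu> ` I" for \<nu>
    proof -
      have "(\<Sum>\<kappa>\<in>\<mu> ` I. inner_X (E \<nu>) (E \<kappa>)) = (\<Sum>\<kappa>\<in>{\<nu>}. inner_X (E \<nu>) (E \<kappa>))"
        using that fin orth by (intro sum.mono_neutral_right) auto
      then show ?thesis by (simp add: XE inner_X_sum_right)
    qed
    then show ?thesis by (simp add: inner_X_sum_left inner_X_scale_left)
  qed
  have XX: "inner_X X X = (\<Sum>\<nu>\<in>\<mu> ` I. inner_X (E \<nu>) (E \<nu>))"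
    using diag[of "\<lambda>_. 1"] by (simp flip: XE)
  then show XX': "Re (inner_X X X) = (\<Sum>\<nu>\<in>\<mu> ` I. Re (inner_X (\<Sum>i\<in>{i\<in>I. \<mu> i = \<nu>}. scale_X (c i) (x i)) (\<Sum>i\<in>{i\<in>I. \<mu> i = \<nu>}. scale_X (c i) (x i))))"
    by (simp add: E_def)
  have "inner_X T Z = (\<Sum>\<nu>\<in>\<mu> ` I. of_real (1 / \<nu>) * inner_X (E \<nu>) (E \<nu>))"
    using oper_symmetric[OF X'T ZX] diag[of "\<lambda>\<nu>. of_real (1 / \<nu>)"] unfolding X'E by (rule trans)
  then have "s * Re (inner_X T Z) = (\<Sum>\<nu>\<in>\<mu> ` I. s * (1 / \<nu> * Re (inner_X (E \<nu>) (E \<nu>))))"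
    by (simp add: sum_distrib_left del: of_real_divide)
  also have "\<dots> \<ge> (\<Sum>\<nu>\<in>\<mu> ` I. 1 / r * Re (inner_X (E \<nu>) (E \<nu>)))"
  proof (rule sum_mono)
    fix \<nu> assume "\<nu> \<in> \<mu> ` I"
    then have \<nu>: "0 < s * \<nu>" "s * \<nu> \<le> r" using \<mu> by auto
    \<comment> \<open>The common sign makes every s / \<nu> positive and at least 1 / r, so the
      blocks add up without cancellation.\<close>
    have "1 / r \<le> 1 / (s * \<nu>)" using \<nu> by (intro divide_left_mono) auto
    also have "\<dots> = s * (1 / \<nu>)" using s by auto
    finally have "1 / r * Re (inner_X (E \<nu>) (E \<nu>)) \<le> s * (1 / \<nu>) * Re (inner_X (E \<nu>) (E \<nu>))"
      by (rule mult_right_mono) (rule inner_X_ge0)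
    then show "1 / r * Re (inner_X (E \<nu>) (E \<nu>)) \<le> s * (1 / \<nu> * Re (inner_X (E \<nu>) (E \<nu>)))"
      by (simp only: mult.assoc)
  qed
  also have "(\<Sum>\<nu>\<in>\<mu> ` I. 1 / r * Re (inner_X (E \<nu>) (E \<nu>))) = 1 / r * Re (inner_X X X)"
    unfolding XX by (simp add: sum_divide_distrib)
  finally have 1: "1 / r * Re (inner_X X X) \<le> s * Re (inner_X T Z)" .
  have 2: "s * Re (inner_X T Z) \<le> 2 * Re (inner_X Z Z)"
    using inner_iJ_bound[OF s, of T] unfolding iJT .
  show "Re (inner_X X X) \<le> 2 * r * Re (inner_X Z Z)"
  proof (cases "I = {}")
    case True
    then show ?thesis by (simp add: X Z)
  next
    case False
    then have "r > 0" using \<mu> by force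
    moreover have "1 / r * Re (inner_X X X) \<le> 2 * Re (inner_X Z Z)"
      using 1 2 by (rule order_trans)
    ultimately show ?thesis by (simp add: field_simps)
  qed
qed

end

section \<open>Counting eigenvalues\<close>

text \<open>The linear functionals whose vanishing leaves only modes beyond \<open>R\<close>. As a
  set it may merge equal functionals, which is harmless since only an upper bound on its size is
  wanted.\<close>

definition low_modes :: "real \<Rightarrow> (state \<Rightarrow> complex) set" where
  "low_modes R = (\<lambda>m z. fcoef (fst z) m) ` {m. norm (ivec m) \<le> R} \<union>
     (\<lambda>m z. fcoef (fst (snd z)) m) ` {m. norm (ivec m) \<le> R} \<union>
     (\<lambda>j z. fst (snd (snd z)) $ j) ` UNIV \<union> (\<lambda>j z. snd (snd (snd z)) $ j) ` UNIV"

lemma finite_low_modes: "R \<ge> 0 \<Longrightarrow> finite (low_modes R)"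
  unfolding low_modes_def using lattice_ball(1) by auto

lemma card_low_modes:
  assumes "R \<ge> 0" shows "real (card (low_modes R)) \<le> 2 * (2 * R + 1) ^ 3 + 6"
proof -
  let ?F = "{m. norm (ivec m) \<le> R}"
  note F = lattice_ball[OF assms]
  have "card (low_modes R) \<le> card ?F + card ?F + card (UNIV :: 3 set) + card (UNIV :: 3 set)"
    unfolding low_modes_def
    by (intro order_trans[OF card_Un_le] add_mono card_image_le F finite)
  then have "card (low_modes R) \<le> 2 * card ?F + 6" by simp
  then have "real (card (low_modes R)) \<le> real (2 * card ?F + 6)" by (simp only: of_nat_le_iff)
  then show ?thesis using F(2) by simp
qed

lemma low_modes_linear:
  assumes "f \<in> low_modes R"
  shows "f (\<Sum>i\<in>I. scale_X (c i) (z i)) = (\<Sum>i\<in>I. c i * f (z i))"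
  using assms unfolding low_modes_def by (auto simp: state_sum_components)

context
  fixes e M Z c r :: real and \<sigma> :: "real^3 \<Rightarrow> real" and \<theta> :: "real^3" and L :: oper and w :: "nat \<Rightarrow> real"
  assumes pos: "e > 0" "M > 0" "Z > 0"
    and \<sigma>: "integrable lborel \<sigma>" and pd: "positive_definite (Sigma_mat \<sigma> \<theta>)" and c: "c > 0"
    and gap: "\<And>m. c * (1 + (norm (ivec m))\<^sup>2) \<le> (norm (freq \<theta> m))\<^sup>2"
    and r: "r > 0" "\<And>q. r * Re (inner_C3 q q) \<le> Re (inner_C3 (T_op \<sigma> \<theta> q) q)"
    and L: "is_sqrt_oper L (B_op e M Z \<sigma> \<theta>)"
    and w: "eigenvalue_enumeration (K_op L) w"
begin

abbreviation coercivity_constant :: real where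
  "coercivity_constant \<equiv> 1 / c + (2 + 8 * (e * sqrt Z)\<^sup>2 / c\<^sup>2) / r + M"

lemma sa: "selfadjoint_oper L" and LL: "L O L = B_op e M Z \<sigma> \<theta>"
  using L by (auto simp: is_sqrt_oper_def)

text \<open>For x = \<Lambda> z the form of B at z is the squared norm of x, so a bound on B becomes
  a comparison of the norms of z and x.\<close>

lemma coercive:
  assumes "(z, x) \<in> L" "(x, y) \<in> L"
  shows "Re (inner_X z z) \<le> coercivity_constant * Re (inner_X x x)"
proof -
  have "(z, y) \<in> B_op e M Z \<sigma> \<theta>" using assms LL by blast
  from B_op_coercive[OF pos \<sigma> pd c gap this r] show ?thesis
    using oper_symmetric[OF sa assms(2,1)] by simp
qed

lemma high_frequency:
  assumes zx: "(z, x) \<in> L" "(x, y) \<in> L" and z: "\<And>f. f \<in> low_modes R \<Longrightarrow> f z = 0" and R: "R \<ge> 0"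
  shows "c * (1 + R\<^sup>2) * Re (inner_X z z) \<le> Re (inner_X x x)"
proof -
  obtain u v q p where zz: "z = (u, v, q, p)" by (cases z)
  have "q $ j = 0" "p $ j = 0" for j
    using z[of "\<lambda>z. fst (snd (snd z)) $ j"] z[of "\<lambda>z. snd (snd (snd z)) $ j"]
    by (auto simp: low_modes_def zz)
  then have qp: "q = 0" "p = 0" by (simp_all add: vec_eq_iff)
  have low: "fcoef u m = 0 \<and> fcoef v m = 0" if "(norm (ivec m))\<^sup>2 \<le> R\<^sup>2" for m
  proof -
    have "norm (ivec m) \<le> R" using that R by (rule power2_le_imp_le)
    then have "(\<lambda>z. fcoef (fst z) m) \<in> low_modes R" "(\<lambda>z. fcoef (fst (snd z)) m) \<in> low_modes R"
      unfolding low_modes_def by blast+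
    from z[OF this(1)] z[OF this(2)] show ?thesis by (simp add: zz)
  qed
  have "(z, y) \<in> B_op e M Z \<sigma> \<theta>" using zx LL by blast
  then have "((u, v, 0, 0), y) \<in> B_op e M Z \<sigma> \<theta>" by (simp only: zz qp)
  from B_op_high_frequency[OF pos \<sigma> pd c gap this low] show ?thesis
    using oper_symmetric[OF sa zx(2,1)] by (simp add: zz qp)
qed

text \<open>Coercivity makes \<Lambda> injective on vectors with image 0; it is used twice, around
  the injective \<open>iJ\<close>. Consequently no index of the enumeration carries the value
  0.\<close>

lemma K_op_kernel:
  assumes "x \<in> eigenspace (K_op L) 0" shows "x = 0"
proof -
  have "(x, 0) \<in> K_op L" using assms by (simp add: eigenspace_def)
  then obtain y where y: "(x, y) \<in> L" "(iJ y, 0) \<in> L" by (rule K_op_E[OF sa])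
  have "Re (inner_X (iJ y) (iJ y)) \<le> 0"
    using coercive[OF y(2) oper_zero[OF sa]] by simp
  then have "y = 0" using norm_iJ[of y] by (intro inner_X_eq0) linarith
  then have "Re (inner_X x x) \<le> 0"
    using coercive[OF _ oper_zero[OF sa], of x] y(1) by simp
  then show ?thesis by (rule inner_X_eq0)
qed

lemma eigenvectors_exist:
  obtains x where
    "\<And>k. 1 \<le> k \<Longrightarrow> x k \<in> eigenspace (K_op L) (of_real (w k))"
    "\<And>k. 1 \<le> k \<Longrightarrow> w k \<noteq> 0"
    "\<And>J a \<nu>. finite J \<Longrightarrow> J \<subseteq> {k. 1 \<le> k \<and> w k = \<nu>} \<Longrightarrow> (\<Sum>j\<in>J. scale_X (a j) (x j)) = 0 \<Longrightarrow> \<forall>j\<in>J. a j = 0"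
proof -
  define I where "I \<mu> = {k. 1 \<le> k \<and> complex_of_real (w k) = \<mu>}" for \<mu>
  have "\<forall>\<mu>. \<exists>v. inj_on v (I \<mu>) \<and> \<not> X_dependent (v ` I \<mu>) \<and> X_span (v ` I \<mu>) = eigenspace (K_op L) \<mu>"
    using w by (simp add: eigenvalue_enumeration_def I_def Let_def)
  then obtain v where v: "\<And>\<mu>. inj_on (v \<mu>) (I \<mu>)" "\<And>\<mu>. \<not> X_dependent (v \<mu> ` I \<mu>)"
    "\<And>\<mu>. X_span (v \<mu> ` I \<mu>) = eigenspace (K_op L) \<mu>"
    by metis
  \<comment> \<open>The enumeration offers a separate labelling \<open>v\<close> for each
    eigenvalue; the diagonal choice selects for index \<open>k\<close> the labelling of its own
    eigenvalue.\<close>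
  define x where "x k = v (of_real (w k)) k" for k
  have mem: "x k \<in> v (of_real (w k)) ` I (of_real (w k))" if "1 \<le> k" for k
    using that by (auto simp: x_def I_def)
  have eig: "x k \<in> eigenspace (K_op L) (of_real (w k))" if "1 \<le> k" for k
    unfolding v(3)[symmetric] by (rule X.span_base[OF mem[OF that]])
  have nz: "w k \<noteq> 0" if k: "1 \<le> k" for k
  proof
    assume 0: "w k = 0"
    then have "x k = 0" using K_op_kernel eig[OF k] by simp
    then show False using X.dependent_zero mem[OF k] v(2) by metis
  qed
  have ind: "\<forall>j\<in>J. a j = 0" if J: "finite J" "J \<subseteq> {k. 1 \<le> k \<and> w k = \<nu>}"
    and 0: "(\<Sum>j\<in>J. scale_X (a j) (x j)) = 0" for J a \<nu>
  proof
    fix j assume j: "j \<in> J"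
    let ?v = "v (of_real \<nu>)"
    have JI: "J \<subseteq> I (of_real \<nu>)" using J(2) by (auto simp: I_def)
    have inj: "inj_on ?v J" by (rule inj_on_subset[OF v(1) JI])
    have xv: "x j = ?v j" if "j \<in> J" for j using that J(2) by (auto simp: x_def)
    \<comment> \<open>Independence is stated for sets of vectors, so coefficients are carried from
      indices to vectors; injectivity of the labelling ensures that no two indices are
      merged.\<close>
    define b where "b = a \<circ> the_inv_into J ?v"
    have bv: "b (?v j) = a j" if "j \<in> J" for j
      using the_inv_into_f_f[OF inj that] by (simp add: b_def)
    have "(\<Sum>y\<in>?v ` J. scale_X (b y) y) = (\<Sum>j\<in>J. scale_X (a j) (x j))"
      unfolding sum.reindex[OF inj] o_def by (intro sum.cong refl) (simp add: bv xv)
    then have "(\<Sum>y\<in>?v ` J. scale_X (b y) y) = 0" using 0 by simp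
    then have "b (?v j) = 0"
      using X.independentD[OF v(2), of "?v ` J" "of_real \<nu>" b "?v j"] J(1) JI j by blast
    then show "a j = 0" using bv[OF j] by simp
  qed
  show ?thesis by (rule that[OF eig nz ind])
qed

lemma eigenvalue_lower_bound:
  assumes k: "1 \<le> k"
  shows "real k powr (2/3) \<le> 2 * coercivity_constant * 120 powr (2/3) * \<bar>w k\<bar>"
proof -
  define C where "C = coercivity_constant"
  have Cc: "1 / c \<le> C" and C0: "C > 0"
  proof -
    have "0 \<le> (2 + 8 * (e * sqrt Z)\<^sup>2 / c\<^sup>2) / r" "0 < 1 / c"
      using c r(1) by (auto intro!: divide_nonneg_nonneg add_nonneg_nonneg)
    then show "1 / c \<le> C" "C > 0" using pos unfolding C_def by linarith+
  qed
  obtain x where x: "\<And>k. 1 \<le> k \<Longrightarrow> x k \<in> eigenspace (K_op L) (of_real (w k))"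
    and nz: "\<And>k. 1 \<le> k \<Longrightarrow> w k \<noteq> 0"
    and ind: "\<And>J a \<nu>. finite J \<Longrightarrow> J \<subseteq> {k. 1 \<le> k \<and> w k = \<nu>} \<Longrightarrow> (\<Sum>j\<in>J. scale_X (a j) (x j)) = 0 \<Longrightarrow> \<forall>j\<in>J. a j = 0"
    by (rule eigenvectors_exist) (rule that)
  \<comment> \<open>The premise is kept inside because index 0 carries no eigenvector.\<close>
  have "\<exists>y z. 1 \<le> k \<longrightarrow> (x k, y) \<in> L \<and> (z, x k) \<in> L \<and> iJ y = scale_X (of_real (w k)) z" for k
    using K_op_eigenvector[OF sa x nz] by metis
  then obtain y z where yz: "\<And>k. 1 \<le> k \<Longrightarrow> (x k, y k) \<in> L \<and> (z k, x k) \<in> L \<and> iJ (y k) = scale_X (of_real (w k)) (z k)"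
    by metis
  define l where "l = \<bar>w k\<bar>"
  have l: "l > 0" using nz[OF k] by (simp add: l_def)
  have mono: "\<bar>w j\<bar> \<le> l" if "1 \<le> j" "j \<le> k" for j
    using w that by (simp add: eigenvalue_enumeration_def l_def)
  define I where "I s = {j\<in>{1..k}. 0 < s * w j}" for s :: real
  have finI: "finite (I s)" for s by (simp add: I_def)
  have I1: "1 \<le> j" if "j \<in> I s" for j s using that by (simp add: I_def)
  have bound: "0 < Re (inner_X (\<Sum>j\<in>I s. scale_X (a j) (x j)) (\<Sum>j\<in>I s. scale_X (a j) (x j)))
      \<and> Re (inner_X (\<Sum>j\<in>I s. scale_X (a j) (x j)) (\<Sum>j\<in>I s. scale_X (a j) (x j)))
        \<le> 2 * l * Re (inner_X (\<Sum>j\<in>I s. scale_X (a j) (z j)) (\<Sum>j\<in>I s. scale_X (a j) (z j)))"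
    if s: "s = 1 \<or> s = -1" and a: "\<exists>j\<in>I s. a j \<noteq> 0" for s a
  proof -
    have ws: "0 < s * w j \<and> s * w j \<le> l" if "j \<in> I s" for j
      using that s mono[of j] by (auto simp: I_def)
    have evs: "(x j, y j) \<in> L \<and> (z j, x j) \<in> L \<and> iJ (y j) = scale_X (of_real (w j)) (z j)" if "j \<in> I s" for j
      using yz[OF I1[OF that]] .
    note e = eigenvector_span_bound[where c = a and I = "I s" and \<mu> = w, OF sa finI s ws evs refl refl]
    let ?E = "\<lambda>\<nu>. \<Sum>i\<in>{i \<in> I s. w i = \<nu>}. scale_X (a i) (x i)"
    obtain j where j: "j \<in> I s" "a j \<noteq> 0" using a by blast
    \<comment> \<open>One nonzero block suffices for a nonzero X, since the squared norm of X is the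
      sum over the blocks.\<close>
    have "?E (w j) \<noteq> 0"
    proof
      assume "?E (w j) = 0"
      moreover have "{i \<in> I s. w i = w j} \<subseteq> {k. 1 \<le> k \<and> w k = w j}" using I1 by auto
      ultimately have "\<forall>i\<in>{i \<in> I s. w i = w j}. a i = 0" using finI by (intro ind) auto
      then show False using j by auto
    qed
    then have "0 < Re (inner_X (?E (w j)) (?E (w j)))"
      using inner_X_eq0 not_le by blast
    then have "0 < (\<Sum>\<nu>\<in>w ` I s. Re (inner_X (?E \<nu>) (?E \<nu>)))"
      using finI j(1) by (intro sum_pos2[of _ "w j"]) (auto simp: inner_X_ge0)
    then show ?thesis using e by simp
  qed
  have mem: "((\<Sum>j\<in>I s. scale_X (a j) (z j)), (\<Sum>j\<in>I s. scale_X (a j) (x j))) \<in> L"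
    "((\<Sum>j\<in>I s. scale_X (a j) (x j)), (\<Sum>j\<in>I s. scale_X (a j) (y j))) \<in> L" for s a
    using yz I1 by (intro oper_sum[OF sa finI]; blast)+
  \<comment> \<open>The square of the cutoff radius. The span bound followed by coercivity gives
    |X|^2 <= 2 l |Z|^2 <= t |X|^2 with X nonzero, so t is at least 1.\<close>
  define t where "t = 2 * l * C"
  have t0: "t > 0" using l C0 by (simp add: t_def)
  have t1: "1 \<le> t" if s: "s = 1 \<or> s = -1" and ne: "I s \<noteq> {}" for s
  proof -
    let ?X = "\<Sum>j\<in>I s. scale_X 1 (x j)" and ?Z = "\<Sum>j\<in>I s. scale_X 1 (z j)"
    have b: "0 < Re (inner_X ?X ?X)" "Re (inner_X ?X ?X) \<le> 2 * l * Re (inner_X ?Z ?Z)"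
      using bound[OF s, of "\<lambda>_. 1"] ne by auto
    have "Re (inner_X ?Z ?Z) \<le> C * Re (inner_X ?X ?X)"
      using coercive[OF mem(1)[where a = "\<lambda>_. 1" and s = s] mem(2)[where a = "\<lambda>_. 1" and s = s]] unfolding C_def .
    then have "2 * l * Re (inner_X ?Z ?Z) \<le> 2 * l * (C * Re (inner_X ?X ?X))"
      using l by (intro mult_left_mono) auto
    then have "1 * Re (inner_X ?X ?X) \<le> t * Re (inner_X ?X ?X)"
      using b(2) by (simp add: t_def mult.assoc)
    then show ?thesis using b(1) by (simp only: mult_le_cancel_right_pos)
  qed
  define R where "R = sqrt t"
  have R: "R \<ge> 0" "R\<^sup>2 = t" using t0 by (simp_all add: R_def)
  \<comment> \<open>C >= 1/c gives c R^2 >= 2 l, and the extra c makes the inequality strict, as the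
    contradiction below requires.\<close>
  have cR: "2 * l < c * (1 + R\<^sup>2)"
  proof -
    have "2 * l * (c * (1 / c)) \<le> 2 * l * (c * C)"
      using Cc l c by (intro mult_left_mono) auto
    then have "2 * l \<le> c * t" using c by (simp add: t_def mult_ac)
    then show ?thesis using c R(2) by (simp add: distrib_left)
  qed
  have cardI: "card (I s) \<le> card (low_modes R)" if s: "s = 1 \<or> s = -1" for s
  proof (rule ccontr)
    assume "\<not> card (I s) \<le> card (low_modes R)"
    then obtain a where a: "\<exists>j\<in>I s. a j \<noteq> 0" "\<forall>f\<in>low_modes R. (\<Sum>j\<in>I s. a j * f (z j)) = 0"
      using homogeneous_system[OF finite_low_modes[OF R(1)] finI, of s "\<lambda>f j. f (z j)"] by auto
    let ?X = "\<Sum>j\<in>I s. scale_X (a j) (x j)" and ?Z = "\<Sum>j\<in>I s. scale_X (a j) (z j)"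
    have b: "0 < Re (inner_X ?X ?X)" "Re (inner_X ?X ?X) \<le> 2 * l * Re (inner_X ?Z ?Z)"
      using bound[OF s a(1)] by auto
    have low: "f ?Z = 0" if "f \<in> low_modes R" for f
      using a(2) that by (simp add: low_modes_linear[OF that])
    have "c * (1 + R\<^sup>2) * Re (inner_X ?Z ?Z) \<le> Re (inner_X ?X ?X)"
      by (rule high_frequency[OF mem(1)[where a = a and s = s] mem(2)[where a = a and s = s] _ R(1)]) (rule low)
    then have "c * (1 + R\<^sup>2) * Re (inner_X ?Z ?Z) \<le> 2 * l * Re (inner_X ?Z ?Z)" using b(2) by linarith
    \<comment> \<open>Otherwise the span bound would make X vanish.\<close>
    moreover have "0 < Re (inner_X ?Z ?Z)"
      using b l inner_X_ge0[of ?Z] by (cases "Re (inner_X ?Z ?Z) = 0") auto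
    ultimately show False using cR by (simp add: mult_le_cancel_right)
  qed
  have "{1..k} = I 1 \<union> I (-1)"
    using nz by (auto simp: I_def) (metis linorder_neqE_linordered_idom)
  then have "k = card (I 1 \<union> I (-1))" by (metis card_atLeastAtMost diff_Suc_1)
  also have "\<dots> \<le> card (I 1) + card (I (-1))" by (rule card_Un_le)
  also have "\<dots> \<le> 2 * card (low_modes R)" using cardI[of 1] cardI[of "-1"] by simp
  finally have "real k \<le> real (2 * card (low_modes R))" by (simp only: of_nat_le_iff)
  also have "\<dots> \<le> 2 * (2 * (2 * R + 1) ^ 3 + 6)" using card_low_modes[OF R(1)] by simp
  \<comment> \<open>R >= 1 yields 2 R + 1 <= 3 R and 6 <= 6 R^3, and 2 (2 * 27 + 6) = 120.\<close>
  also have "\<dots> \<le> 120 * R ^ 3"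
  proof -
    have "I 1 \<noteq> {} \<or> I (-1) \<noteq> {}" using \<open>{1..k} = I 1 \<union> I (-1)\<close> k by auto
    then have "1 \<le> t" using t1 by auto
    then have R1: "1 \<le> R" by (simp add: R_def)
    have "(2 * R + 1) ^ 3 \<le> (3 * R) ^ 3" using R1 by (intro power_mono) auto
    moreover have "1 \<le> R ^ 3" using R1 by (rule one_le_power)
    ultimately show ?thesis by (simp add: power_mult_distrib)
  qed
  finally have kR: "real k \<le> 120 * R ^ 3" .
  have Rp: "R > 0" using t0 by (simp add: R_def)
  have "real k powr (2/3) \<le> (120 * R ^ 3) powr (2/3)"
    using kR by (intro powr_mono2) auto
  also have "\<dots> = 120 powr (2/3) * (R ^ 3) powr (2/3)"
    by (rule powr_mult)
  also have "(R ^ 3) powr (2/3) = R\<^sup>2"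
  proof -
    have "(R ^ 3) powr (2/3) = (R powr real 3) powr (2/3)"
      by (simp only: powr_realpow[OF Rp])
    also have "\<dots> = R powr real 2" unfolding powr_powr by simp
    also have "\<dots> = R\<^sup>2" by (rule powr_realpow[OF Rp])
    finally show ?thesis .
  qed
  also have "120 powr (2/3) * R\<^sup>2 = 2 * C * 120 powr (2/3) * \<bar>w k\<bar>"
    unfolding R(2) t_def l_def by simp
  finally show ?thesis unfolding C_def .
qed

end

theorem lemma3p1:
  fixes e M Z :: real
    and \<sigma> :: "real^3 \<Rightarrow> real"
    and \<Lambda> :: "real^3 \<Rightarrow> oper"
    and \<omega> :: "real^3 \<Rightarrow> nat \<Rightarrow> real"
    and Q :: "(real^3) set"
  assumes "e > 0" and "M > 0" and "Z > 0"
    and "integrable lborel \<sigma>"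
    and "(LINT x|lborel. \<sigma> x) = e * Z"
    and "helmholtz_L1 \<sigma>"
    and wiener: "AE \<theta> in lborel. \<theta> \<in> Pi_star - Gamma_star \<longrightarrow> positive_definite (Sigma_mat \<sigma> \<theta>)"
    and jellium: "\<And>m::int^3. m \<noteq> 0 \<Longrightarrow> fourier \<sigma> ((2 * pi) *\<^sub>R ivec m) = 0"
    and sqrt_B: "\<And>\<theta>. \<theta> \<in> Pi_star_plus \<sigma> \<Longrightarrow> is_sqrt_oper (\<Lambda> \<theta>) (B_op e M Z \<sigma> \<theta>)"
    and dispersion: "\<And>\<theta>. \<theta> \<in> Pi_star_plus \<sigma> \<Longrightarrow> eigenvalue_enumeration (K_op (\<Lambda> \<theta>)) (\<omega> \<theta>)"
    and "compact Q" and "Q \<subseteq> Pi_star_plus \<sigma>"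
  shows "\<exists>\<epsilon>>0. \<forall>\<theta>\<in>Q. \<forall>k\<ge>1. \<epsilon> * real k powr (2/3) \<le> \<bar>\<omega> \<theta> k\<bar>"
proof -
  have "Q \<subseteq> Pi_star - Gamma_star" using \<open>Q \<subseteq> Pi_star_plus \<sigma>\<close> by (auto simp: Pi_star_plus_def)
  then obtain c where c: "c > 0" "\<And>\<theta> m. \<theta> \<in> Q \<Longrightarrow> c * (1 + (norm (ivec m))\<^sup>2) \<le> (norm (freq \<theta> m))\<^sup>2"
    using uniform_gap[OF \<open>compact Q\<close>] by blast
  obtain r where r: "r > 0" "\<And>\<theta> q. \<theta> \<in> Q \<Longrightarrow> r * Re (inner_C3 q q) \<le> Re (inner_C3 (T_op \<sigma> \<theta> q) q)"
    using uniform_T_op[OF \<open>integrable lborel \<sigma>\<close> \<open>compact Q\<close> \<open>Q \<subseteq> Pi_star_plus \<sigma>\<close>] by blast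
  \<comment> \<open>The constant involves \<theta> only through \<open>c\<close> and
    \<open>r\<close>, both already uniform over \<open>Q\<close>.\<close>
  define C where "C = 2 * (1 / c + (2 + 8 * (e * sqrt Z)\<^sup>2 / c\<^sup>2) / r + M) * 120 powr (2/3)"
  have C: "C > 0"
    unfolding C_def using c(1) r(1) \<open>M > 0\<close>
    by (intro mult_pos_pos add_nonneg_pos add_nonneg_nonneg divide_nonneg_nonneg) auto
  show ?thesis
  proof (intro exI[of _ "1 / C"] conjI ballI allI impI)
    fix \<theta> k assume \<theta>: "\<theta> \<in> Q" and k: "1 \<le> (k::nat)"
    then have \<theta>': "\<theta> \<in> Pi_star_plus \<sigma>" using \<open>Q \<subseteq> Pi_star_plus \<sigma>\<close> by blast
    then have "positive_definite (Sigma_mat \<sigma> \<theta>)" by (simp add: Pi_star_plus_def)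
    then have "real k powr (2/3) \<le> C * \<bar>\<omega> \<theta> k\<bar>"
      unfolding C_def
      by (intro eigenvalue_lower_bound[OF assms(1-4) _ c(1) c(2)[OF \<theta>] r(1) r(2)[OF \<theta>] sqrt_B[OF \<theta>'] dispersion[OF \<theta>'] k])
    then show "1 / C * real k powr (2/3) \<le> \<bar>\<omega> \<theta> k\<bar>"
      using C by (simp add: field_simps)
  qed (use C in simp)
qed

end
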